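(* Fix an integer $n\ge 3$, and let $l\in\mathbb N=\{1,2,3,\dots\}$. If $n$ is divisible by $l+1$, and $k:=\frac{nl}{l+1}$ is such that $0\le k\le n-2$, then $\mathrm{Dgm}_{2l}^{\mathfrak D}(G_n)$ consists of precisely the point $\left(\frac{nl}{l+1},\frac{nl}{l+1}+1\right)$ with multiplicity $\frac{n}{l+1}-1$. If $l$ or $k$ do not satisfy these conditions, then $\mathrm{Dgm}_{2l}^{\mathfrak D}(G_n)$ is trivial.
   Context: The cycle network $G_n=(X_n,\omega_{G_n})$ has node set $X_n=\{x_1,\dots,x_n\}$, and $\omega_{G_n}(x,x')$ is the shortest (directed) path distance in the directed graph with edges $(x_1,x_2),(x_2,x_3),\dots,(x_{n-1},x_n),(x_n,x_1)$, each of weight $1$ (so $\omega_{G_n}(x_i,x_j)$ is the representative of $j-i$ modulo $n$ in $\{0,\dots,n-1\}$). For a finite set $X$ with weight function $\omega_X:X\times X\to\mathbb R$ and $\delta\in\mathbb R$, the Dowker $\delta$-sink complex $\mathfrak D^{\mathrm{si}}_{\delta,X}$ consists of all nonempty $\sigma\subseteq X$ for which there is $x'\in X$ with $\omega_X(x,x')\le\delta$ for all $x\in\sigma$; these form a filtration in $\delta$. Fix a field $\mathbb K$. $\mathrm{Dgm}_k^{\mathfrak D}(X)$, the $k$-dimensional Dowker persistence diagram, is the persistence diagram of the persistence vector space obtained by applying $H_k(\cdot;\mathbb K)$ to this filtration (the source filtration, defined with $\omega_X(x',x)\le\delta$ instead, gives the same diagram), i.e. the multiset of points $(a,b)$, $a<b$,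 one for each interval $[a,b)$ in its decomposition into interval modules. A diagram is trivial if it has no off-diagonal points. *)

theory Defs
  imports
    Complex_Main
    "HOL-Library.FuncSet"
    "HOL-Library.Function_Algebras"
    "HOL-Library.Set_Algebras"
    "HOL-Library.Multiset"
    "HOL-Library.Extended_Real"
begin

section \<open>Simplicial homology with coefficients in a field\<close>

text \<open>
  A simplicial complex is a set of finite nonempty vertex sets. Simplices are oriented by the
  linear order of the vertex type, so a \<open>p\<close>-chain is a finitely supported function on the
  simplices with \<open>p + 1\<close> vertices (extended by 0 to all sets).
\<close>

definition chains :: "'a set set \<Rightarrow> nat \<Rightarrow> ('a set \<Rightarrow> 'k::field) set" where
  "chains C p = {c. finite {\<sigma>. c \<sigma> \<noteq> 0} \<and> (\<forall>\<sigma>. c \<sigma> \<noteq> 0 \<longrightarrow> \<sigma> \<in> C \<and> card \<sigma> = p + 1)}"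

text \<open>
  The face of \<open>\<sigma>\<close> opposite to \<open>v\<close> has sign \<open>(-1)^i\<close>, where \<open>i\<close> is the position of \<open>v\<close> in \<open>\<sigma>\<close>.
  The condition \<open>\<tau> \<noteq> {}\<close> makes the boundary of every 0-chain vanish, so that the
  homology below is ordinary, not reduced.
\<close>

definition boundary :: "('a::linorder set \<Rightarrow> 'k::field) \<Rightarrow> 'a set \<Rightarrow> 'k" where
  "boundary c \<tau> =
     (\<Sum>\<sigma> | c \<sigma> \<noteq> 0. \<Sum>v\<in>\<sigma>.
        if \<tau> \<noteq> {} \<and> \<tau> = \<sigma> - {v} then (- 1) ^ card {u \<in> \<sigma>. u < v} * c \<sigma> else 0)"

definition cycles :: "'a::linorder set set \<Rightarrow> nat \<Rightarrow> ('a set \<Rightarrow> 'k::field) set" where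
  "cycles C p = {c \<in> chains C p. boundary c = 0}"

definition boundaries :: "'a::linorder set set \<Rightarrow> nat \<Rightarrow> ('a set \<Rightarrow> 'k::field) set" where
  "boundaries C p = boundary ` chains C (p + 1)"

text \<open>Homology classes are the cosets of the boundaries in the cycles.\<close>

definition homology :: "'a::linorder set set \<Rightarrow> nat \<Rightarrow> ('a set \<Rightarrow> 'k::field) set set" where
  "homology C p = (\<lambda>z. z +o boundaries C p) ` cycles C p"


section \<open>Persistence vector spaces and persistence diagrams\<close>

text \<open>
  The fields are: the underlying set, addition and scalar multiplication of the vector space at
  parameter \<open>\<delta>\<close>, and the linear map from the space at \<open>\<delta>\<close> to the space at \<open>\<delta>'\<close>, which is
  meaningful for \<open>\<delta> \<le> \<delta>'\<close> only.
\<close>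

record ('k, 'v) persistence_space =
  pv_carrier :: "real \<Rightarrow> 'v set"
  pv_add :: "real \<Rightarrow> 'v \<Rightarrow> 'v \<Rightarrow> 'v"
  pv_scale :: "real \<Rightarrow> 'k \<Rightarrow> 'v \<Rightarrow> 'v"
  pv_map :: "real \<Rightarrow> real \<Rightarrow> 'v \<Rightarrow> 'v"

definition pv_isomorphic ::
  "('k, 'v) persistence_space \<Rightarrow> ('k, 'w) persistence_space \<Rightarrow> bool" where
  "pv_isomorphic V W \<longleftrightarrow>
     (\<exists>\<Phi> :: real \<Rightarrow> 'v \<Rightarrow> 'w.
        (\<forall>\<delta>. bij_betw (\<Phi> \<delta>) (pv_carrier V \<delta>) (pv_carrier W \<delta>)) \<and>
        (\<forall>\<delta>. \<forall>x\<in>pv_carrier V \<delta>. \<forall>y\<in>pv_carrier V \<delta>.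
           \<Phi> \<delta> (pv_add V \<delta> x y) = pv_add W \<delta> (\<Phi> \<delta> x) (\<Phi> \<delta> y)) \<and>
        (\<forall>\<delta> a. \<forall>x\<in>pv_carrier V \<delta>. \<Phi> \<delta> (pv_scale V \<delta> a x) = pv_scale W \<delta> a (\<Phi> \<delta> x)) \<and>
        (\<forall>\<delta> \<delta>'. \<delta> \<le> \<delta>' \<longrightarrow>
           (\<forall>x\<in>pv_carrier V \<delta>. \<Phi> \<delta>' (pv_map V \<delta> \<delta>' x) = pv_map W \<delta> \<delta>' (\<Phi> \<delta> x))))"

definition interval_module :: "real \<times> ereal \<Rightarrow> ('k::field, 'k) persistence_space" where
  "interval_module = (\<lambda>(a, b).
     \<lparr> pv_carrier = (\<lambda>\<delta>. if a \<le> \<delta> \<and> ereal \<delta> < b then UNIV else {0}),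
       pv_add = (\<lambda>\<delta>. (+)),
       pv_scale = (\<lambda>\<delta>. (*)),
       pv_map = (\<lambda>\<delta> \<delta>' x. if a \<le> \<delta> \<and> ereal \<delta>' < b then x else 0) \<rparr>)"

text \<open>Only used for finite index sets, where the direct sum is the product.\<close>

definition pv_direct_sum ::
  "'i set \<Rightarrow> ('i \<Rightarrow> ('k, 'v) persistence_space) \<Rightarrow> ('k, 'i \<Rightarrow> 'v) persistence_space" where
  "pv_direct_sum I M =
     \<lparr> pv_carrier = (\<lambda>\<delta>. \<Pi>\<^sub>E i\<in>I. pv_carrier (M i) \<delta>),
       pv_add = (\<lambda>\<delta> f g. \<lambda>i\<in>I. pv_add (M i) \<delta> (f i) (g i)),
       pv_scale = (\<lambda>\<delta> a f. \<lambda>i\<in>I. pv_scale (M i) \<delta> a (f i)),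
       pv_map = (\<lambda>\<delta> \<delta>' f. \<lambda>i\<in>I. pv_map (M i) \<delta> \<delta>' (f i)) \<rparr>"

text \<open>
  The element \<open>(a, b)\<close> of the multiset stands for the nonempty interval \<open>[a, b)\<close>. The index set
  of the direct sum contains one copy of \<open>(a, b)\<close> for each occurrence in the multiset.
\<close>

definition interval_decomposition ::
  "('k::field, 'v) persistence_space \<Rightarrow> (real \<times> ereal) multiset \<Rightarrow> bool" where
  "interval_decomposition V D \<longleftrightarrow>
     (\<forall>(a, b)\<in>#D. ereal a < b) \<and>
     pv_isomorphic V (pv_direct_sum {(I, j). j < count D I} (\<lambda>(I, j). interval_module I))"

text \<open>Unspecified unless \<open>V\<close> has a decomposition into finitely many interval modules.\<close>

definition persistence_diagram ::
  "('k::field, 'v) persistence_space \<Rightarrow> (real \<times> ereal) multiset" where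
  "persistence_diagram V = (THE D. interval_decomposition V D)"

text \<open>
  The operations on cosets: \<open>(z + B) + (w + B) = (z + w) + B\<close> and \<open>a(z + B) + B = az + B\<close>
  (the additional summand \<open>B\<close> matters for \<open>a = 0\<close>), and the inclusion of a complex with
  boundaries \<open>B\<close> into one with boundaries \<open>B' \<supseteq> B\<close> maps \<open>z + B\<close> to \<open>(z + B) + B' = z + B'\<close>.
\<close>

definition persistent_homology ::
  "(real \<Rightarrow> 'a::linorder set set) \<Rightarrow> nat \<Rightarrow> ('k::field, ('a set \<Rightarrow> 'k) set) persistence_space" where
  "persistent_homology F p =
     \<lparr> pv_carrier = (\<lambda>\<delta>. homology (F \<delta>) p),
       pv_add = (\<lambda>\<delta> S T. S + T),
       pv_scale = (\<lambda>\<delta> a S. (\<lambda>z \<sigma>. a * z \<sigma>) ` S + boundaries (F \<delta>) p),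
       pv_map = (\<lambda>\<delta> \<delta>' S. S + boundaries (F \<delta>') p) \<rparr>"


section \<open>Dowker persistence of the cycle networks\<close>

definition dowker_sink :: "'a set \<Rightarrow> ('a \<Rightarrow> 'a \<Rightarrow> real) \<Rightarrow> real \<Rightarrow> 'a set set" where
  "dowker_sink X \<omega> \<delta> = {\<sigma>. \<sigma> \<subseteq> X \<and> \<sigma> \<noteq> {} \<and> (\<exists>x'\<in>X. \<forall>x\<in>\<sigma>. \<omega> x x' \<le> \<delta>)}"

text \<open>The first argument only serves to name the coefficient field.\<close>

definition dowker_diagram ::
  "'k::field itself \<Rightarrow> nat \<Rightarrow> 'a::linorder set \<Rightarrow> ('a \<Rightarrow> 'a \<Rightarrow> real) \<Rightarrow> (real \<times> ereal) multiset" where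
  "dowker_diagram _ p X \<omega> =
     persistence_diagram
       (persistent_homology (dowker_sink X \<omega>) p :: ('k, ('a set \<Rightarrow> 'k) set) persistence_space)"

text \<open>The node \<open>x\<^sub>i\<close> of the cycle network is represented by the number \<open>i\<close>.\<close>

definition cycle_nodes :: "nat \<Rightarrow> nat set" where
  "cycle_nodes n = {1..n}"

definition cycle_edges :: "nat \<Rightarrow> (nat \<times> nat) set" where
  "cycle_edges n = {(i, i + 1) | i. 1 \<le> i \<and> i < n} \<union> {(n, 1)}"

definition cycle_weight :: "nat \<Rightarrow> nat \<Rightarrow> nat \<Rightarrow> real" where
  "cycle_weight n x y = real (LEAST m. (x, y) \<in> cycle_edges n ^^ m)"

end

theory Submission
  imports Defs
begin

text \<open>
  For \<open>0 \<le> \<delta> < n - 1\<close> put \<open>r = n - 1 - \<lfloor>\<delta>\<rfloor>\<close>. A nonempty set of nodes is missing from the Dowker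
  complex iff all its cyclic gaps are at most \<open>r\<close>. Since the full simplex is acyclic, the homology of
  the Dowker complex in degree \<open>2l\<close> is that of the quotient by it, spanned by these sets, in degree
  \<open>2l + 1\<close>. An acyclic matching on the quotient has one critical cell, of odd cardinality, if \<open>r + 1\<close>
  does not divide \<open>n\<close>, and \<open>r\<close> critical cells, all of cardinality \<open>2n / (r + 1)\<close>, if it does. As
  critical cells never occur in adjacent degrees, they form a basis of the homology. So the homology
  in degree \<open>2l\<close> vanishes unless \<open>n = (l + 1)(r + 1)\<close>, that is \<open>\<lfloor>\<delta>\<rfloor> = nl / (l + 1)\<close>, where it has dimension
  \<open>r\<close>. The persistence module thus lives on a single unit interval, on which the complex is constant.
\<close>

section \<open>Acyclic matchings on a based chain complex\<close>

text \<open>In the complement, the search for a sink becomes a condition on consecutive gaps, which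
  toggling one node changes in a controlled way. Numbering the nodes cuts the circle open between
  \<open>n\<close> and 1, and both ways in which the toggle can fail occur at this cut: the pivot
  may be the absent node \<open>n + 1\<close>, or deleting it may make the gap across the cut too
  long. A set of \<open>2i + 1\<close> nodes has degree \<open>2i\<close> in the quotient, hence
  concerns degree \<open>2i - 1\<close> of the Dowker complex; this is why critical cells of odd
  cardinality leave no trace in the even degrees \<open>2l\<close>. Dimensions alone do not give an
  isomorphism of persistence modules, so the matching and the connecting map are made to produce
  linear coordinates on the cycles with kernel the boundaries. As the module vanishes outside a
  stretch on which the complex is constant, no map between different complexes has to be computed.
  The diagram is a definite description, so a decomposition must also be shown unique. All intervals
  of the decomposition found here coincide, and a direct comparison replaces a general Krull-Schmidt
  argument.\<close>

text \<open>The map \<open>f\<close> induces a linear isomorphism from \<open>Z / B\<close> onto the functions on \<open>I\<close>, which are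
  extended by 0.\<close>

definition coordinates ::
  "('c \<Rightarrow> 'k::field) set \<Rightarrow> ('c \<Rightarrow> 'k) set \<Rightarrow> 'i set \<Rightarrow> (('c \<Rightarrow> 'k) \<Rightarrow> 'i \<Rightarrow> 'k) \<Rightarrow> bool" where
  "coordinates Z B I f \<longleftrightarrow>
     (\<forall>z\<in>Z. \<forall>w\<in>Z. f (z + w) = f z + f w) \<and>
     (\<forall>a. \<forall>z\<in>Z. f (\<lambda>\<sigma>. a * z \<sigma>) = (\<lambda>i. a * f z i)) \<and>
     f ` Z = {g. \<forall>i. g i \<noteq> 0 \<longrightarrow> i \<in> I} \<and>
     (\<forall>z\<in>Z. f z = 0 \<longleftrightarrow> z \<in> B)"

locale based_complex =
  fixes Q :: "'c set" and D :: "'c \<Rightarrow> 'c \<Rightarrow> 'k::field" and deg :: "'c \<Rightarrow> nat"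
  assumes finite_cells: "finite Q"
    and deg_incidence: "\<lbrakk>b \<in> Q; a \<in> Q; D b a \<noteq> 0\<rbrakk> \<Longrightarrow> deg b = Suc (deg a)"
begin

definition diff :: "('c \<Rightarrow> 'k) \<Rightarrow> 'c \<Rightarrow> 'k" where
  "diff c a = (if a \<in> Q then \<Sum>b\<in>Q. c b * D b a else 0)"

definition graded :: "nat \<Rightarrow> ('c \<Rightarrow> 'k) set" where
  "graded p = {c. \<forall>\<sigma>. c \<sigma> \<noteq> 0 \<longrightarrow> \<sigma> \<in> Q \<and> deg \<sigma> = p}"

lemma diff_add: "diff (c + e) = diff c + diff e"
  by (auto simp: diff_def fun_eq_iff sum.distrib algebra_simps)

lemma diff_diff: "diff (c - e) = diff c - diff e"
  by (auto simp: diff_def fun_eq_iff sum_subtractf algebra_simps)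

lemma diff_scale: "diff (\<lambda>\<sigma>. x * c \<sigma>) = (\<lambda>a. x * diff c a)"
  by (auto simp: diff_def fun_eq_iff sum_distrib_left algebra_simps)

lemma diff_zero [simp]: "diff 0 = 0"
  by (auto simp: diff_def fun_eq_iff)

lemma graded_diff: "c \<in> graded p \<Longrightarrow> e \<in> graded p \<Longrightarrow> c - e \<in> graded p"
  by (auto simp: graded_def) (metis diff_self)+

lemma diff_graded: "c \<in> graded (Suc p) \<Longrightarrow> diff c \<in> graded p"
proof -
  assume c: "c \<in> graded (Suc p)"
  show ?thesis
    unfolding graded_def
  proof (intro CollectI allI impI)
    fix a assume a: "diff c a \<noteq> 0"
    then have aQ: "a \<in> Q" by (auto simp: diff_def split: if_splits)
    with a have "(\<Sum>b\<in>Q. c b * D b a) \<noteq> 0" by (simp add: diff_def)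
    then obtain b where "b \<in> Q" "c b * D b a \<noteq> 0"
      by (meson sum.neutral)
    with c deg_incidence[of b a] aQ show "a \<in> Q \<and> deg a = p"
      by (auto simp: graded_def)
  qed
qed

end

text \<open>\<open>key\<close> certifies acyclicity: it increases strictly along every gradient
  step, from a lower cell up to its mate and down to another lower cell, so no such path closes
  up.\<close>

locale acyclic_matching = based_complex Q D deg
  for Q :: "'c set" and D :: "'c \<Rightarrow> 'c \<Rightarrow> 'k::field" and deg :: "'c \<Rightarrow> nat" +
  fixes A :: "'c set" and mate :: "'c \<Rightarrow> 'c" and key :: "'c \<Rightarrow> nat"
  assumes diff_diff_zero: "c \<in> graded p \<Longrightarrow> diff (diff c) = 0"
    and low_cells: "A \<subseteq> Q"
    and mate_cells: "mate ` A \<subseteq> Q - A"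
    and inj_mate: "inj_on mate A"
    and mate_incidence: "a \<in> A \<Longrightarrow> D (mate a) a \<noteq> 0"
    and key_less: "\<lbrakk>a \<in> A; a' \<in> A; a \<noteq> a'; D (mate a) a' \<noteq> 0\<rbrakk> \<Longrightarrow> key a < key a'"
begin

definition critical :: "'c set" where
  "critical = Q - A - mate ` A"

definition high :: "('c \<Rightarrow> 'k) set" where
  "high = {c. \<forall>\<sigma>. c \<sigma> \<noteq> 0 \<longrightarrow> \<sigma> \<in> mate ` A}"

lemma finite_low: "finite A"
  using finite_cells low_cells finite_subset by blast

lemma high_diff: "c \<in> high \<Longrightarrow> e \<in> high \<Longrightarrow> c - e \<in> high"
  by (auto simp: high_def) (metis diff_self)+

lemma high_add: "c \<in> high \<Longrightarrow> e \<in> high \<Longrightarrow> c + e \<in> high"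
  by (auto simp: high_def) (metis add.right_neutral)+

lemma high_scale: "c \<in> high \<Longrightarrow> (\<lambda>\<sigma>. x * c \<sigma>) \<in> high"
  by (auto simp: high_def)

lemma diff_high:
  assumes "e \<in> high" "a \<in> A"
  shows "diff e a = (\<Sum>a'\<in>A. e (mate a') * D (mate a') a)"
proof -
  have "diff e a = (\<Sum>b\<in>Q. e b * D b a)" using assms low_cells by (auto simp: diff_def)
  also have "\<dots> = (\<Sum>b\<in>mate ` A. e b * D b a)"
    by (rule sum.mono_neutral_right) (use mate_cells finite_cells assms in \<open>auto simp: high_def\<close>)
  also have "\<dots> = (\<Sum>a'\<in>A. e (mate a') * D (mate a') a)"
    by (rule sum.reindex_cong[OF inj_mate]) auto
  finally show ?thesis .
qed

text \<open>By \<open>key_less\<close> the matrix of \<open>diff\<close> from the upper to the lower matched cells is triangular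
  with nonzero diagonal, hence invertible.\<close>

lemma high_eq_zero:
  assumes e: "e \<in> high" and z: "\<And>a. a \<in> A \<Longrightarrow> diff e a = 0"
  shows "e = 0"
proof (rule ccontr)
  assume "e \<noteq> 0"
  then obtain \<sigma> where "e \<sigma> \<noteq> 0" by (auto simp: fun_eq_iff)
  then have "{a \<in> A. e (mate a) \<noteq> 0} \<noteq> {}" using e by (auto simp: high_def)
  \<comment> \<open>With \<open>key a\<close> minimal among the cells whose mates carry
    \<open>e\<close>, no other mate in the support is incident to \<open>a\<close>, so
    \<open>diff e a\<close> has a single nonzero term.\<close>
  then obtain a where a: "a \<in> A" "e (mate a) \<noteq> 0"
    and least: "\<And>a'. a' \<in> A \<Longrightarrow> e (mate a') \<noteq> 0 \<Longrightarrow> key a \<le> key a'"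
    using ex_has_least_nat[of "\<lambda>a. a \<in> A \<and> e (mate a) \<noteq> 0" _ key] by blast
  have "diff e a = (\<Sum>a'\<in>A. e (mate a') * D (mate a') a)"
    using diff_high e a by blast
  also have "\<dots> = (\<Sum>a'\<in>{a}. e (mate a') * D (mate a') a)"
  proof (rule sum.mono_neutral_right)
    show "\<forall>i\<in>A - {a}. e (mate i) * D (mate i) a = 0"
      using key_less least a(1) by (metis DiffE insertI1 leD mult_zero_left mult_zero_right)
  qed (use a finite_low in auto)
  also have "\<dots> \<noteq> 0" using a mate_incidence by simp
  finally show False using z a by simp
qed

text \<open>Forward substitution in the triangular system, one lower cell at a time in order of
  increasing \<open>key\<close>.\<close>

lemma ex_high:
  assumes "g \<in> graded p"
  shows "\<exists>e\<in>high \<inter> graded (Suc p). \<forall>a\<in>A. diff e a = g a"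
proof -
  have "\<exists>e. (\<forall>\<sigma>. e \<sigma> \<noteq> 0 \<longrightarrow> \<sigma> \<in> mate ` T) \<and> (\<forall>a\<in>T. diff e a = g a)" if "finite T" "T \<subseteq> A" for T
    using that
  proof (induction T rule: finite_ranking_induct[where f = key])
    case empty
    show ?case by (rule exI[of _ 0]) simp
  next
    case (insert a T)
    then obtain e where e: "\<And>\<sigma>. e \<sigma> \<noteq> 0 \<Longrightarrow> \<sigma> \<in> mate ` T" "\<And>a. a \<in> T \<Longrightarrow> diff e a = g a"
      by (metis insert_subset)
    show ?case
    proof (cases "a \<in> T")
      case True
      then show ?thesis using e by (auto intro!: exI[of _ e] simp: insert_absorb)
    next
      case False
      \<comment> \<open>The multiple of \<open>mate a\<close> that corrects the equation at
        \<open>a\<close>; the equations at the cells of \<open>T\<close>, whose keys are at most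
        \<open>key a\<close>, are undisturbed.\<close>
      define x where "x = (g a - diff e a) / D (mate a) a"
      define u where "u = (\<lambda>\<sigma>. if \<sigma> = mate a then x else 0)"
      have aA: "a \<in> A" "mate a \<in> Q" using insert.prems mate_cells by auto
      have du: "diff u t = (if t \<in> Q then x * D (mate a) t else 0)" for t
        using finite_cells aA(2) by (simp add: diff_def u_def if_distrib[of "\<lambda>y. y * _"] sum.delta cong: if_cong)
      have "diff (e + u) t = g t" if t: "t \<in> insert a T" for t
      proof (cases "t = a")
        case True
        then show ?thesis
          using mate_incidence[OF aA(1)] du low_cells aA(1) by (auto simp: diff_add x_def)
      next
        case False
        then have "D (mate a) t = 0"
          using key_less[of a t] insert t aA by (metis insertE leD subsetD)
        then show ?thesis using False t e(2) by (auto simp: diff_add du)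
      qed
      moreover have "(e + u) \<sigma> \<noteq> 0 \<Longrightarrow> \<sigma> \<in> mate ` insert a T" for \<sigma>
        using e(1)[of \<sigma>] by (cases "\<sigma> = mate a") (auto simp: u_def)
      ultimately show ?thesis by blast
    qed
  qed
  \<comment> \<open>Solving only over the cells of degree \<open>p\<close> keeps \<open>e\<close>
    homogeneous; at the other cells of \<open>A\<close> both sides vanish for degree
    reasons.\<close>
  from this[of "{a \<in> A. deg a = p}"] obtain e
    where e: "\<And>\<sigma>. e \<sigma> \<noteq> 0 \<Longrightarrow> \<sigma> \<in> mate ` {a \<in> A. deg a = p}"
      "\<And>a. a \<in> A \<Longrightarrow> deg a = p \<Longrightarrow> diff e a = g a"
    using finite_low by auto
  have gr: "e \<in> graded (Suc p)"
    using e(1) mate_cells low_cells deg_incidence mate_incidence by (auto simp: graded_def) blast+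
  moreover have "e \<in> high" using e(1) by (auto simp: high_def)
  moreover have "diff e a = g a" if "a \<in> A" for a
    using diff_graded[OF gr] assms e(2)[OF that] by (auto simp: graded_def) metis
  ultimately show ?thesis by blast
qed

definition lift :: "('c \<Rightarrow> 'k) \<Rightarrow> 'c \<Rightarrow> 'k" where
  "lift g = (THE e. e \<in> high \<and> (\<forall>a\<in>A. diff e a = g a))"

text \<open>Uniqueness is \<open>high_eq_zero\<close> applied to a difference. It will also give
  linearity of \<open>lift\<close>, since sums and multiples of solutions are solutions.\<close>

lemma lift_eqI:
  assumes "e \<in> high" "\<And>a. a \<in> A \<Longrightarrow> diff e a = g a"
  shows "lift g = e"
  unfolding lift_def
proof (rule the_equality)
  fix e' assume e': "e' \<in> high \<and> (\<forall>a\<in>A. diff e' a = g a)"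
  then have "e' - e = 0"
    by (intro high_eq_zero) (use assms in \<open>auto simp: high_diff diff_diff\<close>)
  then show "e' = e" by simp
qed (use assms in auto)

lemma
  assumes "g \<in> graded p"
  shows lift_high: "lift g \<in> high"
    and lift_graded: "lift g \<in> graded (Suc p)"
    and diff_lift: "a \<in> A \<Longrightarrow> diff (lift g) a = g a"
proof -
  from ex_high[OF assms] obtain e where e: "e \<in> high" "e \<in> graded (Suc p)" "\<forall>a\<in>A. diff e a = g a"
    by auto
  then have "lift g = e" by (intro lift_eqI) auto
  with e show "lift g \<in> high" "lift g \<in> graded (Suc p)" "a \<in> A \<Longrightarrow> diff (lift g) a = g a"
    by auto
qed

text \<open>Subtracting a boundary keeps the homology class and clears all coefficients at lower
  matched cells, so that the critical coefficients become decisive.\<close>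

definition reduce :: "('c \<Rightarrow> 'k) \<Rightarrow> 'c \<Rightarrow> 'k" where
  "reduce z = z - diff (lift z)"

lemma
  assumes "z \<in> graded p"
  shows reduce_graded: "reduce z \<in> graded p"
    and reduce_low: "a \<in> A \<Longrightarrow> reduce z a = 0"
    and diff_reduce: "diff (reduce z) = diff z"
  using assms by (simp_all add: reduce_def graded_diff diff_graded lift_graded diff_lift diff_diff
      diff_diff_zero[OF lift_graded])

lemma highI:
  assumes "z \<in> graded p" "\<And>a. a \<in> A \<Longrightarrow> z a = 0" "\<And>\<sigma>. \<sigma> \<in> critical \<Longrightarrow> deg \<sigma> = p \<Longrightarrow> z \<sigma> = 0"
  shows "z \<in> high"
  unfolding high_def
proof (intro CollectI allI impI, rule ccontr)
  fix \<sigma> assume "z \<sigma> \<noteq> 0" "\<sigma> \<notin> mate ` A"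
  then show False using assms unfolding graded_def critical_def by blast
qed

text \<open>A reduced cycle is determined by its critical coefficients. Absence of critical cells
  one degree up makes boundaries reduce to 0; absence one degree down lets every critical chain be
  completed to a cycle. Without critical cells in the degree itself the homology vanishes.\<close>

theorem coordinates_matching:
  assumes crit: "(\<forall>\<sigma>\<in>critical. deg \<sigma> \<noteq> Suc p) \<or> (\<forall>\<sigma>\<in>critical. deg \<sigma> \<noteq> p \<and> deg \<sigma> \<noteq> Suc (Suc p))"
  shows "coordinates {c \<in> graded (Suc p). diff c = 0} (diff ` graded (Suc (Suc p)))
           {\<sigma> \<in> critical. deg \<sigma> = Suc p} (\<lambda>z \<sigma>. if \<sigma> \<in> critical then reduce z \<sigma> else 0)"
    (is "coordinates ?Z ?B ?I ?f")
proof -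
  have lift_add: "lift (z + w) = lift z + lift w" if "z \<in> graded (Suc p)" "w \<in> graded (Suc p)" for z w
    by (rule lift_eqI)
      (use lift_high[OF that(1)] lift_high[OF that(2)] diff_lift[OF that(1)] diff_lift[OF that(2)]
        in \<open>auto simp: high_add diff_add\<close>)
  have lift_scale: "lift (\<lambda>\<sigma>. a * z \<sigma>) = (\<lambda>\<sigma>. a * lift z \<sigma>)" if "z \<in> graded (Suc p)" for z a
    by (rule lift_eqI)
      (use lift_high[OF that(1)] diff_lift[OF that(1)] in \<open>auto simp: high_scale diff_scale\<close>)
  have add: "?f (z + w) = ?f z + ?f w" if "z \<in> ?Z" "w \<in> ?Z" for z w
    using that by (auto simp: reduce_def lift_add diff_add fun_eq_iff)
  have scale: "?f (\<lambda>\<sigma>. a * z \<sigma>) = (\<lambda>\<sigma>. a * ?f z \<sigma>)" if "z \<in> ?Z" for z a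
    using that by (auto simp: reduce_def lift_scale diff_scale fun_eq_iff algebra_simps)
  have supp: "?f z \<sigma> \<noteq> 0 \<Longrightarrow> \<sigma> \<in> ?I" if "z \<in> ?Z" for z \<sigma>
  proof -
    assume "?f z \<sigma> \<noteq> 0"
    then have "\<sigma> \<in> critical" "reduce z \<sigma> \<noteq> 0" by (simp_all split: if_splits)
    moreover have "reduce z \<in> graded (Suc p)" using that reduce_graded by blast
    ultimately show "\<sigma> \<in> ?I" by (simp add: graded_def)
  qed
  have no_critical: "?f z = 0" if "z \<in> ?Z" "\<forall>\<sigma>\<in>critical. deg \<sigma> \<noteq> Suc p" for z
  proof (rule ext, rule ccontr)
    fix \<sigma> assume "?f z \<sigma> \<noteq> (0 :: 'c \<Rightarrow> 'k) \<sigma>"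
    then have "\<sigma> \<in> ?I" by (intro supp[OF that(1)]) simp
    with that(2) show False by blast
  qed
  have inj: "z \<in> ?B" if z: "z \<in> ?Z" and "?f z = 0" for z
  proof -
    have "reduce z \<in> high"
    proof (rule highI)
      show "reduce z \<sigma> = 0" if "\<sigma> \<in> critical" for \<sigma>
        using fun_cong[OF \<open>?f z = 0\<close>, of \<sigma>] that by simp
    qed (use reduce_graded reduce_low z in blast)+
    then have "reduce z = 0"
      by (rule high_eq_zero) (use z diff_reduce in auto)
    then have "z = diff (lift z)" by (simp add: reduce_def)
    then show ?thesis using z lift_graded by blast
  qed
  have ker: "?f z = 0" if zZ: "z \<in> ?Z" and zB: "z \<in> ?B" for z
  proof (cases "\<forall>\<sigma>\<in>critical. deg \<sigma> \<noteq> Suc p")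
    case True
    then show ?thesis by (rule no_critical[OF zZ])
  next
    case False
    with crit have none: "\<forall>\<sigma>\<in>critical. deg \<sigma> \<noteq> Suc (Suc p)" by blast
    obtain h where h: "h \<in> graded (Suc (Suc p))" "z = diff h" using zB by blast
    have "reduce h \<in> high"
      using highI[of "reduce h" "Suc (Suc p)"] reduce_graded[OF h(1)] reduce_low[OF h(1)] none by auto
    \<comment> \<open>\<open>reduce h\<close> is supported on upper cells and has boundary
      \<open>z\<close>, so uniqueness identifies it with \<open>lift z\<close>.\<close>
    then have "lift z = reduce h"
      by (rule lift_eqI) (simp add: diff_reduce[OF h(1)] h(2))
    then have "reduce z = 0" by (simp add: h(2) reduce_def[of "diff h"] diff_reduce[OF h(1)])
    then show ?thesis by (auto simp: fun_eq_iff)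
  qed
  have surj: "g \<in> ?f ` ?Z" if g: "\<And>\<sigma>. g \<sigma> \<noteq> 0 \<Longrightarrow> \<sigma> \<in> ?I" for g
  proof (cases "\<forall>\<sigma>\<in>critical. deg \<sigma> \<noteq> Suc p")
    case True
    then have "g = 0" using g by (auto simp: fun_eq_iff)
    moreover have "0 \<in> ?Z" by (auto simp: graded_def)
    moreover have "?f 0 = 0" by (rule no_critical) (fact | use True in blast)+
    ultimately show ?thesis by (intro image_eqI[where x = 0]) simp_all
  next
    case False
    with crit have none: "\<forall>\<sigma>\<in>critical. deg \<sigma> \<noteq> p" by blast
    have gr: "g \<in> graded (Suc p)" using g by (auto simp: graded_def critical_def)
    note dgr = diff_graded[OF gr]
    \<comment> \<open>The correction by upper cells cancels the boundary of \<open>g\<close> at the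
      lower cells and leaves the critical coefficients alone. The remaining boundary lies on upper
      cells and is itself a cycle, hence 0.\<close>
    define z where "z = g - lift (diff g)"
    have zgr: "z \<in> graded (Suc p)" using gr lift_graded[OF dgr] by (simp add: z_def graded_diff)
    have low: "z a = 0" if "a \<in> A" for a
    proof -
      have "g a = 0" using g[of a] that by (auto simp: critical_def)
      moreover have "lift (diff g) a = 0" using lift_high[OF dgr] that mate_cells by (auto simp: high_def)
      ultimately show ?thesis by (simp add: z_def)
    qed
    have "diff z = 0"
    proof (rule high_eq_zero)
      show "diff z \<in> high"
        by (rule highI[OF diff_graded[OF zgr]]) (use none diff_lift[OF dgr] in \<open>auto simp: z_def diff_diff\<close>)
    qed (simp add: diff_diff_zero[OF zgr])
    then have "z \<in> ?Z" using zgr by auto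
    moreover have "lift z = 0"
      by (rule lift_eqI) (auto simp: high_def low)
    then have "reduce z = z" by (simp add: reduce_def)
    then have "?f z = g"
      using g lift_high[OF dgr] by (fastforce simp: fun_eq_iff z_def high_def critical_def)
    ultimately show ?thesis by blast
  qed
  show ?thesis
    unfolding coordinates_def using add scale supp inj ker surj by (intro conjI) (blast+)
qed

end

section \<open>Simplicial chains of a complex and of its complement\<close>

text \<open>At most one summand is nonzero. Keeping the sum of \<open>boundary\<close> avoids
  choosing the removed vertex, and \<open>\<tau> \<noteq> {}\<close> again excludes the
  augmentation.\<close>

definition incidence :: "'a::linorder set \<Rightarrow> 'a set \<Rightarrow> 'k::field" where
  "incidence \<sigma> \<tau> =
     (\<Sum>v\<in>\<sigma>. if \<tau> \<noteq> {} \<and> \<tau> = \<sigma> - {v} then (- 1) ^ card {u \<in> \<sigma>. u < v} else 0)"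

lemma boundary_incidence:
  assumes "finite S" "\<And>\<sigma>. c \<sigma> \<noteq> 0 \<Longrightarrow> \<sigma> \<in> S"
  shows "boundary c \<tau> = (\<Sum>\<sigma>\<in>S. c \<sigma> * incidence \<sigma> \<tau>)"
proof -
  have "boundary c \<tau> = (\<Sum>\<sigma> | c \<sigma> \<noteq> 0. c \<sigma> * incidence \<sigma> \<tau>)"
    unfolding boundary_def incidence_def sum_distrib_left
    by (intro sum.cong refl) (simp only: if_distrib[of "times _"] mult_zero_right mult_zero_left mult.commute)
  also have "\<dots> = (\<Sum>\<sigma>\<in>S. c \<sigma> * incidence \<sigma> \<tau>)"
    by (rule sum.mono_neutral_left) (use assms in auto)
  finally show ?thesis .
qed

lemma incidence_nonzero:
  assumes "incidence \<sigma> \<tau> \<noteq> (0 :: 'k::field)"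
  shows "\<tau> \<noteq> {} \<and> (\<exists>v\<in>\<sigma>. \<tau> = \<sigma> - {v})"
proof (rule ccontr)
  assume *: "\<not> ?thesis"
  have "incidence \<sigma> \<tau> = (0 :: 'k)"
    unfolding incidence_def
  proof (intro sum.neutral ballI)
    fix v assume "v \<in> \<sigma>"
    with * have "\<not> (\<tau> \<noteq> {} \<and> \<tau> = \<sigma> - {v})" by blast
    then show "(if \<tau> \<noteq> {} \<and> \<tau> = \<sigma> - {v} then (- 1) ^ card {u \<in> \<sigma>. u < v} else 0) = (0 :: 'k)"
      by (simp only: if_False)
  qed
  with assms show False by contradiction
qed

lemma incidence_insert:
  assumes "finite \<tau>" "u \<notin> \<tau>" "\<tau> \<noteq> {}"
  shows "incidence (insert u \<tau>) \<tau> = (- 1) ^ card {w \<in> \<tau>. w < u}"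
proof -
  have facet: "(\<tau> \<noteq> {} \<and> \<tau> = insert u \<tau> - {v}) \<longleftrightarrow> v = u" if "v \<in> insert u \<tau>" for v
    using that assms by blast
  have "incidence (insert u \<tau>) \<tau> =
      (\<Sum>v\<in>insert u \<tau>. if v = u then (- 1) ^ card {w \<in> insert u \<tau>. w < v} else 0)"
    unfolding incidence_def by (rule sum.cong[OF refl]) (simp only: facet)
  also have "\<dots> = (- 1) ^ card {w \<in> insert u \<tau>. w < u}"
    using assms(1) by (simp add: sum.delta')
  also have "{w \<in> insert u \<tau>. w < u} = {w \<in> \<tau>. w < u}" by blast
  finally show ?thesis .
qed

text \<open>Seen from the face, the sum over simplices becomes a sum over the vertices to be added,
  which is the form that the sign calculations below use.\<close>

lemma boundary_cofaces:
  assumes X: "finite X" "\<And>\<sigma>. c \<sigma> \<noteq> 0 \<Longrightarrow> \<sigma> \<subseteq> X" and \<tau>: "\<tau> \<subseteq> X" "\<tau> \<noteq> {}"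
  shows "boundary c \<tau> = (\<Sum>u\<in>X - \<tau>. (- 1) ^ card {w \<in> \<tau>. w < u} * c (insert u \<tau>))"
proof -
  have fin: "finite \<tau>" using X \<tau> finite_subset by blast
  have inj: "inj_on (\<lambda>u. insert u \<tau>) (X - \<tau>)" by (auto simp: inj_on_def)
  have "boundary c \<tau> = (\<Sum>\<sigma>\<in>Pow X. c \<sigma> * incidence \<sigma> \<tau>)"
    by (rule boundary_incidence) (use X in auto)
  also have "\<dots> = (\<Sum>\<sigma>\<in>(\<lambda>u. insert u \<tau>) ` (X - \<tau>). c \<sigma> * incidence \<sigma> \<tau>)"
  proof (rule sum.mono_neutral_right)
    show "\<forall>\<sigma>\<in>Pow X - (\<lambda>u. insert u \<tau>) ` (X - \<tau>). c \<sigma> * incidence \<sigma> \<tau> = 0"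
    proof (intro ballI, rule ccontr)
      fix \<sigma> assume \<sigma>: "\<sigma> \<in> Pow X - (\<lambda>u. insert u \<tau>) ` (X - \<tau>)" "c \<sigma> * incidence \<sigma> \<tau> \<noteq> 0"
      then obtain v where "v \<in> \<sigma>" "\<tau> = \<sigma> - {v}" using incidence_nonzero[of \<sigma> \<tau>] by auto
      then have "\<sigma> = insert v \<tau>" "v \<in> X - \<tau>" using \<sigma> by auto
      with \<sigma> show False by blast
    qed
  qed (use X \<tau> in auto)
  also have "\<dots> = (\<Sum>u\<in>X - \<tau>. (- 1) ^ card {w \<in> \<tau>. w < u} * c (insert u \<tau>))"
    by (subst sum.reindex[OF inj], rule sum.cong) (use fin \<tau> in \<open>auto simp: incidence_insert\<close>)
  finally show ?thesis .
qed

locale complex_pair =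
  fixes X :: "'a::linorder set" and C :: "'a set set"
  assumes finite_vertices: "finite X"
    and nonempty_vertices: "X \<noteq> {}"
    and simplices: "C \<subseteq> Pow X - {{}}"
    and faces: "\<lbrakk>\<sigma> \<in> C; \<tau> \<subseteq> \<sigma>; \<tau> \<noteq> {}\<rbrakk> \<Longrightarrow> \<tau> \<in> C"
begin

definition full :: "'a set set" where "full = Pow X - {{}}"
definition rel :: "'a set set" where "rel = full - C"

lemma finite_full: "finite full"
  using finite_vertices by (simp add: full_def)

lemma chains_eq:
  assumes "S \<subseteq> full"
  shows "chains S p = {c. \<forall>\<sigma>. c \<sigma> \<noteq> 0 \<longrightarrow> \<sigma> \<in> S \<and> card \<sigma> = p + 1}"
proof -
  have "finite {\<sigma>. c \<sigma> \<noteq> 0}" if "\<forall>\<sigma>. c \<sigma> \<noteq> 0 \<longrightarrow> \<sigma> \<in> S \<and> card \<sigma> = p + 1" for c :: "'a set \<Rightarrow> 'b"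
    by (rule finite_subset[OF _ finite_full]) (use that assms in auto)
  then show ?thesis unfolding chains_def by blast
qed

lemma C_full: "C \<subseteq> full" and rel_full: "rel \<subseteq> full"
  using simplices by (auto simp: full_def rel_def)

lemma chains_full: "S \<subseteq> full \<Longrightarrow> c \<in> chains S p \<Longrightarrow> c \<in> chains full p"
  by (auto simp: chains_def)

lemma chains_diff:
  "c \<in> chains S p \<Longrightarrow> e \<in> chains S p \<Longrightarrow> S \<subseteq> full \<Longrightarrow> (c - e :: 'a set \<Rightarrow> 'k::field) \<in> chains S p"
  by (auto simp: chains_eq) (metis diff_self)+

text \<open>Summing over a fixed finite set makes linearity immediate; the index set of
  \<open>boundary\<close> varies with the support of the chain.\<close>

definition bd :: "('a set \<Rightarrow> 'k::field) \<Rightarrow> 'a set \<Rightarrow> 'k" where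
  "bd c \<tau> = (\<Sum>\<sigma>\<in>full. c \<sigma> * incidence \<sigma> \<tau>)"

lemma boundary_eq_bd:
  assumes "c \<in> chains full p"
  shows "boundary c = bd c"
  unfolding fun_eq_iff bd_def
  by (intro allI boundary_incidence[OF finite_full]) (use assms in \<open>auto simp: chains_eq\<close>)

lemma bd_diff: "bd (c - e) = bd c - bd e"
  by (auto simp: bd_def fun_eq_iff sum_subtractf algebra_simps)

lemma bd_cofaces:
  assumes "c \<in> chains full p" "\<tau> \<subseteq> X" "\<tau> \<noteq> {}"
  shows "bd c \<tau> = (\<Sum>u\<in>X - \<tau>. (- 1) ^ card {w \<in> \<tau>. w < u} * c (insert u \<tau>))"
  unfolding boundary_eq_bd[OF assms(1), symmetric]
  by (rule boundary_cofaces) (use assms finite_vertices in \<open>auto simp: chains_eq full_def\<close>)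

lemma bd_chains:
  assumes S: "S \<subseteq> full" "\<And>\<sigma> \<tau>. \<lbrakk>\<sigma> \<in> S; \<tau> \<subseteq> \<sigma>; \<tau> \<noteq> {}\<rbrakk> \<Longrightarrow> \<tau> \<in> S"
    and c: "c \<in> chains S (Suc p)"
  shows "bd c \<in> chains S p"
  unfolding chains_eq[OF S(1)]
proof (intro CollectI allI impI)
  fix \<tau> assume "bd c \<tau> \<noteq> 0"
  then obtain \<sigma> where "c \<sigma> * incidence \<sigma> \<tau> \<noteq> 0"
    unfolding bd_def by (meson sum.neutral)
  then have "c \<sigma> \<noteq> 0" "incidence \<sigma> \<tau> \<noteq> (0 :: 'b)" by auto
  with incidence_nonzero[of \<sigma> \<tau>] obtain v where v: "c \<sigma> \<noteq> 0" "v \<in> \<sigma>" "\<tau> = \<sigma> - {v}" "\<tau> \<noteq> {}"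
    by blast
  then have "\<sigma> \<in> S" "card \<sigma> = Suc (Suc p)" using c by (auto simp: chains_eq[OF S(1)])
  moreover from this have "finite \<sigma>" by (simp add: card_ge_0_finite)
  ultimately show "\<tau> \<in> S \<and> card \<tau> = p + 1" using v S(2)[of \<sigma> \<tau>] by auto
qed

lemma bd_full: "c \<in> chains full (Suc p) \<Longrightarrow> bd c \<in> chains full p"
  by (rule bd_chains) (auto simp: full_def)

lemma bd_C: "c \<in> chains C (Suc p) \<Longrightarrow> bd c \<in> chains C p"
  by (rule bd_chains) (use C_full faces in auto)

text \<open>Terms are cancelled in pairs by induction. Comparing the sum with its own negative would
  prove nothing in characteristic 2.\<close>

lemma sum_antisymmetric:
  fixes T :: "'b \<Rightarrow> 'b \<Rightarrow> 'k::field"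
  assumes "finite S" "\<And>u w. u \<in> S \<Longrightarrow> w \<in> S \<Longrightarrow> u \<noteq> w \<Longrightarrow> T u w = - T w u"
  shows "(\<Sum>u\<in>S. \<Sum>w\<in>S - {u}. T u w) = 0"
  using assms
proof (induction S rule: finite_induct)
  case (insert x S)
  note fin = insert.hyps
  have IH: "(\<Sum>u\<in>S. \<Sum>w\<in>S - {u}. T u w) = 0"
    by (rule insert.IH) (use insert.prems in blast)
  have "(\<Sum>w\<in>insert x S - {u}. T u w) = T u x + (\<Sum>w\<in>S - {u}. T u w)" if "u \<in> S" for u
  proof -
    have "insert x S - {u} = insert x (S - {u})" using that fin by blast
    then show ?thesis using fin by simp
  qed
  then have "(\<Sum>u\<in>insert x S. \<Sum>w\<in>insert x S - {u}. T u w) =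
      (\<Sum>w\<in>S. T x w) + ((\<Sum>u\<in>S. T u x) + (\<Sum>u\<in>S. \<Sum>w\<in>S - {u}. T u w))"
    using fin by (simp add: sum.distrib)
  also have "\<dots> = (\<Sum>w\<in>S. T x w + T w x)" using IH by (simp add: sum.distrib)
  also have "\<dots> = 0"
  proof (rule sum.neutral, intro ballI)
    fix w assume w: "w \<in> S"
    have "T x w = - T w x" by (rule insert.prems) (use w fin in blast)+
    then show "T x w + T w x = 0" by (simp only: add.left_inverse)
  qed
  finally show ?case .
qed simp

lemma bd_bd:
  assumes c: "c \<in> chains full (Suc (Suc p))"
  shows "bd (bd c) = 0"
proof
  fix \<tau>
  show "bd (bd c) \<tau> = (0 :: _ \<Rightarrow> 'b) \<tau>"
  proof (cases "\<tau> \<in> full")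
    case False
    have "bd (bd c) \<in> chains full p" using c by (intro bd_full)
    then show ?thesis using False by (auto simp: chains_eq)
  next
    case True
    then have \<tau>: "\<tau> \<subseteq> X" "\<tau> \<noteq> {}" "finite \<tau>"
      using finite_vertices finite_subset by (auto simp: full_def)
    define s :: "'a set \<Rightarrow> 'a \<Rightarrow> 'b" where "s \<rho> u = (- 1) ^ card {w \<in> \<rho>. w < u}" for \<rho> u
    have "bd (bd c) \<tau> = (\<Sum>u\<in>X - \<tau>. s \<tau> u * bd c (insert u \<tau>))"
      unfolding s_def by (rule bd_cofaces[OF bd_full[OF c]]) (use \<tau> in auto)
    also have "\<dots> = (\<Sum>u\<in>X - \<tau>. \<Sum>w\<in>X - \<tau> - {u}. s \<tau> u * s (insert u \<tau>) w * c (insert w (insert u \<tau>)))"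
    proof (rule sum.cong)
      fix u assume "u \<in> X - \<tau>"
      then have "bd c (insert u \<tau>) = (\<Sum>w\<in>X - insert u \<tau>. s (insert u \<tau>) w * c (insert w (insert u \<tau>)))"
        unfolding s_def by (intro bd_cofaces[OF c]) (use \<tau> in auto)
      moreover have "X - insert u \<tau> = X - \<tau> - {u}" by auto
      ultimately show "s \<tau> u * bd c (insert u \<tau>) =
          (\<Sum>w\<in>X - \<tau> - {u}. s \<tau> u * s (insert u \<tau>) w * c (insert w (insert u \<tau>)))"
        by (simp add: sum_distrib_left mult.assoc)
    qed simp
    also have "\<dots> = 0"
    proof (rule sum_antisymmetric)
      show "finite (X - \<tau>)" using finite_vertices by simp
      \<comment> \<open>The smaller of two new vertices shifts the position of the larger by one,
        but not conversely; hence the opposite signs.\<close>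
      have less: "s \<tau> u * s (insert u \<tau>) w = - (s \<tau> w * s (insert w \<tau>) u)"
        if "u \<notin> \<tau>" "w \<notin> \<tau>" "u < w" for u w
      proof -
        have "{y \<in> insert u \<tau>. y < w} = insert u {y \<in> \<tau>. y < w}" using that by auto
        then have "card {y \<in> insert u \<tau>. y < w} = Suc (card {y \<in> \<tau>. y < w})" using that \<tau> by simp
        moreover have "{y \<in> insert w \<tau>. y < u} = {y \<in> \<tau>. y < u}" using that by auto
        ultimately show ?thesis by (simp add: s_def)
      qed
      fix u w assume uw: "u \<in> X - \<tau>" "w \<in> X - \<tau>" "u \<noteq> w"
      then have "s \<tau> u * s (insert u \<tau>) w = - (s \<tau> w * s (insert w \<tau>) u)"
        using less[of u w] less[of w u] by (cases "u < w") auto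
      then show "s \<tau> u * s (insert u \<tau>) w * c (insert w (insert u \<tau>)) =
          - (s \<tau> w * s (insert w \<tau>) u * c (insert u (insert w \<tau>)))"
        by (simp add: insert_commute)
    qed
    finally show ?thesis by simp
  qed
qed

section \<open>The cone as a contraction of the full simplex\<close>

definition cone :: "('a set \<Rightarrow> 'k::field) \<Rightarrow> 'a set \<Rightarrow> 'k" where
  "cone c \<sigma> = (if Min X \<in> \<sigma> then c (\<sigma> - {Min X}) else 0)"

lemma cone_add: "cone (c + e) = cone c + cone e"
  and cone_scale: "cone (\<lambda>\<sigma>. x * c \<sigma>) = (\<lambda>\<sigma>. x * cone c \<sigma>)"
  by (auto simp: cone_def fun_eq_iff)

lemma cone_zero [simp]: "cone 0 = 0"
  by (simp add: cone_def fun_eq_iff zero_fun_def)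

lemma cone_full:
  assumes "c \<in> chains full p"
  shows "cone c \<in> chains full (Suc p)"
  unfolding chains_eq[OF subset_refl]
proof (intro CollectI allI impI)
  fix \<sigma> assume "cone c \<sigma> \<noteq> 0"
  then have "Min X \<in> \<sigma>" "c (\<sigma> - {Min X}) \<noteq> 0" by (auto simp: cone_def split: if_splits)
  moreover from this assms have *: "\<sigma> - {Min X} \<in> full" "card (\<sigma> - {Min X}) = Suc p"
    by (auto simp: chains_eq)
  moreover have "finite \<sigma>" using card_ge_0_finite[of "\<sigma> - {Min X}"] *(2) by simp
  moreover have "Min X \<in> X" using finite_vertices nonempty_vertices by simp
  ultimately show "\<sigma> \<in> full \<and> card \<sigma> = Suc p + 1" by (auto simp: full_def)
qed

text \<open>The cone over the smallest vertex involves no signs.\<close>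

lemma cone_homotopy:
  assumes c: "c \<in> chains full (Suc p)"
  shows "bd (cone c) + cone (bd c) = c"
proof
  fix \<tau>
  define v where "v = Min X"
  have v: "v \<in> X" "\<And>w. w \<in> X \<Longrightarrow> v \<le> w"
    using finite_vertices nonempty_vertices by (auto simp: v_def)
  have cone: "cone e \<sigma> = (if v \<in> \<sigma> then e (\<sigma> - {v}) else 0)" for e :: "'a set \<Rightarrow> 'b" and \<sigma>
    by (simp add: cone_def v_def)
  note cone_bd = bd_cofaces[OF cone_full[OF c]]
  show "(bd (cone c) + cone (bd c)) \<tau> = c \<tau>"
  proof (cases "\<tau> \<in> full")
    case False
    have "bd (cone c) \<in> chains full (Suc p)" by (intro bd_full cone_full c)
    moreover have "cone (bd c) \<in> chains full (Suc p)" by (intro bd_full cone_full c)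
    ultimately have "bd (cone c) \<tau> = 0" "cone (bd c) \<tau> = 0" "c \<tau> = 0"
      using False c by (auto simp: chains_eq)
    then show ?thesis by simp
  next
    case True
    then have \<tau>: "\<tau> \<subseteq> X" "\<tau> \<noteq> {}" "finite \<tau>"
      using finite_vertices finite_subset by (auto simp: full_def)
    show ?thesis
    proof (cases "v \<in> \<tau>")
      case False
      have "bd (cone c) \<tau> = (\<Sum>u\<in>{v}. (- 1) ^ card {w \<in> \<tau>. w < u} * cone c (insert u \<tau>))"
        unfolding cone_bd[OF \<tau>(1,2)]
        by (rule sum.mono_neutral_right) (use False v finite_vertices in \<open>auto simp: cone\<close>)
      moreover have "{w \<in> \<tau>. w < v} = {}" using v \<tau> by force
      ultimately show ?thesis using False by (simp add: cone)
    next
      case vin: True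
      show ?thesis
      proof (cases "\<tau> = {v}")
        \<comment> \<open>In positive degree both sides vanish at the apex; for 0-chains the
          homotopy identity would in general fail here.\<close>
        case True
        have "bd (cone c) \<tau> = 0"
          unfolding cone_bd[OF \<tau>(1,2)]
        proof (intro sum.neutral ballI)
          fix u assume u: "u \<in> X - \<tau>"
          then have "insert u \<tau> - {v} = {u}" using True by blast
          then have "cone c (insert u \<tau>) = c {u}" using vin by (simp add: cone)
          moreover have "c {u} = 0" using c by (auto simp: chains_eq)
          ultimately show "(- 1) ^ card {w \<in> \<tau>. w < u} * cone c (insert u \<tau>) = 0" by simp
        qed
        moreover have "bd c {} = 0" using bd_full[OF c] by (auto simp: chains_eq full_def)
        moreover have "c {v} = 0" using c by (auto simp: chains_eq)
        ultimately show ?thesis using True by (simp add: cone)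
      next
        case False
        \<comment> \<open>In the boundary of \<open>c\<close> at this facet the summand for
          \<open>v\<close> gives \<open>c \<tau>\<close>; the other summands cancel those of
          \<open>bd (cone c) \<tau>\<close>, where the apex, being the first vertex, flips every
          sign.\<close>
        define \<rho> where "\<rho> = \<tau> - {v}"
        have \<rho>: "\<rho> \<subseteq> X" "\<rho> \<noteq> {}" "v \<notin> \<rho>" "\<tau> = insert v \<rho>" "finite \<rho>"
          using False vin \<tau> by (auto simp: \<rho>_def)
        have "bd (cone c) \<tau> = (\<Sum>u\<in>X - \<tau>. - ((- 1) ^ card {w \<in> \<rho>. w < u} * c (insert u \<rho>)))"
          unfolding cone_bd[OF \<tau>(1,2)]
        proof (rule sum.cong)
          fix u assume u: "u \<in> X - \<tau>"
          then have "v < u" using v vin by (metis DiffD1 DiffD2 order_le_less)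
          then have "{w \<in> \<tau>. w < u} = insert v {w \<in> \<rho>. w < u}" using \<rho>(4) by blast
          moreover have "insert u \<tau> - {v} = insert u \<rho>" using \<rho> \<open>v < u\<close> by blast
          moreover have "v \<notin> {w \<in> \<rho>. w < u}" "finite {w \<in> \<rho>. w < u}" using \<rho> by auto
          moreover have "v \<in> insert u \<tau>" using vin by blast
          ultimately show "(- 1) ^ card {w \<in> \<tau>. w < u} * cone c (insert u \<tau>) =
              - ((- 1) ^ card {w \<in> \<rho>. w < u} * c (insert u \<rho>))"
            by (simp add: cone)
        qed simp
        moreover have "cone (bd c) \<tau> = (\<Sum>u\<in>X - \<rho>. (- 1) ^ card {w \<in> \<rho>. w < u} * c (insert u \<rho>))"
        proof -
          have "cone (bd c) \<tau> = bd c \<rho>" unfolding cone \<rho>_def using vin by simp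
          then show ?thesis by (simp only: bd_cofaces[OF c \<rho>(1,2)])
        qed
        moreover have "X - \<rho> = insert v (X - \<tau>)" using \<rho> v by blast
        moreover have "{w \<in> \<rho>. w < v} = {}" using v(2) \<rho>(1) leD by blast
        moreover have "c (insert v \<rho>) = c \<tau>" using \<rho>(4) by simp
        ultimately show ?thesis
          using vin finite_vertices by (simp add: sum_negf)
      qed
    qed
  qed
qed

text \<open>The quotient of the full chains by those of \<open>C\<close> is represented by functions
  on \<open>rel\<close>: each class has a canonical representative, with boundary
  \<open>restr (bd c)\<close>.\<close>

definition restr :: "('a set \<Rightarrow> 'k::field) \<Rightarrow> 'a set \<Rightarrow> 'k" where
  "restr c \<sigma> = (if \<sigma> \<in> rel then c \<sigma> else 0)"

lemma restr_add: "restr (c + e) = restr c + restr e"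
  and restr_diff: "restr (c - e) = restr c - restr e"
  and restr_scale: "restr (\<lambda>\<sigma>. x * c \<sigma>) = (\<lambda>\<sigma>. x * restr c \<sigma>)"
  by (auto simp: restr_def fun_eq_iff)

lemma restr_zero [simp]: "restr 0 = 0"
  by (simp add: restr_def fun_eq_iff)

lemma restr_rel: "c \<in> chains full p \<Longrightarrow> restr c \<in> chains rel p"
  by (auto simp: chains_eq rel_full restr_def)

lemma restr_eq_zero_iff: "c \<in> chains full p \<Longrightarrow> restr c = 0 \<longleftrightarrow> c \<in> chains C p"
proof -
  assume c: "c \<in> chains full p"
  have "restr c = 0 \<longleftrightarrow> (\<forall>\<sigma>. c \<sigma> \<noteq> 0 \<longrightarrow> \<sigma> \<notin> rel)"
    by (auto simp: restr_def fun_eq_iff)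
  also have "\<dots> \<longleftrightarrow> (\<forall>\<sigma>. c \<sigma> \<noteq> 0 \<longrightarrow> \<sigma> \<in> C)"
    using c by (auto simp: chains_eq rel_def)
  also have "\<dots> \<longleftrightarrow> c \<in> chains C p"
    using c by (auto simp: chains_def)
  finally show ?thesis .
qed

lemma restr_id: "c \<in> chains rel p \<Longrightarrow> restr c = c"
  by (auto simp: chains_eq rel_full restr_def fun_eq_iff)

text \<open>The discarded part lives on the subcomplex \<open>C\<close>, and so does its boundary.
  Thus the boundary of the quotient can be computed on any representative and, by
  \<open>bd_bd\<close>, squares to 0.\<close>

lemma restr_bd_restr:
  assumes c: "c \<in> chains full (Suc p)"
  shows "restr (bd (restr c)) = restr (bd c)"
proof -
  have "restr c \<in> chains full (Suc p)" by (rule chains_full[OF rel_full restr_rel[OF c]])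
  then have d: "c - restr c \<in> chains full (Suc p)" using c by (intro chains_diff) simp_all
  have "restr (c - restr c) = 0" by (auto simp: restr_def fun_eq_iff)
  then have "c - restr c \<in> chains C (Suc p)" by (simp only: restr_eq_zero_iff[OF d])
  then have "bd (c - restr c) \<in> chains C p" by (rule bd_C)
  then have "restr (bd (c - restr c)) = 0"
    by (simp only: restr_eq_zero_iff[OF bd_full[OF d]])
  then show ?thesis by (simp add: bd_diff restr_diff)
qed

text \<open>The full complex on \<open>X\<close> is a cone, so its homology vanishes and the connecting map of the
  pair is an isomorphism; a preimage of a cycle \<open>z\<close> is the restriction of \<open>cone z\<close>.\<close>

theorem coordinates_connecting:
  fixes f :: "('a set \<Rightarrow> 'k::field) \<Rightarrow> 'i \<Rightarrow> 'k"
  assumes f: "coordinates {c \<in> chains rel (Suc (Suc p)). restr (bd c) = 0}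
      ((\<lambda>c. restr (bd c)) ` chains rel (Suc (Suc (Suc p)))) I f" (is "coordinates ?Zr ?Br I f")
  shows "coordinates (cycles C (Suc p)) (boundaries C (Suc p)) I (\<lambda>z. f (restr (cone z)))"
proof -
  have cyc: "z \<in> chains C (Suc p)" "z \<in> chains full (Suc p)" "bd z = 0"
    "cone z \<in> chains full (Suc (Suc p))" "bd (cone z) = z" "restr (cone z) \<in> ?Zr"
    if "z \<in> cycles C (Suc p)" for z :: "'a set \<Rightarrow> 'k"
  proof -
    show zC: "z \<in> chains C (Suc p)" using that by (simp add: cycles_def)
    then show z: "z \<in> chains full (Suc p)" by (rule chains_full[OF C_full])
    show bz: "bd z = 0" using that boundary_eq_bd[OF z] by (simp add: cycles_def)
    show cz: "cone z \<in> chains full (Suc (Suc p))" by (rule cone_full[OF z])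
    show "bd (cone z) = z" using cone_homotopy[OF z] bz by simp
    then have "restr (bd (cone z)) = 0" using zC restr_eq_zero_iff[OF z] by simp
    then show "restr (cone z) \<in> ?Zr" using restr_rel[OF cz] restr_bd_restr[OF cz] by simp
  qed
  have acyclic: "\<exists>e\<in>chains full (Suc (Suc (Suc p))). c = bd e"
    if "c \<in> chains full (Suc (Suc p))" "bd c = 0" for c :: "'a set \<Rightarrow> 'k"
    using cone_homotopy[OF that(1)] cone_full[OF that(1)] that(2)
    by (intro bexI[of _ "cone c"]) simp_all
  have Br: "restr (bd e) \<in> ?Br" "restr (bd e) \<in> ?Zr" if "e \<in> chains full (Suc (Suc (Suc p)))"
    for e :: "'a set \<Rightarrow> 'k"
  proof -
    show "restr (bd e) \<in> ?Br"
      by (intro image_eqI[where x = "restr e"]) (simp_all add: restr_rel[OF that] restr_bd_restr[OF that])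
    have b: "bd e \<in> chains full (Suc (Suc p))" by (rule bd_full[OF that])
    then show "restr (bd e) \<in> ?Zr"
      using restr_rel[OF b] restr_bd_restr[OF b] bd_bd[OF that] by simp
  qed
  have f_add: "f (z + w) = f z + f w" if "z \<in> ?Zr" "w \<in> ?Zr" for z w
    using f that unfolding coordinates_def by blast
  have f_scale: "f (\<lambda>\<sigma>. a * z \<sigma>) = (\<lambda>i. a * f z i)" if "z \<in> ?Zr" for a z
    using f that unfolding coordinates_def by blast
  have f_image: "f ` ?Zr = {g. \<forall>i. g i \<noteq> 0 \<longrightarrow> i \<in> I}"
    using f unfolding coordinates_def by blast
  have f_ker: "f z = 0 \<longleftrightarrow> z \<in> ?Br" if "z \<in> ?Zr" for z
    using f that unfolding coordinates_def by blast
  have f_absorb: "f (q + restr (bd e)) = f q"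
    if "q \<in> ?Zr" "e \<in> chains full (Suc (Suc (Suc p)))" for q e
    using f_add[OF that(1) Br(2)[OF that(2)]] f_ker[OF Br(2)[OF that(2)]] Br(1)[OF that(2)] by simp
  have ker: "f (restr (cone z)) = 0 \<longleftrightarrow> z \<in> boundaries C (Suc p)" if z: "z \<in> cycles C (Suc p)" for z
  proof
    assume "f (restr (cone z)) = 0"
    then have "restr (cone z) \<in> ?Br" using f_ker cyc(6)[OF z] by blast
    then obtain e where e: "e \<in> chains rel (Suc (Suc (Suc p)))" "restr (cone z) = restr (bd e)"
      by blast
    then have e': "e \<in> chains full (Suc (Suc (Suc p)))" by (intro chains_full[OF rel_full])
    \<comment> \<open>Subtracting \<open>bd e\<close> pushes the cone into \<open>C\<close> without
      changing its boundary \<open>z\<close>.\<close>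
    define d where "d = cone z - bd e"
    have d: "d \<in> chains full (Suc (Suc p))"
      unfolding d_def by (intro chains_diff cyc(4)[OF z] bd_full e') simp
    moreover have "restr d = 0" using e(2) by (simp add: d_def restr_diff)
    ultimately have "d \<in> chains C (Suc (Suc p))" by (simp only: restr_eq_zero_iff)
    moreover have "boundary d = z"
      using boundary_eq_bd[OF d] cyc(5)[OF z] bd_bd[OF e'] by (simp add: d_def bd_diff)
    ultimately show "z \<in> boundaries C (Suc p)" by (auto simp: boundaries_def)
  next
    assume "z \<in> boundaries C (Suc p)"
    then obtain d where d: "d \<in> chains C (Suc (Suc p))" "z = boundary d"
      by (auto simp: boundaries_def)
    have d': "d \<in> chains full (Suc (Suc p))" using chains_full[OF C_full d(1)] .
    \<comment> \<open>Both chains fill \<open>z\<close>, so by acyclicity of the full simplex they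
      differ by a boundary; modulo \<open>C\<close>, where \<open>d\<close> vanishes, the cone is a
      boundary.\<close>
    have "bd (cone z - d) = 0" using cyc(5)[OF z] d(2) boundary_eq_bd[OF d'] by (simp add: bd_diff)
    then obtain e where e: "e \<in> chains full (Suc (Suc (Suc p)))" "cone z - d = bd e"
      using acyclic[of "cone z - d"] chains_diff[OF cyc(4)[OF z] d'] by auto
    have "restr (cone z) = restr (bd e)"
      using arg_cong[OF e(2), of restr] d(1) restr_eq_zero_iff[OF d'] by (simp add: restr_diff)
    then show "f (restr (cone z)) = 0" using f_ker Br[OF e(1)] by simp
  qed
  have surj: "f q \<in> (\<lambda>z. f (restr (cone z))) ` cycles C (Suc p)" if q: "q \<in> ?Zr" for q
  proof -
    have q': "q \<in> chains full (Suc (Suc p))" using q by (intro chains_full[OF rel_full]) simp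
    then have bq: "bd q \<in> chains full (Suc p)" by (rule bd_full)
    moreover have "bd q \<in> chains C (Suc p)" using restr_eq_zero_iff[OF bq] q by simp
    ultimately have z: "bd q \<in> cycles C (Suc p)"
      using boundary_eq_bd[OF bq] bd_bd[OF q'] by (simp add: cycles_def)
    \<comment> \<open>The cycle \<open>bd q\<close> of \<open>C\<close> is mapped back to the class
      of \<open>q\<close>, because \<open>q\<close> and \<open>cone (bd q)\<close> have the same
      boundary.\<close>
    have "bd (cone (bd q) - q) = 0" using cyc(5)[OF z] by (simp add: bd_diff)
    then obtain e where e: "e \<in> chains full (Suc (Suc (Suc p)))" "cone (bd q) - q = bd e"
      using acyclic[of "cone (bd q) - q"] chains_diff[OF cyc(4)[OF z] q'] by auto
    then have "cone (bd q) = q + bd e" by (simp add: algebra_simps)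
    moreover have "restr q = q" using q restr_id by blast
    ultimately have "restr (cone (bd q)) = q + restr (bd e)" by (simp add: restr_add)
    then have "f (restr (cone (bd q))) = f q" using f_absorb[OF q e(1)] by simp
    then show ?thesis using z by (intro image_eqI[where x = "bd q"]) simp_all
  qed
  show ?thesis
    unfolding coordinates_def f_image[symmetric]
  proof (intro conjI ballI allI)
    fix z w :: "'a set \<Rightarrow> 'k" assume "z \<in> cycles C (Suc p)" "w \<in> cycles C (Suc p)"
    then show "f (restr (cone (z + w))) = f (restr (cone z)) + f (restr (cone w))"
      by (simp only: cone_add restr_add f_add[OF cyc(6) cyc(6)])
  next
    fix a and z :: "'a set \<Rightarrow> 'k" assume "z \<in> cycles C (Suc p)"
    then show "f (restr (cone (\<lambda>\<sigma>. a * z \<sigma>))) = (\<lambda>i. a * f (restr (cone z)) i)"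
      using f_scale[OF cyc(6)] by (simp add: cone_scale restr_scale)
  next
    show "(\<lambda>z. f (restr (cone z))) ` cycles C (Suc p) = f ` ?Zr"
      using surj cyc(6) by blast
  qed (use ker in auto)
qed

end

section \<open>The simplices missing from a Dowker complex of the cycle network\<close>

text \<open>The nonempty sets of nodes that meet every \<open>r\<close> cyclically consecutive nodes: the inequality between
  \<open>Min\<close> and \<open>Max\<close> bounds the gap around \<open>n\<close>. For \<open>r = n - 1 - \<delta>\<close> these are the nonsimplices of the
  Dowker complex.\<close>

definition dense_sets :: "nat \<Rightarrow> nat \<Rightarrow> nat set set" where
  "dense_sets n r = {S. S \<noteq> {} \<and> S \<subseteq> {1..n} \<and> Min S + n \<le> Max S + r \<and>
     (\<forall>x\<in>S. x < Max S \<longrightarrow> (\<exists>y\<in>S. x < y \<and> y \<le> x + r))}"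

section \<open>Distances in the cycle network\<close>

lemma cycle_edges_iff:
  assumes "a \<in> {1..n}"
  shows "(a, b) \<in> cycle_edges n \<longleftrightarrow> b \<in> {1..n} \<and> b mod n = Suc a mod n"
proof (cases "a = n")
  case True
  have "b = 1" if "b \<in> {1..n}" "b mod n = Suc 0 mod n" for b
  proof (cases "b = n")
    case True
    with that show ?thesis by (cases "n = 1") auto
  next
    case False
    with that show ?thesis by (cases "n = 1") auto
  qed
  moreover have "Suc n mod n = Suc 0 mod n" by (metis add_Suc_right add_0_right mod_add_self1 add.commute)
  ultimately show ?thesis using True assms by (auto simp: cycle_edges_def)
next
  case False
  have "b = Suc a" if "b \<in> {1..n}" "b mod n = Suc a mod n"
  proof (cases "b = n")
    case True
    with that show ?thesis using False assms by (cases "Suc a = n") auto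
  next
    case bn: False
    with that show ?thesis using False assms by (cases "Suc a = n") auto
  qed
  then show ?thesis using False assms by (auto simp: cycle_edges_def)
qed

lemma cycle_edges_power_iff:
  assumes "a \<in> {1..n}"
  shows "(a, b) \<in> cycle_edges n ^^ m \<longleftrightarrow> b \<in> {1..n} \<and> b mod n = (a + m) mod n"
proof (induction m arbitrary: b)
  case 0
  have "a = b" if "b \<in> {1..n}" "b mod n = a mod n"
    using that assms by (cases "a = n"; cases "b = n") auto
  then show ?case using assms by auto
next
  case (Suc m)
  have "(a, b) \<in> cycle_edges n ^^ Suc m \<longleftrightarrow>
      (\<exists>c. (c \<in> {1..n} \<and> c mod n = (a + m) mod n) \<and> (c, b) \<in> cycle_edges n)"
    using Suc.IH by auto
  also have "\<dots> \<longleftrightarrow> (\<exists>c. c \<in> {1..n} \<and> c mod n = (a + m) mod n \<and> b \<in> {1..n} \<and> b mod n = Suc c mod n)"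
    using cycle_edges_iff by blast
  also have "\<dots> \<longleftrightarrow> b \<in> {1..n} \<and> b mod n = (a + Suc m) mod n" (is "?L \<longleftrightarrow> ?R")
  proof
    assume ?L
    then show ?R by (metis add_Suc_right mod_Suc_eq)
  next
    assume R: ?R
    \<comment> \<open>Residue 0 is represented by the node \<open>n\<close>, not by 0.\<close>
    define c where "c = (if (a + m) mod n = 0 then n else (a + m) mod n)"
    have "n > 0" using assms by auto
    then have "c \<in> {1..n}" "c mod n = (a + m) mod n"
      by (auto simp: c_def Suc_le_eq less_imp_le)
    moreover from this(2) have "Suc c mod n = (a + Suc m) mod n" by (metis add_Suc_right mod_Suc_eq)
    ultimately show ?L using R by metis
  qed
  finally show ?case .
qed

lemma cycle_weight_eq:
  assumes x: "x \<in> {1..n}" and y: "y \<in> {1..n}"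
  shows "cycle_weight n x y = real (if x \<le> y then y - x else y + n - x)"
proof -
  let ?d = "if x \<le> y then y - x else y + n - x"
  have d: "(x + ?d) mod n = y mod n" "?d < n" using x y by auto
  have "(LEAST m. (x, y) \<in> cycle_edges n ^^ m) = ?d"
  proof (rule Least_equality)
    show "(x, y) \<in> cycle_edges n ^^ ?d"
      using cycle_edges_power_iff[OF x] y d(1) by simp
    fix m assume "(x, y) \<in> cycle_edges n ^^ m"
    then have "(x + m) mod n = (x + ?d) mod n"
      using cycle_edges_power_iff[OF x] d(1) by simp
    then have "m mod n = ?d mod n"
      unfolding nat_mod_eq_iff by (simp add: add.assoc)
    then show "?d \<le> m" using d(2) by (metis mod_less mod_less_eq_dividend)
  qed
  then show ?thesis by (simp add: cycle_weight_def)
qed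

text \<open>Distances are integers, so only \<open>\<kappa> = \<lfloor>\<delta>\<rfloor>\<close>
  matters.\<close>

lemma dowker_sink_cycle:
  assumes \<delta>: "real \<kappa> \<le> \<delta>" "\<delta> < real \<kappa> + 1"
  shows "dowker_sink (cycle_nodes n) (cycle_weight n) \<delta> =
    {\<sigma>. \<sigma> \<subseteq> {1..n} \<and> \<sigma> \<noteq> {} \<and> (\<exists>y\<in>{1..n}. \<forall>x\<in>\<sigma>. (if x \<le> y then y - x else y + n - x) \<le> \<kappa>)}"
proof -
  have "real d \<le> \<delta> \<longleftrightarrow> d \<le> \<kappa>" for d using \<delta> by linarith
  then have "cycle_weight n x y \<le> \<delta> \<longleftrightarrow> (if x \<le> y then y - x else y + n - x) \<le> \<kappa>"
    if "x \<in> {1..n}" "y \<in> {1..n}" for x y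
    using cycle_weight_eq[OF that] by presburger
  then show ?thesis unfolding dowker_sink_def cycle_nodes_def by blast
qed

lemma dowker_sink_cycle_neg:
  assumes "\<delta> < 0"
  shows "dowker_sink (cycle_nodes n) (cycle_weight n) \<delta> = {}"
proof -
  have "\<not> cycle_weight n x y \<le> \<delta>" for x y
    using assms by (simp add: cycle_weight_def)
  then show ?thesis by (auto simp: dowker_sink_def)
qed

text \<open>The node \<open>n\<close> is reached from every node within \<open>n - 1\<close> steps
  and serves as a common sink.\<close>

lemma dowker_sink_cycle_full:
  assumes \<delta>: "real n - 1 \<le> \<delta>" and n: "n \<ge> 1"
  shows "dowker_sink (cycle_nodes n) (cycle_weight n) \<delta> = Pow {1..n} - {{}}"
proof -
  have "cycle_weight n x n \<le> \<delta>" if "x \<in> {1..n}" for x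
    using cycle_weight_eq[OF that, of n] that \<delta> n by (auto simp: of_nat_diff)
  moreover have "n \<in> {1..n}" using n by simp
  ultimately show ?thesis unfolding dowker_sink_def cycle_nodes_def by blast
qed

text \<open>The nodes that reach \<open>y\<close> within \<open>\<kappa>\<close> steps form the arc
  of \<open>\<kappa> + 1\<close> nodes ending at \<open>y\<close>. Its complement consists of the
  \<open>r\<close> nodes following \<open>y\<close>, so having a sink means leaving out
  \<open>r\<close> consecutive nodes.\<close>

lemma not_dense_iff:
  assumes \<kappa>: "n = Suc (\<kappa> + r)" and \<sigma>: "\<sigma> \<subseteq> {1..n}" "\<sigma> \<noteq> {}"
  shows "\<sigma> \<notin> dense_sets n r \<longleftrightarrow>
    (\<exists>y\<in>{1..n}. \<forall>x\<in>\<sigma>. (if x \<le> y then y - x else y + n - x) \<le> \<kappa>)" (is "_ \<longleftrightarrow> ?sink")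
proof
  have fin: "finite \<sigma>" using \<sigma> finite_subset by blast
  have mm: "Min \<sigma> \<in> \<sigma>" "Max \<sigma> \<in> \<sigma>" "\<And>x. x \<in> \<sigma> \<Longrightarrow> Min \<sigma> \<le> x \<and> x \<le> Max \<sigma>"
    using fin \<sigma> by auto
  have range: "1 \<le> x \<and> x \<le> n" if "x \<in> \<sigma>" for x using that \<sigma> by auto
  {
    assume "\<sigma> \<notin> dense_sets n r"
    then consider "Max \<sigma> + r < Min \<sigma> + n"
      | x0 where "x0 \<in> \<sigma>" "x0 < Max \<sigma>" "\<And>y. y \<in> \<sigma> \<Longrightarrow> x0 < y \<Longrightarrow> x0 + r < y"
      using \<sigma> unfolding dense_sets_def by (auto simp: not_le)
    then show ?sink
    proof cases
      \<comment> \<open>The gap across the cut between \<open>n\<close> and 1 is too long, and the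
        last node before it is a sink.\<close>
      case 1
      have "(if x \<le> Max \<sigma> then Max \<sigma> - x else Max \<sigma> + n - x) \<le> \<kappa>" if "x \<in> \<sigma>" for x
        using mm(3)[OF that] 1 \<kappa> by auto
      then show ?thesis using mm(2) \<sigma> by blast
    next
      case 2
      have "x0 + r < Max \<sigma>" using 2 mm by blast
      then have "(if x \<le> x0 then x0 - x else x0 + n - x) \<le> \<kappa>" if "x \<in> \<sigma>" for x
        using 2(3)[OF that] range[OF mm(2)] range[OF that] \<kappa> by auto
      then show ?thesis using 2(1) \<sigma> by blast
    qed
  next
    assume ?sink
    then obtain y where y: "y \<in> {1..n}" "\<And>x. x \<in> \<sigma> \<Longrightarrow> (if x \<le> y then y - x else y + n - x) \<le> \<kappa>"
      by blast
    have above: "y + r < x" if "x \<in> \<sigma>" "y < x" for x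
      using y(2)[OF that(1)] that(2) range[OF that(1)] \<kappa> by (auto split: if_splits)
    show "\<sigma> \<notin> dense_sets n r"
    proof
      assume "\<sigma> \<in> dense_sets n r"
      then have d: "Min \<sigma> + n \<le> Max \<sigma> + r"
        "\<And>x. x \<in> \<sigma> \<Longrightarrow> x < Max \<sigma> \<Longrightarrow> \<exists>y\<in>\<sigma>. x < y \<and> y \<le> x + r"
        by (auto simp: dense_sets_def)
      show False
      proof (cases "Max \<sigma> \<le> y")
        case True
        then have "y - Min \<sigma> \<le> \<kappa>" using y(2)[OF mm(1)] mm(3)[OF mm(2)] by (auto split: if_splits)
        then show False using True d(1) \<kappa> by linarith
      next
        case ny: False
        show False
        proof (cases "\<exists>x\<in>\<sigma>. x \<le> y")
          case True
          \<comment> \<open>The last node of \<open>\<sigma>\<close> at or before \<open>y\<close>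
            has a successor at distance at most \<open>r\<close>, but nodes of
            \<open>\<sigma>\<close> beyond \<open>y\<close> start only after
            \<open>y + r\<close>.\<close>
          define Z where "Z = {x \<in> \<sigma>. x \<le> y}"
          have Z: "finite Z" "Z \<noteq> {}" using fin True by (auto simp: Z_def)
          have m: "Max Z \<in> \<sigma>" "Max Z \<le> y" using Max_in[OF Z] by (auto simp: Z_def)
          then obtain w where w: "w \<in> \<sigma>" "Max Z < w" "w \<le> Max Z + r" using d(2)[of "Max Z"] ny by auto
          have "y < w"
          proof (rule ccontr)
            assume "\<not> y < w"
            then have "w \<in> Z" using w by (auto simp: Z_def)
            then show False using Max_ge[OF Z(1)] w(2) by fastforce
          qed
          then show False using above[OF w(1)] w m by linarith
        next
          case False
          then have "y + r < Min \<sigma>" using above mm(1) by (meson not_le)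
          then show False using d(1) range[OF mm(2)] y(1) by auto
        qed
      qed
    qed
  }
qed

lemma dowker_sink_dense:
  assumes "n = Suc (\<kappa> + r)" "real \<kappa> \<le> \<delta>" "\<delta> < real \<kappa> + 1"
  shows "dowker_sink (cycle_nodes n) (cycle_weight n) \<delta> = Pow {1..n} - {{}} - dense_sets n r"
  unfolding dowker_sink_cycle[OF assms(2,3)] using not_dense_iff[OF assms(1)] by blast

section \<open>An acyclic matching of the missing simplices\<close>

text \<open>A set starts by following the pattern of gaps \<open>1, r, 1, r, \<dots>\<close> from its minimum; \<open>stop\<close> is the number
  of complete periods, and the matching toggles \<open>pivot\<close>, the node after the last period. This is the
  usual matching for the bar complex of the truncated polynomial ring \<open>K[x]/(x^(r+1))\<close>.\<close>

definition post :: "nat \<Rightarrow> nat set \<Rightarrow> nat \<Rightarrow> nat" where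
  "post r S i = Min S + i * Suc r"

definition step :: "nat \<Rightarrow> nat set \<Rightarrow> nat \<Rightarrow> bool" where
  "step r S i \<longleftrightarrow>
     S \<inter> {post r S i<..post r S i + Suc r} = {Suc (post r S i), post r S i + Suc r}"

definition stop :: "nat \<Rightarrow> nat set \<Rightarrow> nat" where
  "stop r S = (LEAST i. \<not> step r S i)"

definition pivot :: "nat \<Rightarrow> nat set \<Rightarrow> nat" where
  "pivot r S = Suc (post r S (stop r S))"

lemma post_0 [simp]: "post r S 0 = Min S"
  and post_Suc: "post r S (Suc i) = post r S i + Suc r"
  by (simp_all add: post_def)

lemma post_mono: "i \<le> j \<Longrightarrow> post r S i \<le> post r S j"
  unfolding post_def by (intro add_left_mono mult_le_mono1)

lemma step_less: "i < stop r S \<Longrightarrow> step r S i"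
  using not_less_Least unfolding stop_def by blast

lemma step_mem:
  assumes "step r S i"
  shows "Suc (post r S i) \<in> S" "post r S (Suc i) \<in> S"
  using assms unfolding step_def post_Suc by blast+

lemma post_mem:
  assumes "finite S" "S \<noteq> {}" "i \<le> stop r S"
  shows "post r S i \<in> S"
  using assms step_less[of "i - 1" r S] step_mem(2)[of r S "i - 1"] by (cases i) auto

lemma stop_eqI:
  assumes "\<And>j. j < i \<Longrightarrow> step r S j" "\<not> step r S i"
  shows "stop r S = i"
  unfolding stop_def by (rule Least_equality) (use assms not_le in blast)+

text \<open>Up to the stop a set is determined by its minimum and the number of periods; this yields
  the cardinalities and the shape of the critical cells.\<close>

lemma below_post:
  assumes S: "finite S" "S \<noteq> {}" and i: "i \<le> stop r S"
  shows "S \<inter> {..post r S i} = post r S ` {..i} \<union> (\<lambda>j. Suc (post r S j)) ` {..<i}"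
  using i
proof (induction i)
  case 0
  show ?case using Min_in[OF S] Min_le[OF S(1)] by (auto intro: antisym)
next
  case (Suc i)
  then have "step r S i" by (intro step_less) simp
  moreover have "{..post r S (Suc i)} = {..post r S i} \<union> {post r S i<..post r S i + Suc r}"
    by (auto simp: post_Suc)
  ultimately have "S \<inter> {..post r S (Suc i)} =
      S \<inter> {..post r S i} \<union> {Suc (post r S i), post r S (Suc i)}"
    unfolding step_def post_Suc by blast
  also have "\<dots> = post r S ` {..Suc i} \<union> (\<lambda>j. Suc (post r S j)) ` {..<Suc i}"
    using Suc by (simp add: atMost_Suc lessThan_Suc Un_ac)
  finally show ?case .
qed

locale cyclic_gaps =
  fixes n r :: nat
  assumes r_pos: "1 \<le> r" and r_less: "r < n"
begin

abbreviation "cells \<equiv> dense_sets n r"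

lemma cells_finite: "S \<in> cells \<Longrightarrow> finite S"
  and cells_nonempty: "S \<in> cells \<Longrightarrow> S \<noteq> {}"
  and cells_range: "S \<in> cells \<Longrightarrow> x \<in> S \<Longrightarrow> 1 \<le> x \<and> x \<le> n"
  and cells_wrap: "S \<in> cells \<Longrightarrow> Min S + n \<le> Max S + r"
  and cells_gap: "S \<in> cells \<Longrightarrow> x \<in> S \<Longrightarrow> x < y \<Longrightarrow> y \<in> S \<Longrightarrow> \<exists>z\<in>S. x < z \<and> z \<le> x + r"
proof -
  show fin: "finite S" if "S \<in> cells" for S
    using that finite_subset[of S "{1..n}"] by (auto simp: dense_sets_def)
  show "\<exists>z\<in>S. x < z \<and> z \<le> x + r" if "S \<in> cells" "x \<in> S" "x < y" "y \<in> S"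
  proof -
    have "x < Max S" using Max_ge[OF fin[OF that(1)] that(4)] that(3) by simp
    then show ?thesis using that unfolding dense_sets_def by blast
  qed
qed (auto simp: dense_sets_def)

lemma finite_cells: "finite cells"
  by (rule finite_subset[of _ "Pow {1..n}"]) (auto simp: dense_sets_def)

text \<open>All periods lie within \<open>{1..n}\<close>, so only finitely many fit; on cells the
  \<open>LEAST\<close> in \<open>stop\<close> is therefore attained.\<close>

lemma ex_not_step:
  assumes "S \<in> cells"
  shows "\<not> step r S n"
proof
  assume "step r S n"
  then have "Suc (post r S n) \<le> n" using step_mem cells_range[OF assms] by blast
  then show False by (simp add: post_def)
qed

lemma not_step_stop: "S \<in> cells \<Longrightarrow> \<not> step r S (stop r S)"
  unfolding stop_def by (rule LeastI) (rule ex_not_step)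

lemma stop_le: "S \<in> cells \<Longrightarrow> stop r S \<le> n"
  unfolding stop_def by (rule Least_le) (rule ex_not_step)

lemma stop_mem: "S \<in> cells \<Longrightarrow> post r S (stop r S) \<in> S"
  using post_mem cells_finite cells_nonempty by blast

section \<open>Toggling the pivot\<close>

lemma Min_less_pivot: "Min S < pivot r S"
  by (simp add: pivot_def post_def)

lemma step_cong_pivot:
  assumes "Min T = Min S" "T - {pivot r S} = S - {pivot r S}" "j < stop r S"
  shows "step r T j"
proof -
  have post: "post r T = post r S" by (simp add: post_def fun_eq_iff assms(1))
  have "post r S j + Suc r \<le> post r S (stop r S)"
    using post_mono[of "Suc j" "stop r S" r S] assms(3) by (simp add: post_Suc)
  then have "pivot r S \<notin> {post r S j<..post r S j + Suc r}" by (simp add: pivot_def)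
  then have "T \<inter> {post r S j<..post r S j + Suc r} = S \<inter> {post r S j<..post r S j + Suc r}"
    using assms(2) by blast
  then show ?thesis using step_less[OF assms(3)] by (simp add: step_def post)
qed

text \<open>Splitting the gap after the last period only shortens gaps. The new node cannot complete
  another period: before the insertion that would have been a gap of length
  \<open>r + 1\<close>.\<close>

lemma
  assumes S: "S \<in> cells" and v: "pivot r S \<notin> S" "pivot r S \<le> n"
  shows insert_pivot_cells: "insert (pivot r S) S \<in> cells"
    and Min_insert_pivot: "Min (insert (pivot r S) S) = Min S"
    and stop_insert_pivot: "stop r (insert (pivot r S) S) = stop r S"
proof -
  let ?v = "pivot r S" and ?p = "post r S (stop r S)"
  let ?T = "insert ?v S"
  note fin = cells_finite[OF S] and ne = cells_nonempty[OF S]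
  have p: "?p \<in> S" "?v = Suc ?p" using stop_mem[OF S] by (simp_all add: pivot_def)
  show Min: "Min ?T = Min S"
    unfolding Min_insert[OF fin ne] using Min_less_pivot[of S] by simp
  have MaxT: "Max S \<le> Max ?T" "Max ?T = max ?v (Max S)" using fin ne by simp_all
  have "\<exists>z\<in>?T. x < z \<and> z \<le> x + r" if x: "x \<in> ?T" "x < Max ?T" for x
  proof (cases "x = ?v")
    case True
    then have vm: "?v < Max S" using MaxT x(2) by simp
    have "Max S \<in> S" using fin ne by simp
    then obtain z where z: "z \<in> S" "?p < z" "z \<le> ?p + r"
      using cells_gap[OF S p(1), of "Max S"] vm p by auto
    then have "z \<noteq> ?v" using v by blast
    then show ?thesis using z p(2) True by (intro bexI[of _ z]) auto
  next
    case False
    then have xS: "x \<in> S" using x by simp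
    show ?thesis
    proof (cases "x < Max S")
      case True
      then show ?thesis using cells_gap[OF S xS True] fin ne by auto
    next
      case False
      \<comment> \<open>The maximum grows only if the pivot follows the old maximum, which is then
        the end of the last period.\<close>
      then have "x = Max S" using Max_ge[OF fin xS] by simp
      moreover have "?p \<le> Max S" using fin p by simp
      ultimately have "x = ?p" using x(2) MaxT(2) p(2) by simp
      then show ?thesis using r_pos p(2) by (intro bexI[of _ ?v]) auto
    qed
  qed
  moreover have "Min ?T + n \<le> Max ?T + r" using Min MaxT cells_wrap[OF S] by simp
  moreover have "?T \<subseteq> {1..n}" using v(2) cells_range[OF S] p(2) by auto
  ultimately show T: "?T \<in> cells" by (simp add: dense_sets_def)
  have post: "post r ?T = post r S" by (simp add: post_def fun_eq_iff Min)
  show "stop r ?T = stop r S"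
  proof (rule stop_eqI)
    show "step r ?T j" if "j < stop r S" for j
      by (rule step_cong_pivot[OF Min _ that]) blast
    show "\<not> step r ?T (stop r S)"
    proof
      assume "step r ?T (stop r S)"
      then have eq: "?T \<inter> {?p<..?p + Suc r} = {?v, ?p + Suc r}"
        unfolding step_def post p(2)[symmetric] .
      moreover have "?p + Suc r \<noteq> ?v" using r_pos p(2) by simp
      ultimately have far: "?p + Suc r \<in> S" by blast
      then obtain z where "z \<in> S" "?p < z" "z \<le> ?p + r"
        using cells_gap[OF S p(1) _ far] by auto
      then have "z \<in> {?v, ?p + Suc r}" unfolding eq[symmetric] by simp
      then show False using \<open>z \<in> S\<close> \<open>z \<le> ?p + r\<close> v(1) by auto
    qed
  qed
qed

text \<open>Deleting the pivot merges a gap 1 with the next gap. The result is at most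
  \<open>r\<close>, since otherwise the two gaps would be \<open>1, r\<close> and form one more
  period. Only the gap across the cut escapes this argument: it becomes \<open>r + 1\<close> exactly
  if \<open>n = Suc (stop r S) * Suc r\<close>.\<close>

lemma
  assumes S: "S \<in> cells" and v: "pivot r S \<in> S"
    and not_last: "pivot r S = Max S \<Longrightarrow> n \<noteq> Suc (stop r S) * Suc r"
  shows remove_pivot_cells: "S - {pivot r S} \<in> cells"
    and Min_remove_pivot: "Min (S - {pivot r S}) = Min S"
    and stop_remove_pivot: "stop r (S - {pivot r S}) = stop r S"
proof -
  let ?v = "pivot r S" and ?p = "post r S (stop r S)"
  let ?T = "S - {?v}"
  note fin = cells_finite[OF S] and ne = cells_nonempty[OF S]
  have p: "?p \<in> S" "?v = Suc ?p" using stop_mem[OF S] by (simp_all add: pivot_def)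
  have pT: "?p \<in> ?T" using p by simp
  have finT: "finite ?T" using fin by simp
  have MinS: "Min S \<in> ?T" using Min_less_pivot[of S] fin ne by simp
  show Min: "Min ?T = Min S"
    by (rule Min_eqI) (use fin MinS in auto)
  have post: "post r ?T = post r S" by (simp add: post_def fun_eq_iff Min)
  have gap_p: "\<exists>z\<in>S. ?v < z \<and> z \<le> ?p + r" if y: "y \<in> S" "?v < y" for y
  proof (rule ccontr)
    assume none: "\<not> ?thesis"
    obtain z where z: "z \<in> S" "?v < z" "z \<le> ?v + r"
      using cells_gap[OF S v y(2,1)] by blast
    then have "z = ?p + Suc r" using none p(2) by force
    moreover have "S \<inter> {?p<..?p + Suc r} \<subseteq> {?v, ?p + Suc r}"
      using none p(2) by force
    ultimately have "S \<inter> {?p<..?p + Suc r} = {?v, ?p + Suc r}"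
      using z(1) v p(2) by auto
    then show False using not_step_stop[OF S] p(2) by (simp add: step_def)
  qed
  have gap: "\<exists>z\<in>?T. x < z \<and> z \<le> x + r" if x: "x \<in> ?T" and y: "y \<in> ?T" "x < y" for x y
  proof (cases "x = ?p")
    case True
    then have "?v < y" using y p(2) by auto
    then show ?thesis using gap_p[of y] y True p(2) by fastforce
  next
    case False
    obtain z where z: "z \<in> S" "x < z" "z \<le> x + r"
      using cells_gap[OF S, of x y] x y by blast
    show ?thesis
    proof (cases "z = ?v")
      case True
      then show ?thesis using z False p pT by (intro bexI[of _ ?p]) auto
    next
      case zv: False
      then show ?thesis using z by blast
    qed
  qed
  have wrap: "Min ?T + n \<le> Max ?T + r"
  proof (cases "?v = Max S")
    case False
    have "Max ?T = Max S"
      by (rule Max_eqI) (use fin ne False in auto)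
    then show ?thesis using Min cells_wrap[OF S] by simp
  next
    case True
    have "n \<noteq> Suc (stop r S) * Suc r" by (rule not_last[OF True])
    \<comment> \<open>Equality here would mean \<open>n = Suc (stop r S) * Suc r\<close>, so
      excluding that case makes the inequality strict.\<close>
    moreover have "Min S + n \<le> Suc ?p + r" using cells_wrap[OF S] True p(2) by simp
    ultimately have "Min S + n \<le> ?p + r" by (simp add: post_def)
    moreover have "?p \<le> Max ?T" using finT pT by (rule Max_ge)
    ultimately show ?thesis using Min by simp
  qed
  have "Max ?T \<in> ?T" using finT pT by (intro Max_in) auto
  then show T: "?T \<in> cells"
    using gap wrap pT cells_range[OF S] unfolding dense_sets_def by auto
  show "stop r ?T = stop r S"
  proof (rule stop_eqI)
    show "step r ?T j" if "j < stop r S" for j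
      by (rule step_cong_pivot[OF Min _ that]) blast
    show "\<not> step r ?T (stop r S)"
      using step_mem(1)[of r ?T "stop r S"] unfolding post p(2)[symmetric] by blast
  qed
qed

section \<open>The matching and its acyclicity\<close>

definition low :: "nat set set" where
  "low = {S \<in> cells. pivot r S \<notin> S \<and> pivot r S \<le> n}"

definition mate :: "nat set \<Rightarrow> nat set" where
  "mate S = insert (pivot r S) S"

text \<open>The lexicographic order of \<open>(Min S, stop r S)\<close> as one number; the base
  \<open>n + 1\<close> exceeds every \<open>stop\<close> of a cell by
  \<open>stop_le\<close>.\<close>

definition key :: "nat set \<Rightarrow> nat" where
  "key S = Min S * Suc n + stop r S"

text \<open>\<open>Min\<close> and \<open>stop\<close> survive the insertion, so the pivot, and with
  it the lower cell, can be read off from the mate.\<close>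

lemma pivot_mate: "S \<in> low \<Longrightarrow> pivot r (mate S) = pivot r S"
  by (simp add: low_def mate_def pivot_def[of r "insert _ _"] post_def stop_insert_pivot Min_insert_pivot)
    (simp add: pivot_def post_def)

lemma mate_cells: "S \<in> low \<Longrightarrow> mate S \<in> cells"
  by (simp add: low_def mate_def insert_pivot_cells)

lemma mate_not_low: "S \<in> low \<Longrightarrow> mate S \<notin> low"
  using pivot_mate[of S] by (simp add: low_def mate_def)

lemma inj_on_mate: "inj_on mate low"
proof
  fix S T assume ST: "S \<in> low" "T \<in> low" "mate S = mate T"
  then have "pivot r S = pivot r T" using pivot_mate by metis
  moreover have "S = mate S - {pivot r S}" "T = mate T - {pivot r T}"
    using ST by (auto simp: mate_def low_def)
  ultimately show "S = T" using ST(3) by metis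
qed

text \<open>The other low facets of \<open>mate S\<close> arise by deleting the minimum, which increases the minimum, or
  an element beyond the pivot, after which the next pivot is later: deleting any other element would
  leave a gap of length \<open>r + 1\<close>.\<close>

lemma key_less:
  assumes S: "S \<in> low" and T: "T \<in> low" "S \<noteq> T" and u: "u \<in> mate S" "T = mate S - {u}"
  shows "key S < key T"
proof -
  define M where "M = mate S"
  let ?i = "stop r S" and ?v = "pivot r S"
  have Sc: "S \<in> cells" "?v \<notin> S" "?v \<le> n" and Tc: "T \<in> cells" "pivot r T \<notin> T"
    using S T by (auto simp: low_def)
  have Mc: "M \<in> cells" unfolding M_def by (rule mate_cells[OF S])
  have MinM: "Min M = Min S" and stopM: "stop r M = ?i"
    unfolding M_def mate_def by (rule Min_insert_pivot stop_insert_pivot Sc)+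
  have postM: "post r M = post r S" by (simp add: post_def fun_eq_iff MinM)
  note finM = cells_finite[OF Mc] and neM = cells_nonempty[OF Mc]
  have vM: "?v \<in> M" by (simp add: M_def mate_def)
  have TM: "T = M - {u}" "u \<in> M" using u by (simp_all add: M_def)
  have uv: "u \<noteq> ?v"
    using T(2) TM(1) Sc(2) by (auto simp: M_def mate_def)
  have finT: "finite T" and neT: "T \<noteq> {}" using cells_finite cells_nonempty Tc(1) by auto
  have vT: "?v \<in> T" using TM uv vM by blast
  show ?thesis
  proof (cases "u = Min M")
    case True
    have "Min T \<in> M" "Min T \<noteq> u" using Min_in[OF finT neT] TM by auto
    then have "Min M < Min T" using True Min_le[OF finM] by (metis order_le_less)
    then have "Suc (Min S) \<le> Min T" using MinM by simp
    then have "Suc (Min S) * Suc n \<le> Min T * Suc n" by (rule mult_le_mono1)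
    then show ?thesis using stop_le[OF Sc(1)] by (simp add: key_def)
  next
    case False
    have MinT: "Min T = Min S"
      unfolding MinM[symmetric] by (rule Min_eqI) (use finM neM False TM in auto)
    have postT: "post r T = post r S" by (simp add: post_def fun_eq_iff MinT)
    have notgap: False if "x \<in> T" "x < ?v" "\<And>z. z \<in> T \<Longrightarrow> x < z \<Longrightarrow> x + r < z" for x
      using cells_gap[OF Tc(1) that(1,2) vT] that(3) by fastforce
    have below: "M \<inter> {..post r S i} = post r S ` {..i} \<union> (\<lambda>j. Suc (post r S j)) ` {..<i}"
      if "i \<le> ?i" for i
      using below_post[OF finM neM, of i r] that by (simp add: stopM postM)
    have ugt: "?v < u"
    proof (rule ccontr)
      assume "\<not> ?v < u"
      then have "u \<le> post r S ?i" using uv by (simp add: pivot_def)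
      then have "u \<in> post r S ` {..?i} \<union> (\<lambda>j. Suc (post r S j)) ` {..<?i}"
        using below[of ?i] TM(2) by blast
      then obtain j where "j < ?i" "u = post r S (Suc j) \<or> u = Suc (post r S j)"
      proof
        assume "u \<in> post r S ` {..?i}"
        then obtain j where j: "j \<le> ?i" "u = post r S j" by blast
        then show ?thesis using False MinM that[of "j - 1"] by (cases j) auto
      qed blast
      moreover have step: "M \<inter> {post r S j<..post r S j + Suc r} = {Suc (post r S j), post r S (Suc j)}"
        using step_less[of j r M] \<open>j < ?i\<close> by (simp add: step_def stopM postM post_Suc)
      moreover have lev: "post r S j < ?v" "Suc (post r S j) < ?v"
        using post_mono[of "Suc j" ?i r S] \<open>j < ?i\<close> r_pos by (simp_all add: pivot_def post_Suc)
      ultimately consider "u = post r S (Suc j)" | "u = Suc (post r S j)" by blast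
      then show False
      proof cases
        \<comment> \<open>Deleting the end of a period merges its gap \<open>r\<close> with the
          following gap 1.\<close>
        case 1
        show False
        proof (rule notgap[of "Suc (post r S j)"])
          show "Suc (post r S j) \<in> T" using step TM(1) 1 r_pos by (auto simp: post_Suc)
          fix z assume z: "z \<in> T" "Suc (post r S j) < z"
          then have "z \<notin> {Suc (post r S j), post r S (Suc j)}" using TM(1) 1 by auto
          moreover have "z \<in> M" using z TM(1) by simp
          ultimately have "z \<notin> {post r S j<..post r S j + Suc r}" using step by blast
          then show "Suc (post r S j) + r < z" using z(2) by simp
        qed (rule lev)
      next
        \<comment> \<open>Deleting the inner node of a period merges its gaps 1 and
          \<open>r\<close>.\<close>
        case 2
        show False
        proof (rule notgap[of "post r S j"])
          have "post r S j \<in> M" using below[of j] \<open>j < ?i\<close> by auto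
          then show "post r S j \<in> T" using TM(1) 2 by simp
          fix z assume z: "z \<in> T" "post r S j < z"
          show "post r S j + r < z"
          proof (rule ccontr)
            assume "\<not> post r S j + r < z"
            then have "z \<in> {Suc (post r S j), post r S (Suc j)}" unfolding step[symmetric] using z TM(1) by auto
            then show False using z TM(1) 2 \<open>\<not> post r S j + r < z\<close> by (auto simp: post_Suc)
          qed
        qed (rule lev)
      qed
    qed
    have "step r T j" if j: "j < ?i" for j
    proof -
      have "post r S j + Suc r < ?v"
        using post_mono[of "Suc j" ?i r S] j by (simp add: pivot_def post_Suc)
      then have "T \<inter> {post r S j<..post r S j + Suc r} = M \<inter> {post r S j<..post r S j + Suc r}"
        using TM(1) ugt by auto
      then show ?thesis using step_less[of j r M] j by (simp add: step_def stopM postM postT)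
    qed
    then have "?i \<le> stop r T"
      using not_step_stop[OF Tc(1)] by (meson not_le)
    \<comment> \<open>With the same stop, \<open>T\<close> would contain its own pivot
      \<open>?v\<close> and not be low.\<close>
    moreover have "stop r T \<noteq> ?i"
      using Tc(2) vT by (auto simp: pivot_def postT)
    ultimately show ?thesis by (simp add: key_def MinT)
  qed
qed

section \<open>The critical cells\<close>

lemma card_below_stop:
  assumes "S \<in> cells"
  shows "card (S \<inter> {..post r S (stop r S)}) = Suc (2 * stop r S)"
proof -
  let ?i = "stop r S"
  have "inj (post r S)" "inj (\<lambda>j. Suc (post r S j))"
    by (auto simp: inj_def post_def simp del: mult_Suc_right)
  then have "card (post r S ` {..?i}) = Suc ?i" "card ((\<lambda>j. Suc (post r S j)) ` {..<?i}) = ?i"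
    by (simp_all add: card_image inj_on_subset)
  moreover have "post r S ` {..?i} \<inter> (\<lambda>j. Suc (post r S j)) ` {..<?i} = {}"
  proof -
    \<comment> \<open>The two progressions differ by 1 modulo \<open>r + 1\<close>, and
      \<open>r + 1 \<ge> 2\<close>.\<close>
    have "j * Suc r \<noteq> Suc (j' * Suc r)" for j j'
    proof
      assume "j * Suc r = Suc (j' * Suc r)"
      then have "(j * Suc r) mod Suc r = Suc (j' * Suc r) mod Suc r" by simp
      moreover have "Suc (j' * Suc r) mod Suc r = 1"
        using r_pos by (simp add: mod_Suc del: mult_Suc_right)
      ultimately show False by (simp del: mult_Suc_right)
    qed
    then show ?thesis by (auto simp: post_def)
  qed
  ultimately show ?thesis
    using below_post[OF cells_finite[OF assms] cells_nonempty[OF assms], of ?i r]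
    by (simp add: card_Un_disjoint)
qed

text \<open>The toggle fails in two ways, both at the cut. Either the pivot would be
  \<open>n + 1\<close>; then \<open>S\<close> consists of complete periods ending at
  \<open>n\<close>, with \<open>2 * stop r S + 1\<close> nodes. Or deleting the pivot would lengthen
  the gap across the cut to \<open>r + 1\<close>; then \<open>S\<close> has the pivot as one more
  node.\<close>

lemma critical_cases:
  assumes S: "S \<in> cells" "S \<notin> low" "S \<notin> mate ` low"
  shows "(odd (card S) \<and> \<not> Suc r dvd n) \<or>
    (pivot r S = Max S \<and> n = Suc (stop r S) * Suc r \<and> card S = 2 * Suc (stop r S))"
proof (cases "pivot r S \<in> S")
  case False
  let ?p = "post r S (stop r S)"
  have "n < pivot r S" using False S by (auto simp: low_def)
  moreover have "?p \<le> n" using stop_mem[OF S(1)] cells_range[OF S(1)] by blast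
  ultimately have p: "?p = n" by (simp add: pivot_def)
  then have "S \<inter> {..?p} = S" using cells_range[OF S(1)] by auto
  then have "odd (card S)" using card_below_stop[OF S(1)] by simp
  \<comment> \<open>\<open>n\<close> is congruent to \<open>Min S\<close> modulo
    \<open>r + 1\<close>, and the gap across the cut forces
    \<open>1 \<le> Min S \<le> r\<close>.\<close>
  moreover have "\<not> Suc r dvd n"
  proof
    assume "Suc r dvd n"
    then have "Suc r dvd Min S" using p unfolding post_def by (metis dvd_add_left_iff dvd_triv_right)
    moreover have "1 \<le> Min S" "Max S \<le> n"
      using cells_range[OF S(1)] cells_finite[OF S(1)] cells_nonempty[OF S(1)] by auto
    moreover have "Min S \<le> r" using cells_wrap[OF S(1)] \<open>Max S \<le> n\<close> by simp
    ultimately show False by (auto dest: dvd_imp_le)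
  qed
  ultimately show ?thesis by blast
next
  case True
  let ?v = "pivot r S" and ?p = "post r S (stop r S)"
  have "\<not> (?v = Max S \<longrightarrow> n \<noteq> Suc (stop r S) * Suc r)"
  proof
    assume not_last: "?v = Max S \<longrightarrow> n \<noteq> Suc (stop r S) * Suc r"
    note remove = remove_pivot_cells[OF S(1) True] Min_remove_pivot[OF S(1) True] stop_remove_pivot[OF S(1) True]
    have "pivot r (S - {?v}) = ?v"
      using remove(2,3) not_last by (simp add: pivot_def[of r "S - _"] post_def) (simp add: pivot_def post_def)
    moreover have "?v \<le> n" using True cells_range[OF S(1)] by blast
    ultimately have "S - {?v} \<in> low" "mate (S - {?v}) = S"
      using remove(1) not_last True by (auto simp: low_def mate_def)
    then show False using S(3) by (metis imageI)
  qed
  then have last: "?v = Max S" "n = Suc (stop r S) * Suc r" by auto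
  have "S = insert ?v (S \<inter> {..?p})"
  proof -
    have "x \<le> ?v" if "x \<in> S" for x using that last(1) cells_finite[OF S(1)] by simp
    then show ?thesis using True by (auto simp: pivot_def le_Suc_eq)
  qed
  moreover have "?v \<notin> S \<inter> {..?p}" by (simp add: pivot_def)
  ultimately have "card S = Suc (card (S \<inter> {..?p}))"
    using cells_finite[OF S(1)] by (metis card_insert_disjoint finite_Int)
  then show ?thesis using last card_below_stop[OF S(1)] by simp
qed

text \<open>The pattern of gaps \<open>1, r, 1, r, \<dots>\<close> closing up around the circle:
  \<open>l + 1\<close> adjacent pairs, \<open>r + 1\<close> apart. With
  \<open>n = (l + 1)(r + 1)\<close> the last pair stays within \<open>{1..n}\<close> just for
  \<open>s \<le> r\<close>; hence the multiplicity \<open>r\<close>.\<close>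

definition ladder :: "nat \<Rightarrow> nat \<Rightarrow> nat set" where
  "ladder s l = (\<lambda>j. s + j * Suc r) ` {..l} \<union> (\<lambda>j. Suc (s + j * Suc r)) ` {..l}"

lemma finite_ladder: "finite (ladder s l)"
  by (simp add: ladder_def)

lemma Min_ladder: "Min (ladder s l) = s"
proof (rule Min_eqI[OF finite_ladder])
  show "s \<in> ladder s l" unfolding ladder_def by (rule UnI1, rule image_eqI[of _ _ 0]) simp_all
qed (auto simp: ladder_def)

lemma ladder_le: "x \<in> ladder s l \<Longrightarrow> x \<le> Suc (s + l * Suc r)"
proof -
  assume "x \<in> ladder s l"
  then obtain j where "j \<le> l" "x \<le> Suc (s + j * Suc r)" unfolding ladder_def by auto
  moreover from this(1) have "j * Suc r \<le> l * Suc r" by (rule mult_le_mono1)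
  ultimately show ?thesis by linarith
qed

lemma Max_ladder: "Max (ladder s l) = Suc (s + l * Suc r)"
  by (rule Max_eqI[OF finite_ladder]) (use ladder_le in \<open>auto simp: ladder_def\<close>)

lemma ladder_mem:
  assumes "j \<le> l"
  shows "s + j * Suc r \<in> ladder s l" "Suc (s + j * Suc r) \<in> ladder s l"
  using assms unfolding ladder_def by blast+

lemma block_le:
  assumes "j * Suc r < Suc (j' * Suc r + r)"
  shows "j \<le> j'"
proof -
  have "j * Suc r < Suc j' * Suc r" using assms by simp
  then show ?thesis using mult_less_cancel2[of j "Suc r" "Suc j'"] by simp
qed

lemma step_ladder:
  assumes "j < l"
  shows "step r (ladder s l) j"
proof -
  let ?p = "s + j * Suc r"
  have "ladder s l \<inter> {?p<..?p + Suc r} \<subseteq> {Suc ?p, ?p + Suc r}"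
  proof
    fix x assume "x \<in> ladder s l \<inter> {?p<..?p + Suc r}"
    then have x: "x \<in> ladder s l" "?p < x" "x \<le> ?p + Suc r" by simp_all
    obtain j' where j': "x = s + j' * Suc r \<or> x = Suc (s + j' * Suc r)"
      using x(1) unfolding ladder_def by blast
    have "j \<le> j'" by (rule block_le) (use x(2) j' r_pos in auto)
    moreover have "j' \<le> Suc j"
      by (rule block_le) (use x(3) j' r_pos in auto)
    ultimately have "j' = j \<or> j' = Suc j" by auto
    then show "x \<in> {Suc ?p, ?p + Suc r}" using j' x(2,3) by auto
  qed
  moreover have "Suc ?p \<in> ladder s l" "?p + Suc r \<in> ladder s l"
    using ladder_mem(2)[of j l s] ladder_mem(1)[of "Suc j" l s] assms by (simp_all add: add_ac)
  ultimately show ?thesis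
    unfolding step_def post_def Min_ladder using r_pos by (intro equalityI) simp_all
qed

lemma stop_ladder: "stop r (ladder s l) = l"
proof (rule stop_eqI[OF step_ladder])
  show "\<not> step r (ladder s l) l"
  proof
    assume "step r (ladder s l) l"
    then have "post r (ladder s l) (Suc l) \<in> ladder s l" by (rule step_mem)
    then show False
      using ladder_le[of "s + Suc l * Suc r" s l] r_pos by (simp add: post_def Min_ladder)
  qed
qed

lemma pivot_ladder: "pivot r (ladder s l) = Suc (s + l * Suc r)"
  by (simp add: pivot_def stop_ladder post_def Min_ladder)

text \<open>The gap across the cut equals \<open>r\<close>, the largest value allowed.\<close>

lemma ladder_cells:
  assumes n: "n = Suc l * Suc r" and s: "1 \<le> s" "s \<le> r"
  shows "ladder s l \<in> cells"
proof -
  have "\<exists>y\<in>ladder s l. x < y \<and> y \<le> x + r"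
    if x: "x \<in> ladder s l" "x < Max (ladder s l)" for x
  proof -
    obtain j where j: "j \<le> l" "x = s + j * Suc r \<or> x = Suc (s + j * Suc r)"
      using x(1) unfolding ladder_def by blast
    show ?thesis
    proof (cases "x = s + j * Suc r")
      case True
      then show ?thesis using ladder_mem(2)[OF j(1)] r_pos by (intro bexI[of _ "Suc x"]) auto
    next
      case False
      then have "j \<noteq> l" using x(2) j(2) Max_ladder by auto
      then have "s + Suc j * Suc r \<in> ladder s l" by (intro ladder_mem) (use j in simp)
      then show ?thesis using False j(2) r_pos by (intro bexI[of _ "s + Suc j * Suc r"]) auto
    qed
  qed
  moreover have "ladder s l \<subseteq> {1..n}"
  proof
    fix x assume "x \<in> ladder s l"
    moreover from this have "s \<le> x" by (auto simp: ladder_def)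
    ultimately show "x \<in> {1..n}" using ladder_le[of x s l] s n by simp
  qed
  moreover have "ladder s l \<noteq> {}" by (simp add: ladder_def)
  ultimately show ?thesis
    using s n unfolding dense_sets_def by (simp add: Min_ladder Max_ladder)
qed

lemma critical_ladder:
  assumes n: "n = Suc l * Suc r" and s: "1 \<le> s" "s \<le> r"
  shows "ladder s l \<notin> low" "ladder s l \<notin> mate ` low" "card (ladder s l) = 2 * Suc l"
proof -
  note cell = ladder_cells[OF assms]
  show low: "ladder s l \<notin> low"
    using ladder_mem(2)[of l l s] by (simp add: low_def pivot_ladder)
  show mate: "ladder s l \<notin> mate ` low"
  proof
    assume "ladder s l \<in> mate ` low"
    then obtain S where S: "S \<in> low" "ladder s l = mate S" by blast
    then have "pivot r S = Suc (s + l * Suc r)" using pivot_mate pivot_ladder by metis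
    then have S_eq: "S = ladder s l - {Suc (s + l * Suc r)}"
      using S by (auto simp: low_def mate_def)
    have Sc: "S \<in> cells" using S by (simp add: low_def)
    have "Max S \<in> S" "Min S \<in> S" using cells_finite[OF Sc] cells_nonempty[OF Sc] by auto
    \<comment> \<open>Without the top node the gap across the cut is at least \<open>r + 1\<close>,
      so \<open>S\<close> is no cell.\<close>
    then have "Max S \<le> s + l * Suc r" using S_eq ladder_le[of "Max S" s l] by auto
    moreover have "Min S \<ge> s" using \<open>Min S \<in> S\<close> S_eq by (auto simp: ladder_def)
    ultimately show False using cells_wrap[OF Sc] n by simp
  qed
  show "card (ladder s l) = 2 * Suc l"
  proof -
    have "Suc r dvd n" unfolding n by (rule dvd_triv_right)
    then show ?thesis using critical_cases[OF cell low mate] by (simp add: stop_ladder)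
  qed
qed

text \<open>Even cardinality rules out the first alternative of \<open>critical_cases\<close>; then
  the pivot is the maximum, and \<open>below_post\<close> describes everything beneath it.\<close>

lemma critical_eq_ladder:
  assumes S: "S \<in> cells" "S \<notin> low" "S \<notin> mate ` low" and even: "even (card S)"
  shows "n = Suc (stop r S) * Suc r" "card S = 2 * Suc (stop r S)"
    "1 \<le> Min S" "Min S \<le> r" "S = ladder (Min S) (stop r S)"
proof -
  have last: "pivot r S = Max S" "n = Suc (stop r S) * Suc r" "card S = 2 * Suc (stop r S)"
    using critical_cases[OF S] even by auto
  then show "n = Suc (stop r S) * Suc r" "card S = 2 * Suc (stop r S)" by blast+
  have mm: "Min S \<in> S" "Max S \<in> S"
    using cells_finite[OF S(1)] cells_nonempty[OF S(1)] by auto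
  show "1 \<le> Min S" using cells_range[OF S(1) mm(1)] by blast
  show "Min S \<le> r" using cells_wrap[OF S(1)] cells_range[OF S(1) mm(2)] by simp
  have "x \<le> pivot r S" if "x \<in> S" for x using that last(1) cells_finite[OF S(1)] by simp
  then have "S = insert (pivot r S) (S \<inter> {..post r S (stop r S)})"
    using mm(2) last(1) by (auto simp: pivot_def le_Suc_eq)
  also have "\<dots> = ladder (Min S) (stop r S)"
    using below_post[OF cells_finite[OF S(1)] cells_nonempty[OF S(1)], of "stop r S" r]
    by (simp add: ladder_def pivot_def post_def lessThan_Suc_atMost[symmetric] lessThan_Suc Un_ac)
  finally show "S = ladder (Min S) (stop r S)" .
qed

lemma even_critical:
  "{S \<in> cells - low - mate ` low. card S = 2 * Suc l} =
    (if n = Suc l * Suc r then (\<lambda>s. ladder s l) ` {1..r} else {})"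
proof (cases "n = Suc l * Suc r")
  case True
  have "S \<in> (\<lambda>s. ladder s l) ` {1..r}" if "S \<in> cells - low - mate ` low" "card S = 2 * Suc l" for S
  proof -
    have S: "S \<in> cells" "S \<notin> low" "S \<notin> mate ` low" "even (card S)" using that by auto
    from critical_eq_ladder[OF S] that(2) show ?thesis by (intro image_eqI[of _ _ "Min S"]) auto
  qed
  moreover have "ladder s l \<in> {S \<in> cells - low - mate ` low. card S = 2 * Suc l}" if "s \<in> {1..r}" for s
    using ladder_cells[OF True] critical_ladder[OF True] that by simp
  ultimately show ?thesis unfolding if_P[OF True] by blast
next
  case False
  have False if "S \<in> cells - low - mate ` low" "card S = 2 * Suc l" for S
  proof -
    have S: "S \<in> cells" "S \<notin> low" "S \<notin> mate ` low" "even (card S)" using that by auto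
    from critical_eq_ladder(1,2)[OF S] that(2) False show ?thesis by simp
  qed
  then show ?thesis using False by auto
qed

lemma card_ladders: "card ((\<lambda>s. ladder s l) ` {1..r}) = r"
proof -
  have "inj (\<lambda>s. ladder s l)" by (rule inj_on_inverseI[of _ Min]) (rule Min_ladder)
  then show ?thesis by (simp add: card_image inj_on_subset)
qed

lemma critical_even:
  assumes "Suc r dvd n" "S \<in> cells - low - mate ` low"
  shows "even (card S)"
  using critical_cases[of S] assms by auto

end

section \<open>Persistence modules supported on a single interval\<close>

definition summands :: "(real \<times> ereal) multiset \<Rightarrow> ((real \<times> ereal) \<times> nat) set" where
  "summands D = {(I, j). j < count D I}"

definition interval_sum ::
  "(real \<times> ereal) multiset \<Rightarrow> ('k::field, (real \<times> ereal) \<times> nat \<Rightarrow> 'k) persistence_space" where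
  "interval_sum D = pv_direct_sum (summands D) (\<lambda>(I, j). interval_module I)"

definition alive :: "real \<times> ereal \<Rightarrow> real \<Rightarrow> bool" where
  "alive I \<delta> \<longleftrightarrow> fst I \<le> \<delta> \<and> ereal \<delta> < snd I"

lemma finite_summands: "finite (summands D)"
proof -
  have "summands D \<subseteq> (SIGMA I:set_mset D. {..<count D I})"
    by (auto simp: summands_def simp flip: count_greater_zero_iff)
  then show ?thesis by (rule finite_subset) auto
qed

lemma interval_sum_carrier:
  "x \<in> pv_carrier (interval_sum D) \<delta> \<longleftrightarrow>
     x \<in> extensional (summands D) \<and> (\<forall>i\<in>summands D. alive (fst i) \<delta> \<or> x i = (0 :: 'k::field))"
  by (auto simp: interval_sum_def pv_direct_sum_def interval_module_def PiE_iff alive_def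
      split: prod.splits if_splits)

lemma interval_sum_add:
  "pv_add (interval_sum D) \<delta> x y = (\<lambda>i\<in>summands D. x i + y i :: 'k::field)"
  by (auto simp: interval_sum_def pv_direct_sum_def interval_module_def restrict_def fun_eq_iff)

lemma interval_sum_scale:
  "pv_scale (interval_sum D) \<delta> a x = (\<lambda>i\<in>summands D. a * x i :: 'k::field)"
  by (auto simp: interval_sum_def pv_direct_sum_def interval_module_def restrict_def fun_eq_iff)

lemma interval_sum_map:
  "pv_map (interval_sum D) \<delta> \<delta>' x =
     (\<lambda>i\<in>summands D. if fst (fst i) \<le> \<delta> \<and> ereal \<delta>' < snd (fst i) then x i else (0 :: 'k::field))"
  by (auto simp: interval_sum_def pv_direct_sum_def interval_module_def restrict_def fun_eq_iff)

lemma interval_decomposition_alt: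
  "interval_decomposition V D \<longleftrightarrow>
     (\<forall>(a, b)\<in>#D. ereal a < b) \<and> pv_isomorphic V (interval_sum D)"
  by (simp add: interval_decomposition_def interval_sum_def summands_def)

text \<open>A dimension count. The vector space locales have whole types as carriers, so
  \<open>L\<close> is defined everywhere, and the coordinate subspaces on \<open>I\<close> and
  \<open>J\<close> are expressed by supports.\<close>

lemma card_le_of_linear_injection:
  fixes L :: "('i \<Rightarrow> 'k::field) \<Rightarrow> 'j \<Rightarrow> 'k"
  assumes fin: "finite I" "finite J"
    and add: "\<And>x y. L (x + y) = L x + L y"
    and scale: "\<And>a x. L (\<lambda>i. a * x i) = (\<lambda>j. a * L x j)"
    and range: "\<And>x j. j \<notin> J \<Longrightarrow> L x j = 0"
    and inj: "\<And>x. (\<And>i. i \<notin> I \<Longrightarrow> x i = 0) \<Longrightarrow> L x = 0 \<Longrightarrow> x = 0"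
  shows "card I \<le> card J"
proof -
  interpret V: vector_space "\<lambda>a (x :: 'i \<Rightarrow> 'k) i. a * x i"
    by unfold_locales (auto simp: fun_eq_iff algebra_simps)
  interpret W: vector_space "\<lambda>a (x :: 'j \<Rightarrow> 'k) j. a * x j"
    by unfold_locales (auto simp: fun_eq_iff algebra_simps)
  interpret VW: vector_space_pair "\<lambda>a (x :: 'i \<Rightarrow> 'k) i. a * x i" "\<lambda>a (x :: 'j \<Rightarrow> 'k) j. a * x j" ..
  have lin: "Vector_Spaces.linear (\<lambda>a (x :: 'i \<Rightarrow> 'k) i. a * x i) (\<lambda>a (x :: 'j \<Rightarrow> 'k) j. a * x j) L"
    by (intro Vector_Spaces.linear.intro module_hom.intro module_hom_axioms.intro
        V.vector_space_axioms W.vector_space_axioms V.module_axioms W.module_axioms)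
      (auto simp: add scale)
  define u :: "'i \<Rightarrow> 'i \<Rightarrow> 'k" where "u i = (\<lambda>i'. if i' = i then 1 else 0)" for i
  define w :: "'j \<Rightarrow> 'j \<Rightarrow> 'k" where "w i = (\<lambda>i'. if i' = i then 1 else 0)" for i
  have vanish: "x i = 0" if "x \<in> V.span (u ` I')" "i \<notin> I'" for x i I'
  proof -
    have "V.span (u ` I') \<subseteq> {x. x i = 0}"
      by (rule V.span_minimal) (use that(2) in \<open>auto simp: u_def V.subspace_def\<close>)
    then show ?thesis using that(1) by blast
  qed
  have inj_u: "inj_on u I" by (rule inj_onI) (metis u_def zero_neq_one)
  have "V.independent (u ` I)"
    using fin(1)
  proof (induction I)
    case (insert i I)
    have "u i \<notin> V.span (u ` I)" using vanish[of "u i" I i] insert.hyps by (auto simp: u_def)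
    then show ?case using insert by (simp add: V.independent_insert)
  qed (simp add: V.independent_empty)
  moreover have inj_L: "inj_on L (V.span (u ` I))"
    unfolding VW.linear_inj_on_iff_eq_0[OF lin V.subspace_span] using inj vanish by blast
  ultimately have "W.independent (L ` u ` I)"
    by (rule VW.linear_independent_injective_image[OF lin])
  moreover have "L ` u ` I \<subseteq> W.span (w ` J)"
  proof
    fix y assume "y \<in> L ` u ` I"
    then have y: "y j = 0" if "j \<notin> J" for j using range that by auto
    have ev: "(\<Sum>j\<in>A. h j) i = (\<Sum>j\<in>A. h j i)" if "finite A" for A i and h :: "'j \<Rightarrow> 'j \<Rightarrow> 'k"
      using that by (induction A) auto
    have "y = (\<Sum>j\<in>J. (\<lambda>i. y j * w j i))"
      using fin(2) y by (auto simp: fun_eq_iff ev w_def if_distrib[of "times _"] cong: if_cong)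
    also have "\<dots> \<in> W.span (w ` J)"
      by (intro W.span_sum W.span_scale W.span_base imageI)
    finally show "y \<in> W.span (w ` J)" .
  qed
  ultimately have "card (L ` u ` I) \<le> card (w ` J)"
    using W.independent_span_bound fin(2) by blast
  also have "\<dots> \<le> card J" using fin(2) by (rule card_image_le)
  also have "card (L ` u ` I) = card I"
    using inj_L inj_u by (metis V.span_superset card_image inj_on_subset)
  finally show ?thesis .
qed

text \<open>Elements of a direct sum are \<open>undefined\<close> outside the index set, so they are
  translated from and to functions that are 0 there.\<close>

lemma card_summands_le:
  fixes \<Theta> :: "((real \<times> ereal) \<times> nat \<Rightarrow> 'k::field) \<Rightarrow> (real \<times> ereal) \<times> nat \<Rightarrow> 'k"
  assumes inj: "inj_on \<Theta> (pv_carrier (interval_sum D) \<delta>)"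
    and alive: "\<And>i. i \<in> summands D \<Longrightarrow> alive (fst i) \<delta>"
    and add: "\<And>x y. \<lbrakk>x \<in> pv_carrier (interval_sum D) \<delta>; y \<in> pv_carrier (interval_sum D) \<delta>\<rbrakk> \<Longrightarrow>
      \<Theta> (pv_add (interval_sum D) \<delta> x y) = pv_add (interval_sum D') \<delta> (\<Theta> x) (\<Theta> y)"
    and scale: "\<And>a x. x \<in> pv_carrier (interval_sum D) \<delta> \<Longrightarrow>
      \<Theta> (pv_scale (interval_sum D) \<delta> a x) = pv_scale (interval_sum D') \<delta> a (\<Theta> x)"
  shows "card (summands D) \<le> card (summands D')"
proof (rule card_le_of_linear_injection[OF finite_summands finite_summands])
  let ?S = "summands D" and ?S' = "summands D'"
  define L where "L x = (\<lambda>j. if j \<in> ?S' then \<Theta> (restrict x ?S) j else 0)" for x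
  have car: "restrict x ?S \<in> pv_carrier (interval_sum D) \<delta>" for x :: "(real \<times> ereal) \<times> nat \<Rightarrow> 'k"
    using alive by (auto simp: interval_sum_carrier)
  have radd: "restrict (x + y) ?S = pv_add (interval_sum D) \<delta> (restrict x ?S) (restrict y ?S)"
    for x y :: "(real \<times> ereal) \<times> nat \<Rightarrow> 'k"
    by (auto simp: interval_sum_add restrict_def fun_eq_iff)
  have rscale: "restrict (\<lambda>i. a * x i) ?S = pv_scale (interval_sum D) \<delta> a (restrict x ?S)"
    for x :: "(real \<times> ereal) \<times> nat \<Rightarrow> 'k" and a
    by (auto simp: interval_sum_scale restrict_def fun_eq_iff)
  show "L (x + y) = L x + L y" for x y
    unfolding L_def radd add[OF car car] by (auto simp: interval_sum_add fun_eq_iff)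
  show scaleL: "L (\<lambda>i. a * x i) = (\<lambda>j. a * L x j)" for a x
    unfolding L_def rscale scale[OF car] by (auto simp: interval_sum_scale fun_eq_iff)
  show "L x j = 0" if "j \<notin> ?S'" for x j using that by (simp add: L_def)
  show "x = 0" if supp: "\<And>i. i \<notin> ?S \<Longrightarrow> x i = 0" and zero: "L x = 0" for x
  proof -
    have r0: "pv_scale (interval_sum D) \<delta> 0 y = restrict 0 ?S" for y :: "(real \<times> ereal) \<times> nat \<Rightarrow> 'k"
      by (auto simp: interval_sum_scale restrict_def fun_eq_iff)
    \<comment> \<open>The zero vector is the multiple by 0 of any vector, so compatibility with
      scaling suffices.\<close>
    have zero': "\<Theta> (restrict 0 ?S) = restrict 0 ?S'"
      using scale[OF car[of 0], of 0] unfolding r0 by (auto simp: interval_sum_scale restrict_def fun_eq_iff)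
    have "\<Theta> (restrict x ?S) = pv_add (interval_sum D') \<delta> (\<Theta> (restrict x ?S)) (\<Theta> (restrict 0 ?S))"
      using add[OF car[of x] car[of 0]] radd[of x 0] by simp
    \<comment> \<open>Adding zero exhibits the value as a result of \<open>pv_add\<close>, which is
      restricted to the index set.\<close>
    then have ext: "\<Theta> (restrict x ?S) \<in> extensional ?S'"
      unfolding interval_sum_add by (metis restrict_extensional)
    have "\<Theta> (restrict x ?S) = restrict 0 ?S'"
    proof
      fix j
      have "L x j = 0" using zero by simp
      then show "\<Theta> (restrict x ?S) j = restrict 0 ?S' j"
        using extensional_arb[OF ext, of j] by (cases "j \<in> ?S'") (simp_all add: L_def)
    qed
    then have "\<Theta> (restrict x ?S) = \<Theta> (restrict 0 ?S)" using zero' by simp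
    then have eq: "restrict x ?S = restrict 0 ?S"
      by (rule inj_onD[OF inj _ car car])
    show ?thesis
    proof
      fix i
      show "x i = 0 i" using fun_cong[OF eq, of i] supp[of i] by (cases "i \<in> ?S") simp_all
    qed
  qed
qed

text \<open>The record does not force its operations to stay in the carriers, which inverting an
  isomorphism requires.\<close>

definition pv_closed :: "('k, 'v) persistence_space \<Rightarrow> bool" where
  "pv_closed V \<longleftrightarrow>
     (\<forall>\<delta>. \<forall>x\<in>pv_carrier V \<delta>. \<forall>y\<in>pv_carrier V \<delta>. pv_add V \<delta> x y \<in> pv_carrier V \<delta>) \<and>
     (\<forall>\<delta> a. \<forall>x\<in>pv_carrier V \<delta>. pv_scale V \<delta> a x \<in> pv_carrier V \<delta>) \<and>
     (\<forall>\<delta> \<delta>'. \<delta> \<le> \<delta>' \<longrightarrow> (\<forall>x\<in>pv_carrier V \<delta>. pv_map V \<delta> \<delta>' x \<in> pv_carrier V \<delta>'))"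

text \<open>Inverts the first isomorphism and composes with the second. In the application
  \<open>V\<close> is the homology module, and \<open>W\<close> and \<open>U\<close> are two
  decompositions of it.\<close>

lemma pv_isomorphic_span:
  assumes closed: "pv_closed V" and VW: "pv_isomorphic V W" and VU: "pv_isomorphic V U"
  shows "pv_isomorphic W U"
proof -
  obtain \<Phi> where \<Phi>: "\<And>\<delta>. bij_betw (\<Phi> \<delta>) (pv_carrier V \<delta>) (pv_carrier W \<delta>)"
    "\<And>\<delta> x y. x \<in> pv_carrier V \<delta> \<Longrightarrow> y \<in> pv_carrier V \<delta> \<Longrightarrow> \<Phi> \<delta> (pv_add V \<delta> x y) = pv_add W \<delta> (\<Phi> \<delta> x) (\<Phi> \<delta> y)"
    "\<And>\<delta> a x. x \<in> pv_carrier V \<delta> \<Longrightarrow> \<Phi> \<delta> (pv_scale V \<delta> a x) = pv_scale W \<delta> a (\<Phi> \<delta> x)"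
    "\<And>\<delta> \<delta>' x. \<delta> \<le> \<delta>' \<Longrightarrow> x \<in> pv_carrier V \<delta> \<Longrightarrow> \<Phi> \<delta>' (pv_map V \<delta> \<delta>' x) = pv_map W \<delta> \<delta>' (\<Phi> \<delta> x)"
    using VW unfolding pv_isomorphic_def by metis
  obtain \<Psi> where \<Psi>: "\<And>\<delta>. bij_betw (\<Psi> \<delta>) (pv_carrier V \<delta>) (pv_carrier U \<delta>)"
    "\<And>\<delta> x y. x \<in> pv_carrier V \<delta> \<Longrightarrow> y \<in> pv_carrier V \<delta> \<Longrightarrow> \<Psi> \<delta> (pv_add V \<delta> x y) = pv_add U \<delta> (\<Psi> \<delta> x) (\<Psi> \<delta> y)"
    "\<And>\<delta> a x. x \<in> pv_carrier V \<delta> \<Longrightarrow> \<Psi> \<delta> (pv_scale V \<delta> a x) = pv_scale U \<delta> a (\<Psi> \<delta> x)"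
    "\<And>\<delta> \<delta>' x. \<delta> \<le> \<delta>' \<Longrightarrow> x \<in> pv_carrier V \<delta> \<Longrightarrow> \<Psi> \<delta>' (pv_map V \<delta> \<delta>' x) = pv_map U \<delta> \<delta>' (\<Psi> \<delta> x)"
    using VU unfolding pv_isomorphic_def by metis
  define inv where "inv \<delta> = inv_into (pv_carrier V \<delta>) (\<Phi> \<delta>)" for \<delta>
  have inv: "inv \<delta> w \<in> pv_carrier V \<delta>" "\<Phi> \<delta> (inv \<delta> w) = w" if "w \<in> pv_carrier W \<delta>" for \<delta> w
    using that bij_betw_imp_surj_on[OF \<Phi>(1)] by (auto simp: inv_def inv_into_into f_inv_into_f)
  have inv': "inv \<delta> (\<Phi> \<delta> x) = x" if "x \<in> pv_carrier V \<delta>" for \<delta> x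
    using that bij_betw_imp_inj_on[OF \<Phi>(1)] by (simp add: inv_def)
  have inv_add: "inv \<delta> (pv_add W \<delta> x y) = pv_add V \<delta> (inv \<delta> x) (inv \<delta> y)"
    if "x \<in> pv_carrier W \<delta>" "y \<in> pv_carrier W \<delta>" for \<delta> x y
  proof -
    have "inv \<delta> (\<Phi> \<delta> (pv_add V \<delta> (inv \<delta> x) (inv \<delta> y))) = pv_add V \<delta> (inv \<delta> x) (inv \<delta> y)"
      using closed that inv unfolding pv_closed_def by (intro inv') blast
    then show ?thesis using \<Phi>(2) inv that by simp
  qed
  have inv_scale: "inv \<delta> (pv_scale W \<delta> a x) = pv_scale V \<delta> a (inv \<delta> x)"
    if "x \<in> pv_carrier W \<delta>" for \<delta> a x
  proof -
    have "inv \<delta> (\<Phi> \<delta> (pv_scale V \<delta> a (inv \<delta> x))) = pv_scale V \<delta> a (inv \<delta> x)"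
      using closed that inv unfolding pv_closed_def by (intro inv') blast
    then show ?thesis using \<Phi>(3) inv that by simp
  qed
  have inv_map: "inv \<delta>' (pv_map W \<delta> \<delta>' x) = pv_map V \<delta> \<delta>' (inv \<delta> x)"
    if "\<delta> \<le> \<delta>'" "x \<in> pv_carrier W \<delta>" for \<delta> \<delta>' x
  proof -
    have "inv \<delta>' (\<Phi> \<delta>' (pv_map V \<delta> \<delta>' (inv \<delta> x))) = pv_map V \<delta> \<delta>' (inv \<delta> x)"
      using closed that inv unfolding pv_closed_def by (intro inv') blast
    then show ?thesis using \<Phi>(4) inv that by simp
  qed
  show ?thesis
    unfolding pv_isomorphic_def
  proof (intro exI[of _ "\<lambda>\<delta>. \<Psi> \<delta> \<circ> inv \<delta>"] conjI allI ballI impI)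
    show "bij_betw (\<Psi> \<delta> \<circ> inv \<delta>) (pv_carrier W \<delta>) (pv_carrier U \<delta>)" for \<delta>
      unfolding inv_def by (rule bij_betw_trans[OF bij_betw_inv_into[OF \<Phi>(1)] \<Psi>(1)])
  qed (simp_all add: inv_add inv_scale inv_map inv \<Psi>)
qed

lemma card_summands_isomorphic:
  fixes D D' :: "(real \<times> ereal) multiset"
  assumes iso: "pv_isomorphic (interval_sum D :: ('k::field, _) persistence_space) (interval_sum D')"
    and alive: "\<And>i. i \<in> summands D \<Longrightarrow> alive (fst i) \<delta>"
  shows "card (summands D) \<le> card (summands D')"
proof -
  obtain \<Theta> :: "real \<Rightarrow> ((real \<times> ereal) \<times> nat \<Rightarrow> 'k) \<Rightarrow> (real \<times> ereal) \<times> nat \<Rightarrow> 'k"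
    where \<Theta>: "\<And>\<delta>. bij_betw (\<Theta> \<delta>) (pv_carrier (interval_sum D) \<delta>) (pv_carrier (interval_sum D') \<delta>)"
    "\<And>\<delta> x y. x \<in> pv_carrier (interval_sum D) \<delta> \<Longrightarrow> y \<in> pv_carrier (interval_sum D) \<delta> \<Longrightarrow>
      \<Theta> \<delta> (pv_add (interval_sum D) \<delta> x y) = pv_add (interval_sum D') \<delta> (\<Theta> \<delta> x) (\<Theta> \<delta> y)"
    "\<And>\<delta> a x. x \<in> pv_carrier (interval_sum D) \<delta> \<Longrightarrow>
      \<Theta> \<delta> (pv_scale (interval_sum D) \<delta> a x) = pv_scale (interval_sum D') \<delta> a (\<Theta> \<delta> x)"
    using iso unfolding pv_isomorphic_def by metis
  show ?thesis
    by (rule card_summands_le[OF bij_betw_imp_inj_on[OF \<Theta>(1)] alive \<Theta>(2,3)])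
qed

text \<open>Vectors concentrated on one interval of \<open>D\<close> detect its endpoints: wherever
  they are alive, \<open>interval_sum D0\<close> is nonzero; and its maps within
  \<open>[a, b)\<close> are identities, so nothing is born after \<open>a\<close> and nothing dies
  before \<open>b\<close>. The multiplicity is the dimension at \<open>a\<close>.\<close>

lemma interval_sum_unique:
  fixes D :: "(real \<times> ereal) multiset" and a b :: real
  assumes D0: "D0 = replicate_mset m (a, ereal b)" and ab: "a < b"
    and proper: "\<And>a' b'. (a', b') \<in># D \<Longrightarrow> ereal a' < b'"
    and iso: "pv_isomorphic (interval_sum D0 :: ('k::field, _) persistence_space) (interval_sum D)"
    and iso': "pv_isomorphic (interval_sum D :: ('k, _) persistence_space) (interval_sum D0)"
  shows "D = D0"
proof -
  obtain \<Theta> :: "real \<Rightarrow> ((real \<times> ereal) \<times> nat \<Rightarrow> 'k) \<Rightarrow> (real \<times> ereal) \<times> nat \<Rightarrow> 'k"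
    where bij: "\<And>\<delta>. bij_betw (\<Theta> \<delta>) (pv_carrier (interval_sum D0) \<delta>) (pv_carrier (interval_sum D) \<delta>)"
    and map: "\<And>\<delta> \<delta>' x. \<delta> \<le> \<delta>' \<Longrightarrow> x \<in> pv_carrier (interval_sum D0) \<delta> \<Longrightarrow>
      \<Theta> \<delta>' (pv_map (interval_sum D0) \<delta> \<delta>' x) = pv_map (interval_sum D) \<delta> \<delta>' (\<Theta> \<delta> x)"
    using iso unfolding pv_isomorphic_def by metis
  have D0_fst: "fst i = (a, ereal b)" if "i \<in> summands D0" for i
    using that by (cases i) (auto simp: D0 summands_def split: if_splits)
  have car0: "x \<in> pv_carrier (interval_sum D0) \<delta> \<longleftrightarrow> x \<in> extensional (summands D0)"
    if "a \<le> \<delta>" "\<delta> < b" for \<delta> and x :: "(real \<times> ereal) \<times> nat \<Rightarrow> 'k"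
    using that D0_fst by (auto simp: interval_sum_carrier alive_def)
  have map0: "pv_map (interval_sum D0) \<delta> \<delta>' x = x"
    if "a \<le> \<delta>" "\<delta>' < b" "x \<in> extensional (summands D0)" for \<delta> \<delta>' and x :: "(real \<times> ereal) \<times> nat \<Rightarrow> 'k"
  proof
    fix i
    show "pv_map (interval_sum D0) \<delta> \<delta>' x i = x i"
      using D0_fst[of i] that(1,2) extensional_arb[OF that(3), of i]
      by (cases "i \<in> summands D0") (simp_all add: interval_sum_map)
  qed
  have eq: "(a', b') = (a, ereal b)" if I: "(a', b') \<in># D" for a' b'
  proof -
    define i0 where "i0 = ((a', b'), 0 :: nat)"
    have i0: "i0 \<in> summands D" using I by (auto simp: i0_def summands_def)
    define g :: "'k \<Rightarrow> (real \<times> ereal) \<times> nat \<Rightarrow> 'k"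
      where "g y = (\<lambda>i\<in>summands D. if i = i0 then y else 0)" for y
    have g_car: "g y \<in> pv_carrier (interval_sum D) \<delta>" if "a' \<le> \<delta>" "ereal \<delta> < b'" for y \<delta>
      using that by (auto simp: interval_sum_carrier g_def i0_def alive_def)
    have "g 0 i0 \<noteq> g 1 i0" using i0 by (simp add: g_def)
    then have g_inj: "g 0 \<noteq> g 1" by metis
    have pre: "\<exists>x\<in>pv_carrier (interval_sum D0) \<delta>. \<Theta> \<delta> x = g y" if "a' \<le> \<delta>" "ereal \<delta> < b'" for y \<delta>
    proof -
      have "g y \<in> \<Theta> \<delta> ` pv_carrier (interval_sum D0) \<delta>"
        unfolding bij_betw_imp_surj_on[OF bij] by (rule g_car[OF that])
      then show ?thesis unfolding image_iff by metis
    qed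
    have inside: "a \<le> \<delta> \<and> \<delta> < b" if \<delta>: "a' \<le> \<delta>" "ereal \<delta> < b'" for \<delta>
    proof (rule ccontr)
      assume out: "\<not> ?thesis"
      have zero: "x = (\<lambda>i\<in>summands D0. 0)" if "x \<in> pv_carrier (interval_sum D0) \<delta>"
        for x :: "(real \<times> ereal) \<times> nat \<Rightarrow> 'k"
      proof
        fix i
        show "x i = (\<lambda>i\<in>summands D0. 0) i"
        proof (cases "i \<in> summands D0")
          case True
          moreover have "\<not> alive (fst i) \<delta>" using D0_fst[OF True] out by (simp add: alive_def)
          ultimately have "x i = 0" using that unfolding interval_sum_carrier by blast
          then show ?thesis using True by simp
        next
          case False
          moreover have "x \<in> extensional (summands D0)" using that by (simp only: interval_sum_carrier)
          ultimately show ?thesis by (simp add: extensional_arb[of x])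
        qed
      qed
      from pre[OF \<delta>, of 0] obtain x0
        where x0: "x0 \<in> pv_carrier (interval_sum D0) \<delta>" "\<Theta> \<delta> x0 = g 0" ..
      from pre[OF \<delta>, of 1] obtain x1
        where x1: "x1 \<in> pv_carrier (interval_sum D0) \<delta>" "\<Theta> \<delta> x1 = g 1" ..
      from x0 x1 show False using zero[of x0] zero[of x1] g_inj by simp
    qed
    have a'b': "ereal a' < b'" by (rule proper[OF I])
    have start: "a \<le> a'" "a' < b" using inside[of a'] proper[OF I] by auto
    have "b' \<le> ereal b"
    proof (rule ccontr)
      assume "\<not> b' \<le> ereal b"
      then show False using inside[of b] start by (auto simp: not_le)
    qed
    then obtain \<beta> where \<beta>: "b' = ereal \<beta>" "a' < \<beta>" "\<beta> \<le> b"
      using proper[OF I] by (cases b') auto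
    have "a' = a"
    proof (rule ccontr)
      assume "a' \<noteq> a"
      then have less: "a < a'" using start by simp
      from pre[OF order_refl a'b', of 1] obtain x
        where x: "x \<in> pv_carrier (interval_sum D0) a'" "\<Theta> a' x = g 1" ..
      then have ext: "x \<in> extensional (summands D0)" using car0 start by simp
      then have "x \<in> pv_carrier (interval_sum D0) a" using car0 ab by simp
      \<comment> \<open>\<open>g 1\<close> comes from parameter \<open>a\<close>, where the interval
        of \<open>i0\<close> has not begun, so its component at \<open>i0\<close> would be
        0.\<close>
      then have "g 1 = pv_map (interval_sum D) a a' (\<Theta> a x)"
        using map[of a a' x] map0[of a a' x] ext start less x(2) by simp
      then have "g 1 i0 = 0" using i0 less by (simp add: interval_sum_map i0_def)
      then show False using i0 by (simp add: g_def)
    qed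
    moreover have "\<beta> = b"
    proof (rule ccontr)
      assume "\<beta> \<noteq> b"
      then have less: "\<beta> < b" using \<beta> by simp
      from pre[OF order_refl a'b', of 0] obtain x0
        where x0: "x0 \<in> pv_carrier (interval_sum D0) a'" "\<Theta> a' x0 = g 0" ..
      from pre[OF order_refl a'b', of 1] obtain x1
        where x1: "x1 \<in> pv_carrier (interval_sum D0) a'" "\<Theta> a' x1 = g 1" ..
      note x = x0 x1
      then have ext: "x0 \<in> extensional (summands D0)" "x1 \<in> extensional (summands D0)"
        using car0 start by simp_all
      \<comment> \<open>At \<open>\<beta>\<close> the interval has ended and both vectors have the
        same image, whereas the corresponding map of \<open>interval_sum D0\<close> is
        injective.\<close>
      have "pv_map (interval_sum D) a' \<beta> (g 0) = pv_map (interval_sum D) a' \<beta> (g 1)"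
        by (auto simp: interval_sum_map g_def i0_def \<beta>(1) fun_eq_iff restrict_def)
      then have "\<Theta> \<beta> x0 = \<Theta> \<beta> x1"
        using map[OF less_imp_le[OF \<beta>(2)] x(1)] map[OF less_imp_le[OF \<beta>(2)] x(3)] x(2,4)
        by (simp only: map0[OF start(1) less ext(1)] map0[OF start(1) less ext(2)])
      moreover have "x0 \<in> pv_carrier (interval_sum D0) \<beta>" "x1 \<in> pv_carrier (interval_sum D0) \<beta>"
        using car0 ext start less \<beta>(2) by simp_all
      ultimately have "x0 = x1" using bij_betw_imp_inj_on[OF bij] by (metis inj_onD)
      then show False using x g_inj by simp
    qed
    ultimately show ?thesis using \<beta> by simp
  qed
  have "set_mset D \<subseteq> {(a, ereal b)}"
  proof
    fix I assume "I \<in># D"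
    then have "I = (a, ereal b)" using eq[of "fst I" "snd I"] by simp
    then show "I \<in> {(a, ereal b)}" by simp
  qed
  then have "D = replicate_mset (size D) (a, ereal b)" by (rule set_mset_subset_singletonD)
  then obtain c where D: "D = replicate_mset c (a, ereal b)" by (rule that)
  have summands: "summands (replicate_mset c (a, ereal b)) = {(a, ereal b)} \<times> {..<c}" for c
    by (auto simp: summands_def split: if_splits)
  have alive: "alive (fst i) a" if "i \<in> summands (replicate_mset c (a, ereal b))" for i c
    using that ab by (auto simp: summands alive_def)
  have "card (summands D0) = card (summands D)"
  proof (rule antisym)
    show "card (summands D0) \<le> card (summands D)"
      by (rule card_summands_isomorphic[OF iso, of a], rule alive, simp only: D0)
    show "card (summands D) \<le> card (summands D0)"
      by (rule card_summands_isomorphic[OF iso', of a], rule alive, simp only: D)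
  qed
  then show ?thesis by (simp add: D D0 summands)
qed

section \<open>Persistent homology concentrated on a single interval\<close>

lemma boundary_add:
  fixes c e :: "'a::linorder set \<Rightarrow> 'k::field"
  assumes "c \<in> chains C p" "e \<in> chains C p"
  shows "boundary (c + e) = boundary c + boundary e"
proof
  fix \<tau>
  define S where "S = {\<sigma>. c \<sigma> \<noteq> 0} \<union> {\<sigma>. e \<sigma> \<noteq> 0}"
  have fin: "finite S" using assms by (simp add: S_def chains_def)
  have inc: "boundary x \<tau> = (\<Sum>\<sigma>\<in>S. x \<sigma> * incidence \<sigma> \<tau>)" if "\<And>\<sigma>. \<sigma> \<notin> S \<Longrightarrow> x \<sigma> = 0"
    for x :: "'a set \<Rightarrow> 'k"
    by (rule boundary_incidence[OF fin]) (use that in blast)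
  show "boundary (c + e) \<tau> = (boundary c + boundary e) \<tau>"
    using inc[of "c + e"] inc[of c] inc[of e] by (simp add: S_def sum.distrib algebra_simps)
qed

lemma boundary_scale:
  fixes c :: "'a::linorder set \<Rightarrow> 'k::field"
  assumes "c \<in> chains C p"
  shows "boundary (\<lambda>\<sigma>. a * c \<sigma>) = (\<lambda>\<tau>. a * boundary c \<tau>)"
proof
  fix \<tau>
  define S where "S = {\<sigma>. c \<sigma> \<noteq> 0}"
  have fin: "finite S" using assms by (simp add: S_def chains_def)
  have inc: "boundary x \<tau> = (\<Sum>\<sigma>\<in>S. x \<sigma> * incidence \<sigma> \<tau>)" if "\<And>\<sigma>. \<sigma> \<notin> S \<Longrightarrow> x \<sigma> = 0"
    for x :: "'a set \<Rightarrow> 'k"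
    by (rule boundary_incidence[OF fin]) (use that in blast)
  show "boundary (\<lambda>\<sigma>. a * c \<sigma>) \<tau> = a * boundary c \<tau>"
    using inc[of "\<lambda>\<sigma>. a * c \<sigma>"] inc[of c] by (simp add: S_def sum_distrib_left algebra_simps)
qed

lemma chains_add_closed:
  assumes "c \<in> chains C p" "e \<in> chains C p"
  shows "c + e \<in> chains C p"
proof -
  have "{\<sigma>. (c + e) \<sigma> \<noteq> 0} \<subseteq> {\<sigma>. c \<sigma> \<noteq> 0} \<union> {\<sigma>. e \<sigma> \<noteq> 0}" by auto
  then show ?thesis using assms unfolding chains_def by (blast intro: finite_subset)
qed

lemma chains_scale_closed:
  assumes "c \<in> chains C p"
  shows "(\<lambda>\<sigma>. a * c \<sigma>) \<in> chains C p"
proof -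
  have "{\<sigma>. a * c \<sigma> \<noteq> 0} \<subseteq> {\<sigma>. c \<sigma> \<noteq> 0}" by auto
  then show ?thesis using assms unfolding chains_def by (blast intro: finite_subset)
qed

lemma zero_chain: "0 \<in> chains C p"
  by (simp add: chains_def)

lemma boundary_zero: "boundary 0 = 0"
  by (simp add: boundary_def fun_eq_iff)

lemma boundaries_zero: "0 \<in> boundaries C p"
  unfolding boundaries_def by (rule image_eqI[of _ _ 0]) (simp_all add: boundary_zero zero_chain)

lemma boundaries_add: "b \<in> boundaries C p \<Longrightarrow> c \<in> boundaries C p \<Longrightarrow> b + c \<in> boundaries C p"
  unfolding boundaries_def by (auto simp: boundary_add[symmetric] intro!: imageI chains_add_closed)

lemma boundaries_scale: "b \<in> boundaries C p \<Longrightarrow> (\<lambda>\<sigma>. a * b \<sigma>) \<in> boundaries C p"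
  unfolding boundaries_def by (auto simp: boundary_scale[symmetric] intro!: imageI chains_scale_closed)

lemma boundaries_mono: "C \<subseteq> C' \<Longrightarrow> boundaries C p \<subseteq> boundaries C' p"
  unfolding boundaries_def chains_def by blast

lemma cycles_add: "z \<in> cycles C p \<Longrightarrow> w \<in> cycles C p \<Longrightarrow> z + w \<in> cycles C p"
  by (auto simp: cycles_def boundary_add chains_add_closed)

lemma cycles_scale: "z \<in> cycles C p \<Longrightarrow> (\<lambda>\<sigma>. a * z \<sigma>) \<in> cycles C p"
  by (auto simp: cycles_def boundary_scale chains_scale_closed fun_eq_iff)

lemma cycles_mono: "C \<subseteq> C' \<Longrightarrow> cycles C p \<subseteq> cycles C' p"
  unfolding cycles_def chains_def by blast

lemma mem_coset: "w \<in> z +o B \<longleftrightarrow> (\<exists>b\<in>B. w = z + b)"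
  by (simp add: elt_set_plus_def)

lemma coset_absorb:
  assumes "C \<subseteq> C'"
  shows "(z +o boundaries C p) + boundaries C' p = z +o boundaries C' p"
proof (intro equalityI subsetI)
  fix w assume "w \<in> (z +o boundaries C p) + boundaries C' p"
  then obtain b b' where "b \<in> boundaries C p" "b' \<in> boundaries C' p" "w = z + b + b'"
    by (auto simp: set_plus_def mem_coset)
  moreover from this have "b + b' \<in> boundaries C' p"
    using boundaries_mono[OF assms] by (intro boundaries_add) blast+
  ultimately show "w \<in> z +o boundaries C' p" by (auto simp: mem_coset add.assoc)
next
  fix w assume "w \<in> z +o boundaries C' p"
  then obtain b where b: "b \<in> boundaries C' p" "w = z + b" by (auto simp: mem_coset)
  have "z + 0 \<in> z +o boundaries C p" by (metis boundaries_zero mem_coset)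
  then show "w \<in> (z +o boundaries C p) + boundaries C' p" using b set_plus_intro by fastforce
qed

lemma coset_add:
  fixes z w :: "'a::linorder set \<Rightarrow> 'k::field"
  shows "(z +o boundaries C p) + (w +o boundaries C p) = (z + w) +o boundaries C p"
proof -
  have "boundaries C p + boundaries C p = (boundaries C p :: ('a set \<Rightarrow> 'k) set)"
    using coset_absorb[of C C "0 :: 'a set \<Rightarrow> 'k" p] by simp
  then show ?thesis by (simp only: set_plus_rearrange)
qed

lemma coset_shift:
  fixes z e :: "'a::linorder set \<Rightarrow> 'k::field"
  assumes "e \<in> boundaries C p"
  shows "(z + e) +o boundaries C p = z +o boundaries C p"
proof (intro equalityI subsetI)
  fix w assume "w \<in> (z + e) +o boundaries C p"
  then obtain b where "b \<in> boundaries C p" "w = z + (e + b)" by (auto simp: mem_coset add.assoc)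
  then show "w \<in> z +o boundaries C p" using boundaries_add[OF assms] by (auto simp: mem_coset)
next
  fix w assume "w \<in> z +o boundaries C p"
  then obtain b where b: "b \<in> boundaries C p" "w = z + b" by (auto simp: mem_coset)
  have "(\<lambda>\<sigma>. (- 1) * e \<sigma>) + b \<in> boundaries C p"
    by (intro boundaries_add boundaries_scale assms b)
  moreover have "w = z + e + ((\<lambda>\<sigma>. (- 1) * e \<sigma>) + b)" by (auto simp: b fun_eq_iff)
  ultimately show "w \<in> (z + e) +o boundaries C p" unfolding mem_coset by blast
qed

lemma coset_scale:
  "(\<lambda>z \<sigma>. a * z \<sigma>) ` (z +o boundaries C p) + boundaries C p = (\<lambda>\<sigma>. a * z \<sigma>) +o boundaries C p"
proof (intro equalityI subsetI)
  fix w assume "w \<in> (\<lambda>z \<sigma>. a * z \<sigma>) ` (z +o boundaries C p) + boundaries C p"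
  then obtain b b' where b: "b \<in> boundaries C p" "b' \<in> boundaries C p" "w = (\<lambda>\<sigma>. a * (z + b) \<sigma>) + b'"
    by (auto simp: set_plus_def mem_coset)
  then have "w = (\<lambda>\<sigma>. a * z \<sigma>) + ((\<lambda>\<sigma>. a * b \<sigma>) + b')"
    by (auto simp: fun_eq_iff algebra_simps)
  moreover have "(\<lambda>\<sigma>. a * b \<sigma>) + b' \<in> boundaries C p"
    using b by (intro boundaries_add boundaries_scale)
  ultimately show "w \<in> (\<lambda>\<sigma>. a * z \<sigma>) +o boundaries C p" by (auto simp: mem_coset)
next
  fix w assume "w \<in> (\<lambda>\<sigma>. a * z \<sigma>) +o boundaries C p"
  then obtain b where b: "b \<in> boundaries C p" "w = (\<lambda>\<sigma>. a * z \<sigma>) + b" by (auto simp: mem_coset)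
  have "z \<in> z +o boundaries C p" unfolding mem_coset
    by (rule bexI[OF _ boundaries_zero]) simp
  then have "(\<lambda>\<sigma>. a * z \<sigma>) \<in> (\<lambda>z \<sigma>. a * z \<sigma>) ` (z +o boundaries C p)" by (rule imageI)
  then show "w \<in> (\<lambda>z \<sigma>. a * z \<sigma>) ` (z +o boundaries C p) + boundaries C p"
    using b set_plus_intro by blast
qed

text \<open>Coordinates on the constant stretch turn each class into its coefficients; elsewhere all
  classes are 0. Zero copies are allowed, so trivial diagrams are the case of empty
  \<open>I\<close>.\<close>

theorem persistence_diagram_single_interval:
  fixes F :: "real \<Rightarrow> 'a::linorder set set" and f :: "('a set \<Rightarrow> 'k::field) \<Rightarrow> 'i \<Rightarrow> 'k"
  assumes mono: "\<And>\<delta> \<delta>'. \<delta> \<le> \<delta>' \<Longrightarrow> F \<delta> \<subseteq> F \<delta>'" and ab: "a < b"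
    and inside: "\<And>\<delta>. a \<le> \<delta> \<Longrightarrow> \<delta> < b \<Longrightarrow> F \<delta> = C"
    and outside: "\<And>\<delta>. \<not> (a \<le> \<delta> \<and> \<delta> < b) \<Longrightarrow> cycles (F \<delta>) p = (boundaries (F \<delta>) p :: ('a set \<Rightarrow> 'k) set)"
    and sub: "boundaries C p \<subseteq> (cycles C p :: ('a set \<Rightarrow> 'k) set)"
    and f: "coordinates (cycles C p) (boundaries C p) I f" and I: "finite I"
  shows "persistence_diagram (persistent_homology F p :: ('k, ('a set \<Rightarrow> 'k) set) persistence_space) =
    replicate_mset (card I) (a, ereal b)"
proof -
  let ?D = "replicate_mset (card I) (a, ereal b)"
  let ?V = "persistent_homology F p :: ('k, ('a set \<Rightarrow> 'k) set) persistence_space"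
  let ?B = "\<lambda>\<delta>. boundaries (F \<delta>) p :: ('a set \<Rightarrow> 'k) set"
  let ?Z = "\<lambda>\<delta>. cycles (F \<delta>) p :: ('a set \<Rightarrow> 'k) set"
  define alv where "alv \<delta> \<longleftrightarrow> a \<le> \<delta> \<and> \<delta> < b" for \<delta>
  have f_add: "f (z + w) = f z + f w" if "z \<in> cycles C p" "w \<in> cycles C p" for z w
    using f that unfolding coordinates_def by blast
  have f_scale: "f (\<lambda>\<sigma>. x * z \<sigma>) = (\<lambda>i. x * f z i)" if "z \<in> cycles C p" for x z
    using f that unfolding coordinates_def by blast
  have f_image: "f ` cycles C p = {g. \<forall>i. g i \<noteq> 0 \<longrightarrow> i \<in> I}"
    using f unfolding coordinates_def by blast
  have f_ker: "f z = 0 \<longleftrightarrow> z \<in> boundaries C p" if "z \<in> cycles C p" for z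
    using f that unfolding coordinates_def by blast
  have carrier: "pv_carrier ?V \<delta> = (\<lambda>z. z +o ?B \<delta>) ` ?Z \<delta>" for \<delta>
    by (simp add: persistent_homology_def homology_def)
  have Vadd: "pv_add ?V \<delta> (z +o ?B \<delta>) (w +o ?B \<delta>) = (z + w) +o ?B \<delta>" for \<delta> z w
    by (simp add: persistent_homology_def coset_add)
  have Vscale: "pv_scale ?V \<delta> x (z +o ?B \<delta>) = (\<lambda>\<sigma>. x * z \<sigma>) +o ?B \<delta>" for \<delta> x z
    by (simp add: persistent_homology_def coset_scale)
  have Vmap: "pv_map ?V \<delta> \<delta>' (z +o ?B \<delta>) = z +o ?B \<delta>'" if "\<delta> \<le> \<delta>'" for \<delta> \<delta>' z
    by (simp add: persistent_homology_def coset_absorb[OF mono[OF that]])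
  have closed: "pv_closed ?V"
    unfolding pv_closed_def
  proof (intro conjI allI ballI impI)
    fix \<delta> x y assume "x \<in> pv_carrier ?V \<delta>" "y \<in> pv_carrier ?V \<delta>"
    then obtain z w where "z \<in> ?Z \<delta>" "w \<in> ?Z \<delta>" "x = z +o ?B \<delta>" "y = w +o ?B \<delta>"
      unfolding carrier by blast
    then show "pv_add ?V \<delta> x y \<in> pv_carrier ?V \<delta>"
      unfolding carrier by (simp only: Vadd) (intro imageI cycles_add)
  next
    fix \<delta> x y assume "y \<in> pv_carrier ?V \<delta>"
    then obtain w where "w \<in> ?Z \<delta>" "y = w +o ?B \<delta>"
      unfolding carrier by blast
    then show "pv_scale ?V \<delta> x y \<in> pv_carrier ?V \<delta>"
      unfolding carrier by (simp only: Vscale) (intro imageI cycles_scale)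
  next
    fix \<delta> \<delta>' :: real and y assume le: "\<delta> \<le> \<delta>'" and "y \<in> pv_carrier ?V \<delta>"
    then obtain w where w: "w \<in> ?Z \<delta>" "y = w +o ?B \<delta>"
      unfolding carrier by blast
    have "w \<in> ?Z \<delta>'" using w(1) cycles_mono[OF mono[OF le]] by blast
    then show "pv_map ?V \<delta> \<delta>' y \<in> pv_carrier ?V \<delta>'"
      unfolding carrier w(2) Vmap[OF le] by (rule imageI)
  qed
  obtain h where h: "bij_betw h {..<card I} I"
    using ex_bij_betw_nat_finite[OF I] by (auto simp: atLeast0LessThan)
  have summands: "summands ?D = {(a, ereal b)} \<times> {..<card I}"
    by (auto simp: summands_def split: if_splits)
  \<comment> \<open>Any representative serves: two of them differ by a boundary, which
    \<open>f\<close> kills.\<close>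
  define \<Phi> :: "real \<Rightarrow> ('a set \<Rightarrow> 'k) set \<Rightarrow> (real \<times> ereal) \<times> nat \<Rightarrow> 'k"
    where "\<Phi> \<delta> S = (\<lambda>i\<in>summands ?D. if alv \<delta> then f (SOME z. z \<in> S) (h (snd i)) else 0)" for \<delta> S
  have \<Phi>: "\<Phi> \<delta> (z +o ?B \<delta>) = (\<lambda>i\<in>summands ?D. if alv \<delta> then f z (h (snd i)) else 0)"
    if z: "z \<in> ?Z \<delta>" for \<delta> z
  proof (cases "alv \<delta>")
    case True
    then have FC: "F \<delta> = C" using inside by (simp add: alv_def)
    have "z + 0 \<in> z +o ?B \<delta>" unfolding mem_coset using boundaries_zero by blast
    then have "(SOME w. w \<in> z +o ?B \<delta>) \<in> z +o ?B \<delta>" by (rule someI[of "\<lambda>w. w \<in> z +o ?B \<delta>"])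
    then obtain c where c: "c \<in> boundaries C p" "(SOME w. w \<in> z +o ?B \<delta>) = z + c"
      unfolding mem_coset FC by blast
    have zC: "z \<in> cycles C p" and cC: "c \<in> cycles C p" using z c sub FC by auto
    have "f (z + c) = f z" using f_add[OF zC cC] f_ker[OF cC] c(1) by simp
    then show ?thesis unfolding \<Phi>_def c(2) by (simp only:)
  qed (simp add: \<Phi>_def)
  have "pv_isomorphic ?V (interval_sum ?D)"
    unfolding pv_isomorphic_def
  proof (intro exI[of _ \<Phi>] conjI allI ballI impI)
    fix \<delta>
    show "bij_betw (\<Phi> \<delta>) (pv_carrier ?V \<delta>) (pv_carrier (interval_sum ?D) \<delta>)"
    proof (cases "alv \<delta>")
      case True
      then have FC: "F \<delta> = C" using inside by (simp add: alv_def)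
      have alive: "alive (a, ereal b) \<delta>" using True by (simp add: alive_def alv_def)
      show ?thesis
      proof (rule bij_betw_imageI)
        show "inj_on (\<Phi> \<delta>) (pv_carrier ?V \<delta>)"
        proof (rule inj_onI)
          fix x y assume xy: "x \<in> pv_carrier ?V \<delta>" "y \<in> pv_carrier ?V \<delta>" "\<Phi> \<delta> x = \<Phi> \<delta> y"
          then obtain z w where zw: "z \<in> cycles C p" "w \<in> cycles C p" "x = z +o boundaries C p" "y = w +o boundaries C p"
            unfolding carrier FC by blast
          have eq: "f z (h j) = f w (h j)" if "j < card I" for j
            using fun_cong[OF xy(3), of "((a, ereal b), j)"] that zw \<Phi>[of z \<delta>] \<Phi>[of w \<delta>] True
            by (simp add: FC summands)
          have fzw: "f z i = f w i" for i
          proof (cases "i \<in> I")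
            case True
            then obtain j where "j < card I" "i = h j" using h by (auto simp: bij_betw_def)
            then show ?thesis using eq by simp
          next
            case False
            have "f z \<in> f ` cycles C p" "f w \<in> f ` cycles C p" using zw by auto
            then have "f z i = 0" "f w i = 0" unfolding f_image using False by blast+
            then show ?thesis by simp
          qed
          define e where "e = w + (\<lambda>\<sigma>. (- 1) * z \<sigma>)"
          have e: "e \<in> cycles C p" unfolding e_def by (intro cycles_add cycles_scale zw)
          have "f e = 0"
            unfolding e_def f_add[OF zw(2) cycles_scale[OF zw(1)]] f_scale[OF zw(1)]
            using fzw by (simp add: fun_eq_iff)
          then have "e \<in> boundaries C p" using f_ker[OF e] by simp
          moreover have "w = z + e" by (auto simp: e_def fun_eq_iff)
          ultimately show "x = y" unfolding zw(3,4) by (simp only: coset_shift)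
        qed
        show "\<Phi> \<delta> ` pv_carrier ?V \<delta> = pv_carrier (interval_sum ?D) \<delta>"
        proof (intro equalityI subsetI)
          fix g assume "g \<in> \<Phi> \<delta> ` pv_carrier ?V \<delta>"
          then obtain z where "z \<in> ?Z \<delta>" "g = \<Phi> \<delta> (z +o ?B \<delta>)" unfolding carrier by blast
          then show "g \<in> pv_carrier (interval_sum ?D) \<delta>"
            using alive by (simp add: \<Phi> interval_sum_carrier summands)
        next
          fix g :: "(real \<times> ereal) \<times> nat \<Rightarrow> 'k"
          assume g: "g \<in> pv_carrier (interval_sum ?D) \<delta>"
          define g' where "g' i = (if i \<in> I then g ((a, ereal b), inv_into {..<card I} h i) else 0)" for i
          have "g' \<in> f ` cycles C p" unfolding f_image by (simp add: g'_def)
          then obtain z where z: "z \<in> cycles C p" "f z = g'" by auto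
          have zF: "z \<in> ?Z \<delta>" using z FC by simp
          have "g = \<Phi> \<delta> (z +o ?B \<delta>)"
          proof
            fix i
            show "g i = \<Phi> \<delta> (z +o ?B \<delta>) i"
            proof (cases "i \<in> summands ?D")
              case iS: True
              then obtain j where j: "i = ((a, ereal b), j)" "j < card I" by (auto simp: summands)
              then have "h j \<in> I" "inv_into {..<card I} h (h j) = j"
                using h by (auto simp: bij_betw_def)
              then show ?thesis unfolding \<Phi>[OF zF] using iS j z True by (simp add: g'_def)
            next
              case False
              moreover have "g \<in> extensional (summands ?D)" using g by (simp only: interval_sum_carrier)
              ultimately show ?thesis unfolding \<Phi>[OF zF] by (simp add: extensional_arb[of g])
            qed
          qed
          moreover have "z +o ?B \<delta> \<in> pv_carrier ?V \<delta>" unfolding carrier using z FC by blast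
          ultimately show "g \<in> \<Phi> \<delta> ` pv_carrier ?V \<delta>" by blast
        qed
      qed
    next
      case False
      then have ZB: "?Z \<delta> = ?B \<delta>" using outside by (simp add: alv_def)
      have zero: "(0 :: 'a set \<Rightarrow> 'k) \<in> ?Z \<delta>" unfolding ZB by (rule boundaries_zero)
      have "z +o ?B \<delta> = 0 +o ?B \<delta>" if "z \<in> ?Z \<delta>" for z
        using coset_shift[of z "F \<delta>" p 0] that ZB by simp
      then have "pv_carrier ?V \<delta> = {0 +o ?B \<delta>}" unfolding carrier using zero by blast
      moreover have "pv_carrier (interval_sum ?D) \<delta> = {\<lambda>i\<in>summands ?D. 0 :: 'k}"
      proof -
        have "\<not> alive (a, ereal b) \<delta>" using False by (simp add: alive_def alv_def)
        then have "g \<in> pv_carrier (interval_sum ?D) \<delta> \<longleftrightarrow> g = (\<lambda>i\<in>summands ?D. 0)"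
          for g :: "(real \<times> ereal) \<times> nat \<Rightarrow> 'k"
          unfolding interval_sum_carrier
          by (auto simp: summands fun_eq_iff restrict_def extensional_def)
        then show ?thesis by blast
      qed
      moreover have "\<Phi> \<delta> (0 +o ?B \<delta>) = (\<lambda>i\<in>summands ?D. 0)"
        using \<Phi>[OF zero] False by simp
      ultimately show ?thesis by (simp add: bij_betw_def)
    qed
  next
    fix \<delta> x y assume "x \<in> pv_carrier ?V \<delta>" "y \<in> pv_carrier ?V \<delta>"
    then obtain z w where zw: "z \<in> ?Z \<delta>" "w \<in> ?Z \<delta>" "x = z +o ?B \<delta>" "y = w +o ?B \<delta>"
      unfolding carrier by blast
    have "alv \<delta> \<Longrightarrow> f (z + w) = f z + f w" using f_add zw inside by (simp add: alv_def)
    then show "\<Phi> \<delta> (pv_add ?V \<delta> x y) = pv_add (interval_sum ?D) \<delta> (\<Phi> \<delta> x) (\<Phi> \<delta> y)"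
      unfolding zw(3,4) Vadd \<Phi>[OF zw(1)] \<Phi>[OF zw(2)] \<Phi>[OF cycles_add[OF zw(1,2)]] interval_sum_add
      by (auto simp: restrict_def fun_eq_iff)
  next
    fix \<delta> x y assume "y \<in> pv_carrier ?V \<delta>"
    then obtain w where w: "w \<in> ?Z \<delta>" "y = w +o ?B \<delta>"
      unfolding carrier by blast
    have "alv \<delta> \<Longrightarrow> f (\<lambda>\<sigma>. x * w \<sigma>) = (\<lambda>i. x * f w i)" using f_scale w inside by (simp add: alv_def)
    then show "\<Phi> \<delta> (pv_scale ?V \<delta> x y) = pv_scale (interval_sum ?D) \<delta> x (\<Phi> \<delta> y)"
      unfolding w(2) Vscale \<Phi>[OF w(1)] \<Phi>[OF cycles_scale[OF w(1)]] interval_sum_scale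
      by (auto simp: restrict_def fun_eq_iff)
  next
    fix \<delta> \<delta>' :: real and y assume le: "\<delta> \<le> \<delta>'" and "y \<in> pv_carrier ?V \<delta>"
    then obtain w where w: "w \<in> ?Z \<delta>" "y = w +o ?B \<delta>"
      unfolding carrier by blast
    have w': "w \<in> ?Z \<delta>'" using w(1) cycles_mono[OF mono[OF le]] by blast
    \<comment> \<open>Entering the interval: a cycle of a complex before it is already a boundary
      there, and remains one.\<close>
    have "f w = 0" if "\<not> alv \<delta>" "alv \<delta>'"
    proof -
      have "w \<in> ?B \<delta>" using w(1) outside that by (simp add: alv_def)
      then have "w \<in> ?B \<delta>'" using boundaries_mono[OF mono[OF le]] by blast
      moreover have "F \<delta>' = C" using that(2) inside by (simp add: alv_def)
      ultimately show ?thesis using f_ker w' by simp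
    qed
    then show "\<Phi> \<delta>' (pv_map ?V \<delta> \<delta>' y) = pv_map (interval_sum ?D) \<delta> \<delta>' (\<Phi> \<delta> y)"
      unfolding w(2) Vmap[OF le] \<Phi>[OF w(1)] \<Phi>[OF w'] interval_sum_map
      using le by (auto simp: restrict_def fun_eq_iff summands alv_def)
  qed
  then have iso: "interval_decomposition ?V ?D"
    using ab by (auto simp: interval_decomposition_alt split: if_splits)
  show ?thesis
    unfolding persistence_diagram_def
  proof (rule the_equality)
    show "interval_decomposition ?V ?D" by (rule iso)
    fix D assume D: "interval_decomposition ?V D"
    show "D = ?D"
    proof (rule interval_sum_unique[OF refl ab])
      show "ereal a' < b'" if "(a', b') \<in># D" for a' b'
        using D that unfolding interval_decomposition_alt by blast
      have "pv_isomorphic ?V (interval_sum D)" "pv_isomorphic ?V (interval_sum ?D)"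
        using D iso unfolding interval_decomposition_alt by blast+
      then show "pv_isomorphic (interval_sum ?D :: ('k, _) persistence_space) (interval_sum D)"
        "pv_isomorphic (interval_sum D :: ('k, _) persistence_space) (interval_sum ?D)"
        using pv_isomorphic_span[OF closed] by blast+
    qed
  qed
qed

section \<open>Cycle networks\<close>

context complex_pair
begin

lemma boundaries_subset_cycles: "boundaries C p \<subseteq> (cycles C p :: ('a set \<Rightarrow> 'k::field) set)"
proof
  fix b :: "'a set \<Rightarrow> 'k" assume "b \<in> boundaries C p"
  then obtain c where c: "c \<in> chains C (Suc p)" "b = boundary c" by (auto simp: boundaries_def)
  have cF: "c \<in> chains full (Suc p)" by (rule chains_full[OF C_full c(1)])
  then have b: "b = bd c" using boundary_eq_bd c(2) by simp
  have bC: "b \<in> chains C p" unfolding b by (rule bd_C[OF c(1)])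
  have "boundary b = bd b" by (rule boundary_eq_bd[OF chains_full[OF C_full bC]])
  also have "\<dots> = 0"
  proof (cases p)
    \<comment> \<open>Here \<open>bd_bd\<close> says nothing; the boundary of a 0-chain vanishes
      because \<open>incidence\<close> excludes the empty face.\<close>
    case 0
    have "bd b \<tau> = 0" for \<tau>
      unfolding bd_def
    proof (intro sum.neutral ballI, rule ccontr)
      fix \<sigma> assume "\<sigma> \<in> full" "b \<sigma> * incidence \<sigma> \<tau> \<noteq> 0"
      then have "card \<sigma> = 1" "incidence \<sigma> \<tau> \<noteq> (0 :: 'k)"
        using bC 0 by (auto simp: chains_def)
      then show False using incidence_nonzero[of \<sigma> \<tau>] by (auto simp: card_1_singleton_iff)
    qed
    then show ?thesis by (simp add: fun_eq_iff)
  next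
    case (Suc q)
    then show ?thesis unfolding b using bd_bd cF by simp
  qed
  finally show "b \<in> cycles C p" using bC by (simp add: cycles_def)
qed

lemma full_cycles:
  assumes "C = full"
  shows "cycles C (Suc p) = (boundaries C (Suc p) :: ('a set \<Rightarrow> 'k::field) set)"
proof
  show "cycles C (Suc p) \<subseteq> (boundaries C (Suc p) :: ('a set \<Rightarrow> 'k) set)"
  proof
    fix z :: "'a set \<Rightarrow> 'k" assume "z \<in> cycles C (Suc p)"
    then have z: "z \<in> chains full (Suc p)" "boundary z = 0" by (simp_all add: cycles_def assms)
    then have "bd (cone z) = z" using cone_homotopy[OF z(1)] boundary_eq_bd[OF z(1)] by simp
    then have "z = boundary (cone z)" using boundary_eq_bd[OF cone_full[OF z(1)]] by simp
    then show "z \<in> boundaries C (Suc p)"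
      using cone_full[OF z(1)] by (simp add: boundaries_def assms)
  qed
qed (rule boundaries_subset_cycles)

end

lemma coordinates_empty:
  assumes "coordinates Z B {} f" "B \<subseteq> Z"
  shows "Z = B"
proof -
  have "f z = 0" if "z \<in> Z" for z
  proof -
    have "f z \<in> {g. \<forall>i. g i \<noteq> 0 \<longrightarrow> i \<in> {}}"
      using assms(1) that unfolding coordinates_def by blast
    then show ?thesis by (auto simp: fun_eq_iff)
  qed
  then show ?thesis using assms unfolding coordinates_def by blast
qed

text \<open>Feeds the trivial diagrams into \<open>persistence_diagram_single_interval\<close> with
  an empty index set.\<close>

lemma coordinates_trivial:
  fixes Z :: "('c \<Rightarrow> 'a::field) set"
  assumes "0 \<in> Z" "Z = B"
  shows "coordinates Z B {} (\<lambda>_. 0 :: 'b \<Rightarrow> 'a)"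
  unfolding coordinates_def
proof (intro conjI)
  have "{g :: 'b \<Rightarrow> 'a. \<forall>i. g i \<noteq> 0 \<longrightarrow> i \<in> {}} = {0}"
    by (auto simp: fun_eq_iff)
  then show "(\<lambda>_. 0) ` Z = {g :: 'b \<Rightarrow> 'a. \<forall>i. g i \<noteq> 0 \<longrightarrow> i \<in> {}}"
    using assms(1) by auto
qed (use assms(2) in \<open>simp_all add: fun_eq_iff\<close>)

locale dowker_pair = cyclic_gaps +
  fixes C :: "nat set set"
  assumes C_eq: "C = Pow {1..n} - {{}} - cells"
    and C_faces: "\<lbrakk>\<sigma> \<in> C; \<tau> \<subseteq> \<sigma>; \<tau> \<noteq> {}\<rbrakk> \<Longrightarrow> \<tau> \<in> C"
begin

sublocale complex_pair "{1..n}" C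
proof
  show "{1..n} \<noteq> {}" using r_less by simp
  show "C \<subseteq> Pow {1..n} - {{}}" unfolding C_eq by (rule Diff_subset)
  show "\<tau> \<in> C" if "\<sigma> \<in> C" "\<tau> \<subseteq> \<sigma>" "\<tau> \<noteq> {}" for \<sigma> \<tau>
    by (rule C_faces[OF that])
qed (rule finite_atLeastAtMost)

lemma rel_eq: "rel = cells"
proof -
  have "cells \<subseteq> Pow {1..n} - {{}}" by (auto simp: dense_sets_def)
  then show ?thesis unfolding rel_def full_def using C_eq by blast
qed

text \<open>Degree \<open>2l\<close> of \<open>C\<close> corresponds to degree \<open>2l + 1\<close>
  of the quotient, that is to sets of \<open>2l + 2 = 2 * Suc l\<close> nodes.\<close>

theorem homology_coordinates:
  assumes l: "l \<ge> 1"
  shows "\<exists>I f. coordinates (cycles C (2 * l)) (boundaries C (2 * l)) I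
      (f :: (nat set \<Rightarrow> 'k::field) \<Rightarrow> nat set \<Rightarrow> 'k) \<and>
    finite I \<and> card I = (if n = Suc l * Suc r then r else 0)"
proof -
  interpret rel: based_complex cells "incidence :: nat set \<Rightarrow> nat set \<Rightarrow> 'k" card
  proof
    show "finite cells" by (rule finite_cells)
    fix \<sigma> \<tau> :: "nat set" assume "\<sigma> \<in> cells" "incidence \<sigma> \<tau> \<noteq> (0 :: 'k)"
    then obtain v where "v \<in> \<sigma>" "\<tau> = \<sigma> - {v}" "finite \<sigma>"
      using incidence_nonzero[of \<sigma> \<tau>] cells_finite[of \<sigma>] by blast
    then show "card \<sigma> = Suc (card \<tau>)" by (metis card_Suc_Diff1)
  qed
  \<comment> \<open>The matching grades by cardinality, which exceeds the simplicial degree by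
    one.\<close>
  have graded: "rel.graded (Suc p) = chains rel p" for p
    unfolding chains_eq[OF rel_full] unfolding rel.graded_def rel_eq by simp
  have diff: "rel.diff c = restr (bd c)" if c: "c \<in> chains rel p" for c p
  proof
    fix \<tau>
    have zero: "c \<sigma> = 0" if "\<sigma> \<notin> cells" for \<sigma>
      using c that unfolding chains_def rel_eq by blast
    have "bd c \<tau> = (\<Sum>\<sigma>\<in>cells. c \<sigma> * incidence \<sigma> \<tau>)"
      unfolding bd_def
      by (rule sum.mono_neutral_right)
        (use finite_full rel_full[unfolded rel_eq] zero in auto)
    then show "rel.diff c \<tau> = restr (bd c) \<tau>"
      unfolding rel.diff_def restr_def rel_eq by simp
  qed
  interpret acyclic_matching cells "incidence :: nat set \<Rightarrow> nat set \<Rightarrow> 'k" card low mate key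
  proof
    fix c :: "nat set \<Rightarrow> 'k" and p assume c: "c \<in> rel.graded p"
    show "rel.diff (rel.diff c) = 0"
    proof (cases "p \<le> 2")
      \<comment> \<open>Two boundaries would lead to cardinality 0 or below, where there are no
        cells.\<close>
      case True
      have none: "e = 0" if "e \<in> rel.graded 0" for e
      proof
        fix \<sigma>
        have "card \<sigma> \<noteq> 0" if "\<sigma> \<in> cells" using cells_finite[OF that] cells_nonempty[OF that] by simp
        moreover have "e \<sigma> \<noteq> 0 \<Longrightarrow> \<sigma> \<in> cells \<and> card \<sigma> = 0"
          using that unfolding rel.graded_def by blast
        ultimately show "e \<sigma> = 0 \<sigma>" by (cases "e \<sigma> = 0") simp_all
      qed
      consider "p = 0" | "p = Suc 0" | "p = Suc (Suc 0)" using True by linarith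
      then show ?thesis
      proof cases
        case 1
        then have "c = 0" using none c by blast
        then show ?thesis by simp
      next
        case 2
        then have "rel.diff c = 0" using none rel.diff_graded c by blast
        then show ?thesis by simp
      next
        case 3
        then show ?thesis using none rel.diff_graded c by blast
      qed
    next
      case False
      then obtain q where p: "p = Suc (Suc (Suc q))" by (metis Suc_le_D numeral_2_eq_2 not_less_eq_eq)
      have cr: "c \<in> chains rel (Suc (Suc q))" using c graded p by simp
      then have cf: "c \<in> chains full (Suc (Suc q))" by (rule chains_full[OF rel_full])
      have "restr (bd c) \<in> chains rel (Suc q)" by (rule restr_rel[OF bd_full[OF cf]])
      then have "rel.diff (rel.diff c) = restr (bd (restr (bd c)))"
        using diff[OF cr] diff by simp
      also have "\<dots> = restr (bd (bd c))" by (rule restr_bd_restr[OF bd_full[OF cf]])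
      also have "\<dots> = 0" unfolding bd_bd[OF cf] by (rule restr_zero)
      finally show ?thesis .
    qed
  next
    show "low \<subseteq> cells" by (auto simp: low_def)
    show "mate ` low \<subseteq> cells - low" using mate_cells mate_not_low by blast
    show "inj_on mate low" by (rule inj_on_mate)
  next
    fix S assume "S \<in> low"
    then have "S \<in> cells" "pivot r S \<notin> S" by (simp_all add: low_def)
    then show "incidence (mate S) S \<noteq> (0 :: 'k)"
      unfolding mate_def by (simp add: incidence_insert cells_finite cells_nonempty)
  next
    fix S T assume "S \<in> low" "T \<in> low" "S \<noteq> T" "incidence (mate S) T \<noteq> (0 :: 'k)"
    then show "key S < key T" using incidence_nonzero[of "mate S" T] key_less by blast
  qed
  define p where "p = 2 * l - 1"
  have p: "2 * l = Suc p" using l by (simp add: p_def)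
  \<comment> \<open>If \<open>r + 1\<close> divides \<open>n\<close>, every critical cell is even,
    so the adjacent odd cardinalities are free; otherwise no critical cell has
    \<open>2 * Suc l\<close> nodes.\<close>
  have "(\<forall>\<sigma>\<in>critical. card \<sigma> \<noteq> Suc (Suc (Suc p))) \<or>
      (\<forall>\<sigma>\<in>critical. card \<sigma> \<noteq> Suc (Suc p) \<and> card \<sigma> \<noteq> Suc (Suc (Suc (Suc p))))"
  proof (cases "Suc r dvd n")
    case True
    have "even (card \<sigma>)" if "\<sigma> \<in> critical" for \<sigma>
      using critical_even[OF True] that by (simp add: critical_def)
    moreover have "odd (Suc (Suc p))" "odd (Suc (Suc (Suc (Suc p))))" using p by presburger+
    ultimately show ?thesis by metis
  next
    case False
    then have "n \<noteq> Suc l * Suc r" by (metis dvd_triv_right)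
    then have "{S \<in> cells - low - mate ` low. card S = 2 * Suc l} = {}"
      using even_critical[of l] by simp
    moreover have "2 * Suc l = Suc (Suc (Suc p))" using p by simp
    ultimately show ?thesis unfolding critical_def by auto
  qed
  from coordinates_matching[OF this] obtain f :: "(nat set \<Rightarrow> 'k) \<Rightarrow> nat set \<Rightarrow> 'k"
    where f: "coordinates {c \<in> rel.graded (Suc (Suc (Suc p))). rel.diff c = 0}
      (rel.diff ` rel.graded (Suc (Suc (Suc (Suc p))))) {\<sigma> \<in> critical. card \<sigma> = Suc (Suc (Suc p))} f"
    by (rule that)
  have Z: "{c \<in> rel.graded (Suc (Suc (Suc p))). rel.diff c = 0} =
      {c \<in> chains rel (Suc (Suc p)). restr (bd c) = (0 :: nat set \<Rightarrow> 'k)}"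
    unfolding graded by (rule Collect_cong) (metis diff)
  have B: "rel.diff ` rel.graded (Suc (Suc (Suc (Suc p)))) =
      (\<lambda>c :: nat set \<Rightarrow> 'k. restr (bd c)) ` chains rel (Suc (Suc (Suc p)))"
    unfolding graded by (rule image_cong[OF refl diff])
  have I: "{\<sigma> \<in> critical. card \<sigma> = Suc (Suc (Suc p))} =
      (if n = Suc l * Suc r then (\<lambda>s. ladder s l) ` {1..r} else {})"
    unfolding even_critical[symmetric] critical_def using p by simp
  have card: "finite {\<sigma> \<in> critical. card \<sigma> = Suc (Suc (Suc p))}"
    "card {\<sigma> \<in> critical. card \<sigma> = Suc (Suc (Suc p))} = (if n = Suc l * Suc r then r else 0)"
    unfolding I using card_ladders by simp_all
  show ?thesis
    unfolding p by (intro exI conjI) (rule coordinates_connecting[OF f[unfolded Z B]] card)+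
qed

end

lemma dowker_sink_mono: "\<delta> \<le> \<delta>' \<Longrightarrow> dowker_sink X \<omega> \<delta> \<subseteq> dowker_sink X \<omega> \<delta>'"
proof
  fix \<sigma> assume "\<delta> \<le> \<delta>'" "\<sigma> \<in> dowker_sink X \<omega> \<delta>"
  then obtain y where "\<sigma> \<subseteq> X" "\<sigma> \<noteq> {}" "y \<in> X" "\<And>x. x \<in> \<sigma> \<Longrightarrow> \<omega> x y \<le> \<delta>'"
    unfolding dowker_sink_def using order_trans by blast
  then show "\<sigma> \<in> dowker_sink X \<omega> \<delta>'" unfolding dowker_sink_def by blast
qed

lemma dowker_sink_face:
  "\<lbrakk>\<sigma> \<in> dowker_sink X \<omega> \<delta>; \<tau> \<subseteq> \<sigma>; \<tau> \<noteq> {}\<rbrakk> \<Longrightarrow> \<tau> \<in> dowker_sink X \<omega> \<delta>"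
  unfolding dowker_sink_def by blast

abbreviation cycle_filtration :: "nat \<Rightarrow> real \<Rightarrow> nat set set" where
  "cycle_filtration n \<equiv> dowker_sink (cycle_nodes n) (cycle_weight n)"

lemma dowker_pair_cycle:
  assumes "1 \<le> r" "n = Suc (\<kappa> + r)" "real \<kappa> \<le> \<delta>" "\<delta> < real \<kappa> + 1"
  shows "dowker_pair n r (cycle_filtration n \<delta>)"
proof
  show "cycle_filtration n \<delta> = Pow {1..n} - {{}} - dense_sets n r"
    by (rule dowker_sink_dense[OF assms(2-4)])
  show "\<tau> \<in> cycle_filtration n \<delta>" if "\<sigma> \<in> cycle_filtration n \<delta>" "\<tau> \<subseteq> \<sigma>" "\<tau> \<noteq> {}" for \<sigma> \<tau>
    by (rule dowker_sink_face[OF that])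
qed (use assms in simp_all)

text \<open>The complex is empty, a full simplex, or the complement of \<open>dense_sets n r\<close>
  with \<open>r = n - 1 - \<lfloor>\<delta>\<rfloor>\<close>. The hypothesis excludes only
  parameters with \<open>n = (l + 1)(r + 1)\<close>, so it covers both the trivial diagrams and the
  outside of the critical interval.\<close>

lemma cycle_homology_trivial:
  assumes n: "n \<ge> 3" and l: "l \<ge> 1"
    and not: "\<And>r \<kappa>. \<lbrakk>1 \<le> r; n = Suc l * Suc r; n = Suc (\<kappa> + r)\<rbrakk> \<Longrightarrow> \<not> (real \<kappa> \<le> \<delta> \<and> \<delta> < real \<kappa> + 1)"
  shows "cycles (cycle_filtration n \<delta>) (2 * l) =
    (boundaries (cycle_filtration n \<delta>) (2 * l) :: (nat set \<Rightarrow> 'k::field) set)"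
proof -
  consider "\<delta> < 0" | "0 \<le> \<delta>" "\<delta> < real n - 1" | "real n - 1 \<le> \<delta>" by linarith
  then show ?thesis
  proof cases
    case 1
    have "chains {} p = {0 :: nat set \<Rightarrow> 'k}" for p by (auto simp: chains_def fun_eq_iff)
    then show ?thesis
      unfolding dowker_sink_cycle_neg[OF 1] cycles_def boundaries_def by (auto simp: boundary_zero)
  next
    case 2
    define \<kappa> where "\<kappa> = nat \<lfloor>\<delta>\<rfloor>"
    define r where "r = n - 1 - \<kappa>"
    have \<kappa>: "real \<kappa> \<le> \<delta>" "\<delta> < real \<kappa> + 1" using 2(1) by (auto simp: \<kappa>_def)
    then have "real \<kappa> < real n - 1" using 2 by linarith
    then have r: "1 \<le> r" "n = Suc (\<kappa> + r)" by (auto simp: r_def)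
    interpret dowker_pair n r "cycle_filtration n \<delta>"
      by (rule dowker_pair_cycle[OF r \<kappa>])
    have "n \<noteq> Suc l * Suc r" using not[OF r(1) _ r(2)] \<kappa> by blast
    then obtain I and f :: "(nat set \<Rightarrow> 'k) \<Rightarrow> nat set \<Rightarrow> 'k"
      where If: "coordinates (cycles (cycle_filtration n \<delta>) (2 * l))
          (boundaries (cycle_filtration n \<delta>) (2 * l)) I f" "finite I" "card I = 0"
      using homology_coordinates[OF l] by metis
    then have "I = {}" by simp
    then show ?thesis using coordinates_empty If(1) boundaries_subset_cycles by blast
  next
    case 3
    have full: "cycle_filtration n \<delta> = Pow {1..n} - {{}}"
      by (rule dowker_sink_cycle_full[OF 3]) (use n in simp)
    interpret complex_pair "{1..n}" "cycle_filtration n \<delta>"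
      by unfold_locales (use n full in auto)
    have "2 * l = Suc (2 * l - 1)" using l by simp
    moreover have "cycle_filtration n \<delta> = full" unfolding full_def by (rule full)
    ultimately show ?thesis using full_cycles by metis
  qed
qed

lemma cycle_diagram_trivial:
  assumes n: "n \<ge> 3" and l: "l \<ge> 1" and not: "\<And>r. 1 \<le> r \<Longrightarrow> n \<noteq> Suc l * Suc r"
  shows "dowker_diagram TYPE('k::field) (2 * l) (cycle_nodes n) (cycle_weight n) = {#}"
proof -
  let ?F = "cycle_filtration n"
  have triv: "cycles (?F \<delta>) (2 * l) = (boundaries (?F \<delta>) (2 * l) :: (nat set \<Rightarrow> 'k) set)" for \<delta>
    by (rule cycle_homology_trivial[OF n l]) (use not in blast)
  \<comment> \<open>\<open>[0, 1)\<close> is an arbitrary stretch of constancy; it will occur with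
    multiplicity 0.\<close>
  have const: "?F \<delta> = ?F 0" if "0 \<le> \<delta>" "\<delta> < 1" for \<delta>
    using dowker_sink_cycle[of 0 \<delta> n] dowker_sink_cycle[of 0 0 n] that by simp
  have "(0 :: nat set \<Rightarrow> 'k) \<in> cycles (?F 0) (2 * l)"
    unfolding triv by (rule boundaries_zero)
  then have coord: "coordinates (cycles (?F 0) (2 * l)) (boundaries (?F 0) (2 * l)) {}
      (\<lambda>_ :: nat set \<Rightarrow> 'k. 0 :: nat \<Rightarrow> 'k)"
    using triv by (rule coordinates_trivial)
  have "persistence_diagram (persistent_homology ?F (2 * l) :: ('k, (nat set \<Rightarrow> 'k) set) persistence_space) =
      replicate_mset (card ({} :: nat set)) (0, ereal 1)"
    by (rule persistence_diagram_single_interval[OF dowker_sink_mono _ const triv _ coord])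
      (simp_all add: triv)
  then show ?thesis by (simp add: dowker_diagram_def)
qed

lemma cycle_diagram_critical:
  assumes n: "n \<ge> 3" and l: "l \<ge> 1" and r: "1 \<le> r" and eq: "n = Suc l * Suc r"
  shows "dowker_diagram TYPE('k::field) (2 * l) (cycle_nodes n) (cycle_weight n) =
    replicate_mset r (real (l * Suc r), ereal (real (l * Suc r) + 1))"
proof -
  let ?F = "cycle_filtration n"
  \<comment> \<open>This is \<open>n - 1 - r\<close> for \<open>n = (l + 1)(r + 1)\<close>.\<close>
  define \<kappa> where "\<kappa> = l * Suc r"
  have nk: "n = Suc (\<kappa> + r)" using eq by (simp add: \<kappa>_def)
  have const: "?F \<delta> = ?F (real \<kappa>)" if "real \<kappa> \<le> \<delta>" "\<delta> < real \<kappa> + 1" for \<delta>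
    using dowker_sink_cycle[OF that] dowker_sink_cycle[of \<kappa> "real \<kappa>" n] by simp
  have triv: "cycles (?F \<delta>) (2 * l) = (boundaries (?F \<delta>) (2 * l) :: (nat set \<Rightarrow> 'k) set)"
    if "\<not> (real \<kappa> \<le> \<delta> \<and> \<delta> < real \<kappa> + 1)" for \<delta>
  proof (rule cycle_homology_trivial[OF n l])
    fix r' \<kappa>' assume "n = Suc l * Suc r'" "n = Suc (\<kappa>' + r')"
    then have "r' = r" using eq by (metis mult_cancel1 nat.inject nat.distinct(1))
    then have "\<kappa>' = \<kappa>" using nk \<open>n = Suc (\<kappa>' + r')\<close> by simp
    then show "\<not> (real \<kappa>' \<le> \<delta> \<and> \<delta> < real \<kappa>' + 1)" using that by simp
  qed
  interpret dowker_pair n r "?F (real \<kappa>)"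
    by (rule dowker_pair_cycle[OF r nk]) simp_all
  obtain I and f :: "(nat set \<Rightarrow> 'k) \<Rightarrow> nat set \<Rightarrow> 'k"
    where If: "coordinates (cycles (?F (real \<kappa>)) (2 * l)) (boundaries (?F (real \<kappa>)) (2 * l)) I f"
      "finite I" "card I = r"
    using homology_coordinates[OF l] eq by metis
  have "persistence_diagram (persistent_homology ?F (2 * l) :: ('k, (nat set \<Rightarrow> 'k) set) persistence_space) =
      replicate_mset (card I) (real \<kappa>, ereal (real \<kappa> + 1))"
    by (rule persistence_diagram_single_interval[OF dowker_sink_mono _ const triv
          boundaries_subset_cycles If(1,2)]) simp_all
  then show ?thesis by (simp add: dowker_diagram_def If(3) \<kappa>_def)
qed

text \<open>Write \<open>n = (l + 1) * m\<close>. Then \<open>k = l * m\<close> and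
  \<open>n - k = m\<close>, so \<open>k \<le> n - 2\<close> means \<open>m \<ge> 2\<close>, that is
  \<open>m = r + 1\<close> with \<open>r \<ge> 1\<close>, and the multiplicity is
  \<open>r\<close>.\<close>

theorem theorem37:
  fixes n l :: nat and k :: real
  assumes "n \<ge> 3" and "l \<ge> 1"
    and "k = real (n * l) / real (l + 1)"
  shows "dowker_diagram TYPE('k::field) (2 * l) (cycle_nodes n) (cycle_weight n) =
    (if (l + 1) dvd n \<and> 0 \<le> k \<and> k \<le> real n - 2
     then replicate_mset (n div (l + 1) - 1) (k, ereal (k + 1))
     else {#})"
proof (cases "(l + 1) dvd n \<and> k \<le> real n - 2")
  case True
  then obtain m where m: "n = Suc l * m" by auto
  have k: "k = real (l * m)"
  proof -
    have "real (n * l) = real (l * m) * real (l + 1)" unfolding m by (simp add: algebra_simps)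
    then show ?thesis unfolding assms(3) by (simp only: nonzero_mult_div_cancel_right of_nat_eq_0_iff)
  qed
  have "real (l * m) + 2 \<le> real (Suc l * m)" using True unfolding k m by simp
  then have "2 \<le> m" by (simp add: algebra_simps)
  then obtain r where r: "m = Suc r" "1 \<le> r" by (cases m) auto
  have "n div (l + 1) = m" unfolding m by (simp del: mult_Suc)
  then have "n div (l + 1) - 1 = r" using r by simp
  moreover have "0 \<le> k" using k by simp
  moreover have "k = real (l * Suc r)" using k r(1) by simp
  moreover have "n = Suc l * Suc r" using m r(1) by simp
  then have "dowker_diagram TYPE('k) (2 * l) (cycle_nodes n) (cycle_weight n) =
      replicate_mset r (real (l * Suc r), ereal (real (l * Suc r) + 1))"
    by (rule cycle_diagram_critical[OF assms(1,2) r(2)])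
  ultimately show ?thesis using True by (simp only: simp_thms if_True)
next
  case False
  have "n \<noteq> Suc l * Suc r" if "1 \<le> r" for r
  proof
    assume n: "n = Suc l * Suc r"
    have "real (n * l) = real (l * Suc r) * real (l + 1)" unfolding n by (simp add: algebra_simps)
    then have "k = real (l * Suc r)" unfolding assms(3) by simp
    moreover have "real n = real (l * Suc r) + real (Suc r)" using n by (simp add: algebra_simps)
    ultimately have "k \<le> real n - 2" using that by simp
    moreover have "(l + 1) dvd n" unfolding n Suc_eq_plus1 by (rule dvd_triv_left)
    ultimately show False using False by blast
  qed
  then have "dowker_diagram TYPE('k) (2 * l) (cycle_nodes n) (cycle_weight n) = {#}"
    by (rule cycle_diagram_trivial[OF assms(1,2)])
  moreover have "\<not> ((l + 1) dvd n \<and> 0 \<le> k \<and> k \<le> real n - 2)" using False by blast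
  ultimately show ?thesis by (simp only: if_False)
qed

end
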